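(* Let $V:G\to\mathbb{R}$ be a modular function and $\beta\in\mathbb{R}$. If a Borel probability measure $\alpha$ on $\Omega$ is a $C^*$-Gibbs probability with respect to $V$ and $\beta$, then $\alpha$ is a KMS probability for the modular function $\beta V$; that is, the associated functional $\hat\alpha$, determined by $\hat\alpha(A)=\int_\Omega A(x,x)\,d\alpha(x)$ for $A\in\mathcal{C}_c(G)$, is a state on $C^*_r(G)$ which satisfies the KMS boundary condition for the modular function $\beta V$.
   Context: Space: $d$ is a positive integer, $\Omega=\{1,\dots,d\}^{\mathbb{Z}\setminus\{0\}}$ with the product topology; points are written $(\dots,x_{-2},x_{-1}|x_1,x_2,\dots)$. Write $x\sim y$ (homoclinic) if $x_j\ne y_j$ for only finitely many $j$; $[x]$ is the (countable) class of $x$, and $G=\{(x,y)\in\Omega\times\Omega: x\sim y\}$. Symmetric conjugating homeomorphisms: for $n\ge1$ and two strings $x_{-n},\dots,x_{-1},x_1,\dots,x_n$ and $y_{-n},\dots,y_{-1},y_1,\dots,y_n$ in $\{1,\dots,d\}$, let $\mathcal{O}$ be the cylinder of $z\in\Omega$ with $z_j=x_j$ for $1\le|j|\le n$, and let $\varphi:\mathcal{O}\to\Omega$ replace the coordinates $z_j$, $1\le|j|\le n$, by $y_j$ and leave all other coordinates unchanged. $G$ carries the (Hausdorff) topology generated by the sets $\{(z,\varphi(z)):z\in\mathcal{O}\}$ over all such $(\mathcal{O},\varphi)$. Modular function: a continuous $V:G\to\mathbb{R}$ with $V(x,y)+V(y,z)=V(x,z)$ whenever $x\sim y\sim z$. $\alpha$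 is a $C^*$-Gibbs probability with respect to $\beta$ and $V$ if for every such $(\mathcal{O},\varphi)$ and every continuous $f:\Omega\to\mathbb{C}$: $\int_{\mathcal{O}}e^{-\beta V(z,\varphi(z))}f(\varphi(z))\,d\alpha(z)=\int_{\varphi(\mathcal{O})}f\,d\alpha$. $C^*$-algebra: $\mathcal{C}_c(G)$ is the space of continuous compactly supported $A:G\to\mathbb{C}$, with product $(A*B)(x,y)=\sum_{z\in[x]}A(x,z)B(z,y)$ and involution $A^*(x,y)=\overline{A(y,x)}$. For each class $[x]$ there is a representation on $\ell^2([x])$, $(\pi_{[x]}(A)\xi)(y)=\sum_{z\in[x]}A(y,z)\xi(z)$; $\|A\|=\sup_{[x]}\|\pi_{[x]}A\|$, and $C^*_r(G)$ is the completion of $\mathcal{C}_c(G)$ in this norm. Its unit is $I_D$, the indicator function of the diagonal $D=\{(x,x):x\in\Omega\}$. A state on $C^*_r(G)$ is a linear functional $\omega:C_r^*(G)\to\mathbb{C}$ with $\omega(A*A^* )\ge0$ for all $A$ and $\omega(I_D)=1$. For a modular function $W$, $(\sigma^tA)(x,y)=e^{iW(x,y)t}A(x,y)$, $t\in\mathbb{R}$, defines a one-parameter group of $*$-automorphisms of $\mathcal{C}_c(G)$, which extends uniquely to one of $C^*_r(G)$. A state $\omega$ satisfies the KMS boundary condition for $W$ if it is invariant ($\omega\circ\sigma^t=\omega$ for all $t\in\mathbb{R}$) and for all $A,B\in C^*_r(G)$ there is a continuous function $F$ on $\{z\in\mathbb{C}:0\le\mathrm{Im}\,z\le1\}$, holomorphic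 in $\{0<\mathrm{Im}\,z<1\}$, such that for all real $t$, $\omega((\sigma^tA)*B)=F(t)$ and $\omega(B*(\sigma^tA))=F(t+i)$. A probability $\nu$ on $\Omega$ is a KMS probability for $W$ if the state $\hat\nu$ on $C^*_r(G)$ determined by $\hat\nu(A)=\int A(x,x)\,d\nu(x)$, $A\in\mathcal{C}_c(G)$, satisfies the KMS boundary condition for $W$. *)

theory Defs
  imports "HOL-Probability.Probability" "HOL-Complex_Analysis.Complex_Analysis"
begin

type_synonym config = "int \<Rightarrow> nat"

text \<open>Configurations are functions on the nonzero integers, extensional at \<open>0\<close>.\<close>

definition Omega_top :: "nat \<Rightarrow> config topology" where
  "Omega_top d = product_topology (\<lambda>_. discrete_topology {1..d}) (- {0})"

definition Omega :: "nat \<Rightarrow> config set" where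
  "Omega d = topspace (Omega_top d)"

definition Borel_Omega :: "nat \<Rightarrow> config measure" where
  "Borel_Omega d = sigma (Omega d) {U. openin (Omega_top d) U}"

definition Borel_probability :: "nat \<Rightarrow> config measure \<Rightarrow> bool" where
  "Borel_probability d \<nu> \<longleftrightarrow> prob_space \<nu> \<and> sets \<nu> = sets (Borel_Omega d)"

definition homoclinic :: "config \<Rightarrow> config \<Rightarrow> bool" where
  "homoclinic x y \<longleftrightarrow> finite {j. j \<noteq> 0 \<and> x j \<noteq> y j}"

definition hclass :: "nat \<Rightarrow> config \<Rightarrow> config set" where
  "hclass d x = {y \<in> Omega d. homoclinic x y}"

definition G :: "nat \<Rightarrow> (config \<times> config) set" where
  "G d = {(x, y). x \<in> Omega d \<and> y \<in> Omega d \<and> homoclinic x y}"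

definition block :: "nat \<Rightarrow> int set" where
  "block n = {j. 1 \<le> \<bar>j\<bar> \<and> \<bar>j\<bar> \<le> int n}"

definition words :: "nat \<Rightarrow> nat \<Rightarrow> (int \<Rightarrow> nat) set" where
  "words d n = (block n \<rightarrow>\<^sub>E {1..d})"

definition cylinder :: "nat \<Rightarrow> nat \<Rightarrow> (int \<Rightarrow> nat) \<Rightarrow> config set" where
  "cylinder d n u = {z \<in> Omega d. \<forall>j\<in>block n. z j = u j}"

text \<open>On \<open>cylinder d n u\<close>, the map \<open>conj_map n w\<close> is the homeomorphism that replaces the
  word \<open>u\<close> by \<open>w\<close>; its formula does not involve \<open>u\<close>.\<close>

definition conj_map :: "nat \<Rightarrow> (int \<Rightarrow> nat) \<Rightarrow> config \<Rightarrow> config" where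
  "conj_map n w z = (\<lambda>j. if j \<in> block n then w j else z j)"

definition G_top :: "nat \<Rightarrow> (config \<times> config) topology" where
  "G_top d = topology_generated_by
     {(\<lambda>z. (z, conj_map n w z)) ` cylinder d n u | n u w.
        1 \<le> n \<and> u \<in> words d n \<and> w \<in> words d n}"

definition modular_function :: "nat \<Rightarrow> (config \<times> config \<Rightarrow> real) \<Rightarrow> bool" where
  "modular_function d V \<longleftrightarrow>
     continuous_map (G_top d) euclideanreal V \<and>
     (\<forall>x y z. (x, y) \<in> G d \<longrightarrow> (y, z) \<in> G d \<longrightarrow> V (x, y) + V (y, z) = V (x, z))"

definition Cstar_Gibbs ::
    "nat \<Rightarrow> real \<Rightarrow> (config \<times> config \<Rightarrow> real) \<Rightarrow> config measure \<Rightarrow> bool" where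
  "Cstar_Gibbs d \<beta> V \<alpha> \<longleftrightarrow>
     Borel_probability d \<alpha> \<and>
     (\<forall>n u w f. 1 \<le> n \<longrightarrow> u \<in> words d n \<longrightarrow> w \<in> words d n \<longrightarrow>
        continuous_map (Omega_top d) (euclidean :: complex topology) f \<longrightarrow>
        (LINT z:cylinder d n u|\<alpha>.
            complex_of_real (exp (- \<beta> * V (z, conj_map n w z))) * f (conj_map n w z))
        = (LINT z:conj_map n w ` cylinder d n u|\<alpha>. f z))"

type_synonym kernel = "config \<times> config \<Rightarrow> complex"

text \<open>Functions on \<open>G d\<close> are represented by their extension by zero, so that they are equal
  as kernels iff they agree on \<open>G d\<close>.\<close>

definition Cc :: "nat \<Rightarrow> kernel set" where
  "Cc d = {A. continuous_map (G_top d) euclidean A \<and>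
              compactin (G_top d) (G_top d closure_of {g \<in> G d. A g \<noteq> 0}) \<and>
              (\<forall>g. g \<notin> G d \<longrightarrow> A g = 0)}"

text \<open>For \<open>A\<close> in \<open>Cc d\<close> the row \<open>A (x, _)\<close> has finite support, so the unordered sum
  below is a finite one.\<close>

definition kconv :: "nat \<Rightarrow> kernel \<Rightarrow> kernel \<Rightarrow> kernel" where
  "kconv d A B = (\<lambda>(x, y). if (x, y) \<in> G d
                           then \<Sum>\<^sub>\<infinity>z\<in>hclass d x. A (x, z) * B (z, y) else 0)"

definition kstar :: "kernel \<Rightarrow> kernel" where
  "kstar A = (\<lambda>(x, y). cnj (A (y, x)))"

definition kunit :: "nat \<Rightarrow> kernel" where
  "kunit d = indicator {(x, x) | x. x \<in> Omega d}"

definition in_l2 :: "'a set \<Rightarrow> ('a \<Rightarrow> complex) \<Rightarrow> bool" where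
  "in_l2 S \<xi> \<longleftrightarrow> (\<lambda>y. (cmod (\<xi> y))\<^sup>2) summable_on S"

definition l2_norm :: "'a set \<Rightarrow> ('a \<Rightarrow> complex) \<Rightarrow> real" where
  "l2_norm S \<xi> = sqrt (\<Sum>\<^sub>\<infinity>y\<in>S. (cmod (\<xi> y))\<^sup>2)"

definition rep :: "nat \<Rightarrow> config \<Rightarrow> kernel \<Rightarrow> (config \<Rightarrow> complex) \<Rightarrow> config \<Rightarrow> complex" where
  "rep d x A \<xi> = (\<lambda>y. \<Sum>\<^sub>\<infinity>z\<in>hclass d x. A (y, z) * \<xi> z)"

definition rep_norm :: "nat \<Rightarrow> config \<Rightarrow> kernel \<Rightarrow> real" where
  "rep_norm d x A =
     (SUP \<xi>\<in>{\<xi>. in_l2 (hclass d x) \<xi> \<and> l2_norm (hclass d x) \<xi> \<le> 1}.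
        l2_norm (hclass d x) (rep d x A \<xi>))"

text \<open>For \<open>A\<close> in \<open>Cc d\<close> both suprema are finite: \<open>A\<close> is bounded, and the number of
  nonzero entries in a row or a column is bounded uniformly.\<close>

definition red_norm :: "nat \<Rightarrow> kernel \<Rightarrow> real" where
  "red_norm d A = (SUP x\<in>Omega d. rep_norm d x A)"

text \<open>The reduced algebra consists of the classes of Cauchy sequences in \<open>Cc d\<close>
  modulo sequences of norm tending to zero.\<close>

type_synonym cstar = "(nat \<Rightarrow> kernel) set"

definition Cauchy_seqs :: "nat \<Rightarrow> (nat \<Rightarrow> kernel) set" where
  "Cauchy_seqs d = {a. (\<forall>n. a n \<in> Cc d) \<and>
     (\<forall>e>0. \<exists>N. \<forall>m\<ge>N. \<forall>n\<ge>N. red_norm d (\<lambda>g. a m g - a n g) < e)}"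

definition cstar_rel :: "nat \<Rightarrow> ((nat \<Rightarrow> kernel) \<times> (nat \<Rightarrow> kernel)) set" where
  "cstar_rel d = {(a, b). a \<in> Cauchy_seqs d \<and> b \<in> Cauchy_seqs d \<and>
     (\<lambda>n. red_norm d (\<lambda>g. a n g - b n g)) \<longlonglongrightarrow> 0}"

definition Cstar :: "nat \<Rightarrow> cstar set" where
  "Cstar d = Cauchy_seqs d // cstar_rel d"

definition cstar_embed :: "nat \<Rightarrow> kernel \<Rightarrow> cstar" where
  "cstar_embed d A = cstar_rel d `` {\<lambda>_. A}"

text \<open>An operation on \<open>Cc d\<close> is extended to the completion by applying it termwise to
  representatives; every operation lifted below respects \<open>cstar_rel\<close>, so the union is over
  copies of a single class.\<close>

definition cstar_lift :: "nat \<Rightarrow> (kernel \<Rightarrow> kernel) \<Rightarrow> cstar \<Rightarrow> cstar" where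
  "cstar_lift d f X = (\<Union>a\<in>X. cstar_rel d `` {\<lambda>n. f (a n)})"

definition cstar_lift2 ::
    "nat \<Rightarrow> (kernel \<Rightarrow> kernel \<Rightarrow> kernel) \<Rightarrow> cstar \<Rightarrow> cstar \<Rightarrow> cstar" where
  "cstar_lift2 d f X Y = (\<Union>a\<in>X. \<Union>b\<in>Y. cstar_rel d `` {\<lambda>n. f (a n) (b n)})"

definition cstar_add :: "nat \<Rightarrow> cstar \<Rightarrow> cstar \<Rightarrow> cstar" where
  "cstar_add d = cstar_lift2 d (\<lambda>A B g. A g + B g)"

definition cstar_scale :: "nat \<Rightarrow> complex \<Rightarrow> cstar \<Rightarrow> cstar" where
  "cstar_scale d c = cstar_lift d (\<lambda>A g. c * A g)"

definition cstar_mult :: "nat \<Rightarrow> cstar \<Rightarrow> cstar \<Rightarrow> cstar" where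
  "cstar_mult d = cstar_lift2 d (kconv d)"

definition cstar_star :: "nat \<Rightarrow> cstar \<Rightarrow> cstar" where
  "cstar_star d = cstar_lift d kstar"

definition cstar_unit :: "nat \<Rightarrow> cstar" where
  "cstar_unit d = cstar_embed d (kunit d)"

definition is_state :: "nat \<Rightarrow> (cstar \<Rightarrow> complex) \<Rightarrow> bool" where
  "is_state d \<omega> \<longleftrightarrow>
     (\<forall>X\<in>Cstar d. \<forall>Y\<in>Cstar d. \<omega> (cstar_add d X Y) = \<omega> X + \<omega> Y) \<and>
     (\<forall>c. \<forall>X\<in>Cstar d. \<omega> (cstar_scale d c X) = c * \<omega> X) \<and>
     (\<forall>X\<in>Cstar d. \<omega> (cstar_mult d X (cstar_star d X)) \<in> \<real>\<^sub>\<ge>\<^sub>0) \<and>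
     \<omega> (cstar_unit d) = 1"

definition kflow :: "(config \<times> config \<Rightarrow> real) \<Rightarrow> real \<Rightarrow> kernel \<Rightarrow> kernel" where
  "kflow W t A = (\<lambda>g. exp (\<i> * complex_of_real (W g * t)) * A g)"

definition cstar_flow ::
    "nat \<Rightarrow> (config \<times> config \<Rightarrow> real) \<Rightarrow> real \<Rightarrow> cstar \<Rightarrow> cstar" where
  "cstar_flow d W t = cstar_lift d (kflow W t)"

definition KMS_condition ::
    "nat \<Rightarrow> (config \<times> config \<Rightarrow> real) \<Rightarrow> (cstar \<Rightarrow> complex) \<Rightarrow> bool" where
  "KMS_condition d W \<omega> \<longleftrightarrow>
     (\<forall>t. \<forall>X\<in>Cstar d. \<omega> (cstar_flow d W t X) = \<omega> X) \<and>
     (\<forall>X\<in>Cstar d. \<forall>Y\<in>Cstar d. \<exists>F :: complex \<Rightarrow> complex.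
        continuous_on {z. 0 \<le> Im z \<and> Im z \<le> 1} F \<and>
        F holomorphic_on {z. 0 < Im z \<and> Im z < 1} \<and>
        (\<forall>t::real.
           \<omega> (cstar_mult d (cstar_flow d W t X) Y) = F (complex_of_real t) \<and>
           \<omega> (cstar_mult d Y (cstar_flow d W t X)) = F (complex_of_real t + \<i>)))"

text \<open>The functional \<open>A \<mapsto> \<integral>A(x,x) d\<nu>(x)\<close> on \<open>Cc d\<close> is bounded by the reduced
  norm, because \<open>A(x,x)\<close> is a diagonal matrix entry in the representation on the class of
  \<open>x\<close>; \<open>hat\<close> is its continuous extension to the completion.\<close>

definition hat :: "config measure \<Rightarrow> cstar \<Rightarrow> complex" where
  "hat \<nu> X = (THE c. \<forall>a\<in>X. (\<lambda>n. LINT x|\<nu>. a n (x, x)) \<longlonglongrightarrow> c)"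

definition KMS_probability ::
    "nat \<Rightarrow> (config \<times> config \<Rightarrow> real) \<Rightarrow> config measure \<Rightarrow> bool" where
  "KMS_probability d W \<nu> \<longleftrightarrow>
     Borel_probability d \<nu> \<and>
     (\<forall>A\<in>Cc d. hat \<nu> (cstar_embed d A) = (LINT x|\<nu>. A (x, x))) \<and>
     is_state d (hat \<nu>) \<and>
     KMS_condition d W (hat \<nu>)"

end

theory Submission
  imports Defs
begin

text \<open>For \<open>A\<close>, \<open>B\<close> in \<open>Cc d\<close> and \<open>W = \<beta> V\<close>, the function
  \<open>F z = \<integral> \<Sum>\<^sub>y exp (\<i> W(x, y) z) A(x, y) B(y, x) d\<alpha>(x)\<close> is entire, since the inner sum runs over the
  finitely many \<open>y\<close> that differ from \<open>x\<close> inside a fixed block. On the real line it is visibly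
  \<open>\<omega> ((\<sigma>\<^sup>t A) * B)\<close>; on the line \<open>Im z = 1\<close> the extra weight \<open>exp (- W(x, y))\<close> is exactly what the
  Gibbs relation needs to exchange the roles of \<open>x\<close> and \<open>y\<close>, which gives \<open>\<omega> (B * (\<sigma>\<^sup>t A))\<close>.
  For general elements of the completion, \<open>F\<close> is the uniform limit on the closed strip of the
  functions attached to approximating kernels: the diagonal integral is dominated by the reduced
  norm and the flow is isometric, so these functions are uniformly Cauchy on the two boundary lines,
  and the maximum principle for bounded functions on a strip carries this over to the interior.\<close>

subsection \<open>The topology of the homoclinic groupoid\<close>

text \<open>Two obstacles shape the argument. First, \<open>rep_norm\<close> and
  \<open>red_norm\<close> are real suprema, which say nothing until the sets involved are known to
  be bounded. Hence the a priori bound from counting matrix entries comes before any property of the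
  norm, and from then on the norm is handled through \<open>op_bound\<close> alone. Second, a
  modular function is bounded on each band, which is compact, but it need not be bounded on all of
  \<open>G d\<close>. So the flow at complex time makes sense on compactly supported kernels but has
  no norm bound, and approximating kernels can be compared only on the two lines where the flow has
  real time. This is why an a priori bound for \<open>F\<close> on the strip, depending on the
  kernel, is needed beside the bounds on the boundary.

  Integration over rows and columns rests on one device: the neighbours of \<open>x\<close> inside a
  window are the points \<open>conj_map N w x\<close>, with \<open>w\<close> in the finite set
  \<open>words d N\<close> that does not depend on \<open>x\<close>. Sums over neighbours become
  finite sums of continuous functions of \<open>x\<close>.\<close>

definition band :: "nat \<Rightarrow> nat \<Rightarrow> (config \<times> config) set" where
  "band d n = {(x, y). x \<in> Omega d \<and> y \<in> Omega d \<and> (\<forall>j. j \<notin> block n \<longrightarrow> x j = y j)}"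

text \<open>The graph of a conjugating homeomorphism. Only the letters of \<open>x\<close> and
  \<open>y\<close> on \<open>block n\<close> enter, so points can stand in for words, and
  neighbourhoods of \<open>(x, y)\<close> are named by the pair itself.\<close>

definition slice :: "nat \<Rightarrow> nat \<Rightarrow> config \<Rightarrow> config \<Rightarrow> (config \<times> config) set" where
  "slice d n x y = (\<lambda>z. (z, conj_map n y z)) ` cylinder d n x"

lemma Omega_iff: "x \<in> Omega d \<longleftrightarrow> x \<in> (- {0}) \<rightarrow>\<^sub>E {1..d}"
  by (simp add: Omega_def Omega_top_def)

lemma topspace_Omega [simp]: "topspace (Omega_top d) = Omega d"
  by (simp add: Omega_def)

lemma zero_notin_block [simp]: "0 \<notin> block n"
  by (simp add: block_def)

lemma finite_block: "finite (block n)"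
  by (rule finite_subset[of _ "{- int n..int n}"]) (auto simp: block_def)

lemma block_mono: "m \<le> n \<Longrightarrow> block m \<subseteq> block n"
  by (auto simp: block_def)

lemma block_exhaust:
  assumes "finite (I :: int set)" "0 \<notin> I"
  shows "\<exists>n\<ge>1. I \<subseteq> block n"
proof -
  have "\<exists>n. \<forall>j\<in>I. nat \<bar>j\<bar> \<le> n"
    using finite_imageI[OF assms(1), of "\<lambda>j. nat \<bar>j\<bar>"] by (auto simp: finite_nat_set_iff_bounded_le)
  then obtain n where n: "\<And>j. j \<in> I \<Longrightarrow> nat \<bar>j\<bar> \<le> n" by blast
  have "I \<subseteq> block (max n 1)"
  proof
    fix j assume "j \<in> I"
    then have "j \<noteq> 0" "nat \<bar>j\<bar> \<le> n" using assms(2) n by auto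
    then show "j \<in> block (max n 1)" by (auto simp: block_def)
  qed
  then show ?thesis by (intro exI[of _ "max n 1"]) auto
qed

lemma OmegaD: "x \<in> Omega d \<Longrightarrow> j \<noteq> 0 \<Longrightarrow> x j \<in> {1..d}"
  by (auto simp: Omega_iff PiE_iff)

lemma Omega_in_block: "x \<in> Omega d \<Longrightarrow> j \<in> block n \<Longrightarrow> x j \<in> {1..d}"
  using OmegaD by (metis zero_notin_block)

lemma words_in_block: "w \<in> words d n \<Longrightarrow> j \<in> block n \<Longrightarrow> w j \<in> {1..d}"
  by (auto simp: words_def PiE_iff)

lemma finite_words: "finite (words d n)"
  unfolding words_def by (intro finite_PiE finite_block) auto

lemma conj_map_Omega:
  assumes "x \<in> Omega d" "\<And>j. j \<in> block n \<Longrightarrow> w j \<in> {1..d}"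
  shows "conj_map n w x \<in> Omega d"
  using assms unfolding Omega_iff conj_map_def PiE_iff extensional_def by auto

lemma conj_map_words: "x \<in> Omega d \<Longrightarrow> w \<in> words d n \<Longrightarrow> conj_map n w x \<in> Omega d"
  using conj_map_Omega words_in_block by blast

lemma conj_map_cong: "(\<And>j. j \<in> block n \<Longrightarrow> w j = v j) \<Longrightarrow> conj_map n w = conj_map n v"
  by (auto simp: conj_map_def fun_eq_iff)

lemma restrict_words: "x \<in> Omega d \<Longrightarrow> restrict x (block n) \<in> words d n"
  unfolding words_def using Omega_in_block by auto

lemma cylinder_restrict: "cylinder d n (restrict x (block n)) = cylinder d n x"
  by (auto simp: cylinder_def)

lemma conj_map_restrict: "conj_map n (restrict x (block n)) = conj_map n x"
  by (rule conj_map_cong) simp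

lemma cylinder_mono: "m \<le> n \<Longrightarrow> cylinder d n x \<subseteq> cylinder d m x"
  using block_mono by (force simp: cylinder_def)

lemma cylinder_self: "x \<in> Omega d \<Longrightarrow> x \<in> cylinder d n x"
  by (simp add: cylinder_def)

lemma cylinder_subset: "cylinder d n u \<subseteq> Omega d"
  by (auto simp: cylinder_def)

text \<open>A basic open set of the product restricts finitely many coordinates, all contained in
  one block; conversely a cylinder is a product with at most one letter allowed at each position of
  its block.\<close>

lemma openin_Omega_iff:
  "openin (Omega_top d) U \<longleftrightarrow> U \<subseteq> Omega d \<and> (\<forall>x\<in>U. \<exists>n\<ge>1. cylinder d n x \<subseteq> U)"
proof
  assume U: "openin (Omega_top d) U"
  have "\<exists>n\<ge>1. cylinder d n x \<subseteq> U" if xU: "x \<in> U" for x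
  proof -
    obtain W where W: "finite {i \<in> - {0}. W i \<noteq> {1..d}}" "x \<in> Pi\<^sub>E (- {0}) W" "Pi\<^sub>E (- {0}) W \<subseteq> U"
    proof -
      have "\<exists>W. finite {i \<in> - {0}. W i \<noteq> topspace (discrete_topology {1..d})} \<and>
          (\<forall>i\<in>- {0}. openin (discrete_topology {1..d}) (W i)) \<and> x \<in> Pi\<^sub>E (- {0}) W \<and> Pi\<^sub>E (- {0}) W \<subseteq> U"
        using U[unfolded Omega_top_def openin_product_topology_alt] xU by (rule bspec)
      then show ?thesis using that by (elim exE conjE) simp
    qed
    obtain n where n: "n \<ge> 1" "{i \<in> - {0}. W i \<noteq> {1..d}} \<subseteq> block n"
      using block_exhaust[OF W(1)] by auto
    have "cylinder d n x \<subseteq> Pi\<^sub>E (- {0}) W"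
    proof
      fix z assume z: "z \<in> cylinder d n x"
      then have zO: "z \<in> Omega d" by (simp add: cylinder_def)
      show "z \<in> Pi\<^sub>E (- {0}) W"
      proof (rule PiE_I)
        fix i :: int assume i: "i \<in> - {0}"
        show "z i \<in> W i"
        proof (cases "i \<in> block n")
          case True
          then show ?thesis using z W(2) i by (auto simp: cylinder_def PiE_iff)
        next
          case False
          then have "W i = {1..d}" using n i by auto
          then show ?thesis using OmegaD[OF zO] i by auto
        qed
      next
        fix i :: int assume "i \<notin> - {0}"
        then show "z i = undefined" using zO by (auto simp: Omega_iff PiE_iff extensional_def)
      qed
    qed
    then show ?thesis using n(1) W(3) by blast
  qed
  then show "U \<subseteq> Omega d \<and> (\<forall>x\<in>U. \<exists>n\<ge>1. cylinder d n x \<subseteq> U)"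
    using openin_subset[OF U] by auto
next
  assume R: "U \<subseteq> Omega d \<and> (\<forall>x\<in>U. \<exists>n\<ge>1. cylinder d n x \<subseteq> U)"
  have cyl: "openin (Omega_top d) (cylinder d n x)" for n x
  proof -
    \<comment> \<open>Here \<open>x\<close> is an arbitrary function; intersecting with
      \<open>{1..d}\<close> keeps every factor open in the discrete alphabet, and the product is
      empty when some letter of \<open>x\<close> on the block is invalid.\<close>
    have "cylinder d n x =
        Pi\<^sub>E (- {0}) (\<lambda>j. if j \<in> block n then {x j} \<inter> {1..d} else {1..d})" (is "_ = Pi\<^sub>E _ ?W")
    proof (intro set_eqI iffI)
      fix z assume "z \<in> cylinder d n x"
      then show "z \<in> Pi\<^sub>E (- {0}) ?W"
        using OmegaD[of z d] unfolding cylinder_def Omega_iff by (force simp: PiE_iff)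
    next
      fix z assume z: "z \<in> Pi\<^sub>E (- {0}) ?W"
      have zi: "z i \<in> ?W i" if "i \<noteq> 0" for i using z that by (auto simp: PiE_iff)
      have "z \<in> Omega d" unfolding Omega_iff
      proof (rule PiE_I)
        fix i :: int assume "i \<in> - {0}"
        then show "z i \<in> {1..d}" using zi[of i] by (cases "i \<in> block n") auto
      next
        fix i :: int assume "i \<notin> - {0}"
        then show "z i = undefined" using z by (auto simp: PiE_iff extensional_def)
      qed
      moreover have "z j = x j" if "j \<in> block n" for j
        using zi[of j] that zero_notin_block[of n] by (cases "j = 0") auto
      ultimately show "z \<in> cylinder d n x" by (simp add: cylinder_def)
    qed
    moreover have "openin (Omega_top d) (Pi\<^sub>E (- {0}) ?W)"
      unfolding Omega_top_def
      by (rule product_topology_basis)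
        (auto intro!: finite_subset[OF _ finite_block[of n]] split: if_splits)
    ultimately show ?thesis by simp
  qed
  have "U = (\<Union>{cylinder d n x | n x. cylinder d n x \<subseteq> U})"
  proof (intro equalityI subsetI)
    fix x assume x: "x \<in> U"
    then obtain n where "cylinder d n x \<subseteq> U" using R by blast
    moreover have "x \<in> cylinder d n x" using x R cylinder_self by blast
    ultimately show "x \<in> (\<Union>{cylinder d n x | n x. cylinder d n x \<subseteq> U})" by blast
  qed blast
  also have "openin (Omega_top d) \<dots>"
    using cyl by (intro openin_Union) auto
  finally show "openin (Omega_top d) U" .
qed

lemma openin_cylinder: "openin (Omega_top d) (cylinder d n x)"
  if "n \<ge> 1"
  unfolding openin_Omega_iff
proof (intro conjI ballI cylinder_subset)
  fix y assume "y \<in> cylinder d n x"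
  then have "cylinder d n y \<subseteq> cylinder d n x" by (auto simp: cylinder_def)
  then show "\<exists>m\<ge>1. cylinder d m y \<subseteq> cylinder d n x" using that by blast
qed

lemma compact_Omega: "compact_space (Omega_top d)"
  unfolding Omega_top_def compact_space_product_topology
  by (auto simp: compact_space_discrete_topology)

lemma band_sym: "(x, y) \<in> band d n \<Longrightarrow> (y, x) \<in> band d n"
  by (auto simp: band_def)

lemma band_refl: "x \<in> Omega d \<Longrightarrow> (x, x) \<in> band d n"
  by (auto simp: band_def)

lemma band_trans: "(x, y) \<in> band d n \<Longrightarrow> (y, z) \<in> band d n \<Longrightarrow> (x, z) \<in> band d n"
  by (auto simp: band_def)

lemma band_mono: "m \<le> n \<Longrightarrow> band d m \<subseteq> band d n"
  using block_mono by (fastforce simp: band_def)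

lemma G_iff_band: "g \<in> G d \<longleftrightarrow> (\<exists>n\<ge>1. g \<in> band d n)"
proof
  assume "g \<in> G d"
  then obtain x y where g: "g = (x, y)" "x \<in> Omega d" "y \<in> Omega d" "finite {j. j \<noteq> 0 \<and> x j \<noteq> y j}"
    by (auto simp: G_def homoclinic_def)
  obtain n where n: "n \<ge> 1" "{j. j \<noteq> 0 \<and> x j \<noteq> y j} \<subseteq> block n"
    using block_exhaust[OF g(4)] by auto
  have "x j = y j" if "j \<notin> block n" for j
  \<comment> \<open>Homoclinic points are compared only at nonzero positions; at \<open>0\<close>
    both take the value \<open>undefined\<close> because configurations are extensional.\<close>
  proof (cases "j = 0")
    case True
    then show ?thesis using g(2,3) by (auto simp: Omega_iff PiE_iff extensional_def)
  qed (use n that in auto)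
  then show "\<exists>n\<ge>1. g \<in> band d n" using g n by (auto simp: band_def)
next
  assume "\<exists>n\<ge>1. g \<in> band d n"
  then obtain n where n: "g \<in> band d n" by blast
  then have "finite {j. j \<noteq> 0 \<and> fst g j \<noteq> snd g j}"
    by (intro finite_subset[OF _ finite_block[of n]]) (auto simp: band_def)
  then show "g \<in> G d" using n by (auto simp: G_def homoclinic_def band_def)
qed

lemma band_subset_G: "band d n \<subseteq> G d"
proof
  fix g assume "g \<in> band d n"
  then have "g \<in> band d (max n 1)" using band_mono[of n "max n 1"] by auto
  then show "g \<in> G d" using G_iff_band by (meson max.cobounded2)
qed

lemma G_sym: "(x, y) \<in> G d \<Longrightarrow> (y, x) \<in> G d"
  using band_sym by (auto simp: G_iff_band)

lemma G_refl: "x \<in> Omega d \<Longrightarrow> (x, x) \<in> G d"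
  using band_refl band_subset_G by blast

lemma G_trans: "(x, y) \<in> G d \<Longrightarrow> (y, z) \<in> G d \<Longrightarrow> (x, z) \<in> G d"
proof -
  assume "(x, y) \<in> G d" "(y, z) \<in> G d"
  then obtain m n where "(x, y) \<in> band d m" "(y, z) \<in> band d n" by (auto simp: G_iff_band)
  then have "(x, y) \<in> band d (max m n)" "(y, z) \<in> band d (max m n)"
    using band_mono[of _ "max m n"] by (meson max.cobounded1 max.cobounded2 subsetD)+
  then show "(x, z) \<in> G d" using band_trans band_subset_G by blast
qed

lemma G_Omega: "(x, y) \<in> G d \<Longrightarrow> x \<in> Omega d \<and> y \<in> Omega d"
  by (auto simp: G_def)

lemma hclass_iff: "x \<in> Omega d \<Longrightarrow> y \<in> hclass d x \<longleftrightarrow> (x, y) \<in> G d"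
  by (auto simp: G_def hclass_def)

lemma conj_map_band:
  "x \<in> Omega d \<Longrightarrow> w \<in> words d n \<Longrightarrow> (x, conj_map n w x) \<in> band d n"
  by (simp add: band_def conj_map_words) (auto simp: conj_map_def)

lemma band_conj_map: "(x, y) \<in> band d n \<Longrightarrow> conj_map n y x = y"
  by (auto simp: band_def conj_map_def)

lemma slice_band: "x \<in> Omega d \<Longrightarrow> y \<in> Omega d \<Longrightarrow> slice d n x y \<subseteq> band d n"
  unfolding slice_def cylinder_def using conj_map_Omega Omega_in_block
  by (auto simp: band_def conj_map_def)

lemma slice_self: "(x, y) \<in> band d n \<Longrightarrow> (x, y) \<in> slice d n x y"
  unfolding slice_def using band_conj_map cylinder_self
  by (metis (mono_tags, lifting) G_Omega band_subset_G imageI subsetD)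

lemma mem_slice_iff:
  "(a, b) \<in> slice d n x y \<longleftrightarrow> a \<in> cylinder d n x \<and> b = conj_map n y a"
  by (auto simp: slice_def)

text \<open>Between the blocks of size \<open>m\<close> and \<open>n\<close> the points
  \<open>x\<close> and \<open>y\<close> agree, and \<open>z\<close> already carries the letters of
  \<open>x\<close> there; the larger replacement changes nothing more.\<close>

lemma conj_map_mono:
  assumes "(x, y) \<in> band d m" "m \<le> n" "z \<in> cylinder d n x"
  shows "conj_map n y z = conj_map m y z"
proof
  fix j
  show "conj_map n y z j = conj_map m y z j"
    using assms block_mono[OF assms(2)] by (auto simp: conj_map_def cylinder_def band_def)
qed

text \<open>Slices around one point are nested, so they behave as a neighbourhood basis although the
  generating family of \<open>G_top\<close> is only given as a subbasis.\<close>

lemma slice_mono: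
  assumes "(x, y) \<in> band d m" "m \<le> n"
  shows "slice d n x y \<subseteq> slice d m x y"
proof
  fix g assume "g \<in> slice d n x y"
  then obtain z where z: "g = (z, conj_map n y z)" "z \<in> cylinder d n x" by (auto simp: slice_def)
  then show "g \<in> slice d m x y"
    using conj_map_mono[OF assms z(2)] cylinder_mono[OF assms(2)] by (auto simp: slice_def)
qed

lemma slice_basis:
  assumes "n \<ge> 1" "x \<in> Omega d" "y \<in> Omega d"
  shows "openin (G_top d) (slice d n x y)"
proof -
  have "slice d n x y \<in> {(\<lambda>z. (z, conj_map n w z)) ` cylinder d n u | n u w.
        1 \<le> n \<and> u \<in> words d n \<and> w \<in> words d n}"
    using assms restrict_words[of x d n] restrict_words[of y d n]
    by (intro CollectI exI[of _ n] exI[of _ "restrict x (block n)"] exI[of _ "restrict y (block n)"])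
      (simp add: slice_def cylinder_restrict conj_map_restrict)
  then show ?thesis unfolding G_top_def by (rule topology_generated_by_Basis)
qed

lemma topspace_G [simp]: "topspace (G_top d) = G d"
proof -
  have "g \<in> G d" if "g \<in> (\<lambda>z. (z, conj_map n w z)) ` cylinder d n u" "w \<in> words d n" for g n u w
    using that conj_map_band[of _ d w n] band_subset_G[of d n] by (auto simp: cylinder_def)
  then have "topspace (G_top d) \<subseteq> G d" unfolding G_top_def topology_generated_by_topspace by fast
  moreover have "G d \<subseteq> topspace (G_top d)"
  proof
    fix g assume g: "g \<in> G d"
    obtain x y where [simp]: "g = (x, y)" by (cases g)
    obtain n where n: "n \<ge> 1" "(x, y) \<in> band d n" using g G_iff_band by auto
    then have "openin (G_top d) (slice d n x y)" using slice_basis G_Omega g by auto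
    then show "g \<in> topspace (G_top d)" using slice_self[OF n(2)] openin_subset by auto
  qed
  ultimately show ?thesis by blast
qed

text \<open>Induction over the generation of the topology; the intersection case takes the larger of
  two depths, which is where nestedness of slices enters. All later continuity proofs on
  \<open>G d\<close> go through this local description.\<close>

lemma openin_G_iff:
  "openin (G_top d) U \<longleftrightarrow> U \<subseteq> G d \<and>
     (\<forall>x y. (x, y) \<in> U \<longrightarrow> (\<exists>n\<ge>1. (x, y) \<in> band d n \<and> slice d n x y \<subseteq> U))" (is "_ \<longleftrightarrow> ?R U")
proof
  assume U: "openin (G_top d) U"
  have "\<exists>n\<ge>1. (x, y) \<in> band d n \<and> slice d n x y \<subseteq> U" if "(x, y) \<in> U" for x y
    using openin_topology_generated_by[OF U[unfolded G_top_def]] that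
  proof (induction arbitrary: x y rule: generate_topology_on.induct)
    case (Int a b)
    obtain m where m: "m \<ge> 1" "(x, y) \<in> band d m" "slice d m x y \<subseteq> a" using Int by blast
    obtain n where n: "n \<ge> 1" "(x, y) \<in> band d n" "slice d n x y \<subseteq> b" using Int by blast
    have "(x, y) \<in> band d (max m n)" using m(2) band_mono[of m "max m n"] by auto
    moreover have "slice d (max m n) x y \<subseteq> a \<inter> b"
      using slice_mono[OF m(2), of "max m n"] slice_mono[OF n(2), of "max m n"] m(3) n(3) by auto
    ultimately show ?case using m(1) by (intro exI[of _ "max m n"]) auto
  next
    case (UN K)
    then obtain k where k: "k \<in> K" "(x, y) \<in> k" by auto
    then obtain n where "n \<ge> 1" "(x, y) \<in> band d n" "slice d n x y \<subseteq> k" using UN by blast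
    then show ?case using k by blast
  next
    case (Basis s)
    then obtain n u w where s: "s = (\<lambda>z. (z, conj_map n w z)) ` cylinder d n u" "1 \<le> n"
      "u \<in> words d n" "w \<in> words d n" by auto
    then have xy: "x \<in> cylinder d n u" "y = conj_map n w x" using Basis by auto
    then have "(x, y) \<in> band d n" using conj_map_band s(4) by (auto simp: cylinder_def)
    \<comment> \<open>\<open>y\<close> is the image of \<open>x\<close> under the replacement by
      \<open>w\<close>, so on the block it spells exactly \<open>w\<close>.\<close>
    moreover have "conj_map n y = conj_map n w" using xy by (intro conj_map_cong) (auto simp: conj_map_def)
    moreover have "cylinder d n x \<subseteq> cylinder d n u" using xy by (auto simp: cylinder_def)
    ultimately have "slice d n x y \<subseteq> s" unfolding s(1) slice_def by (metis image_mono)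
    then show ?case using s \<open>(x, y) \<in> band d n\<close> by blast
  qed auto
  then show "?R U" using openin_subset[OF U] by auto
next
  assume R: "?R U"
  have "U = \<Union>{slice d n x y | n x y. n \<ge> 1 \<and> (x, y) \<in> band d n \<and> slice d n x y \<subseteq> U}" (is "U = \<Union>?S")
  proof (intro equalityI subsetI)
    fix g assume g: "g \<in> U"
    obtain x y where [simp]: "g = (x, y)" by (cases g)
    obtain n where n: "n \<ge> 1" "(x, y) \<in> band d n" "slice d n x y \<subseteq> U"
      using g R \<open>g = (x, y)\<close> by metis
    then have "slice d n x y \<in> ?S" by blast
    then show "g \<in> \<Union>?S" using slice_self[OF n(2)] by auto
  qed blast
  also have "openin (G_top d) (\<Union>?S)"
    using slice_basis G_Omega band_subset_G by (intro openin_Union) blast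
  finally show "openin (G_top d) U" .
qed

section \<open>Continuous maps into, out of and on the groupoid\<close>

lemma continuous_map_Omega_G:
  assumes w: "w \<in> words d N"
  shows "continuous_map (Omega_top d) (G_top d) (\<lambda>x. (x, conj_map N w x))"
  unfolding continuous_map
proof (intro conjI allI impI)
  show "(\<lambda>x. (x, conj_map N w x)) ` topspace (Omega_top d) \<subseteq> topspace (G_top d)"
    using conj_map_band[OF _ w] band_subset_G by fastforce
  fix U assume U: "openin (G_top d) U"
  show "openin (Omega_top d) {x \<in> topspace (Omega_top d). (x, conj_map N w x) \<in> U}"
    unfolding openin_Omega_iff
  proof (intro conjI ballI)
    fix x assume "x \<in> {x \<in> topspace (Omega_top d). (x, conj_map N w x) \<in> U}"
    then have x: "x \<in> Omega d" "(x, conj_map N w x) \<in> U" by auto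
    obtain n where n: "n \<ge> 1" "slice d n x (conj_map N w x) \<subseteq> U"
      "(x, conj_map N w x) \<in> band d n" using U x(2) unfolding openin_G_iff by blast
    \<comment> \<open>At depth \<open>max n N\<close> the cylinder fixes enough letters of
      \<open>x\<close> for the replacement on \<open>block N\<close> and the one defining the slice
      to coincide.\<close>
    have "cylinder d (max n N) x \<subseteq> {x \<in> topspace (Omega_top d). (x, conj_map N w x) \<in> U}"
    proof
      fix z assume z: "z \<in> cylinder d (max n N) x"
      have "conj_map N w z = conj_map N (conj_map N w x) z" by (auto simp: conj_map_def)
      also have "\<dots> = conj_map (max n N) (conj_map N w x) z"
        using conj_map_mono[OF conj_map_band[OF x(1) w] _ z] by simp
      finally have "(z, conj_map N w z) \<in> slice d (max n N) x (conj_map N w x)"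
        using z by (simp add: mem_slice_iff)
      then have "(z, conj_map N w z) \<in> U" using slice_mono[OF n(3), of "max n N"] n(2) by auto
      then show "z \<in> {x \<in> topspace (Omega_top d). (x, conj_map N w x) \<in> U}"
        using z by (auto simp: cylinder_def)
    qed
    then show "\<exists>n\<ge>1. cylinder d n x \<subseteq> {x \<in> topspace (Omega_top d). (x, conj_map N w x) \<in> U}"
      using n(1) by (meson max.coboundedI1)
  qed auto
qed

lemma block_0 [simp]: "block 0 = {}"
  by (auto simp: block_def)

lemma words_0: "words d 0 = {\<lambda>_. undefined}"
  by (simp add: words_def)

lemma conj_map_0 [simp]: "conj_map 0 w x = x"
  by (simp add: conj_map_def)

lemma continuous_map_diagonal: "continuous_map (Omega_top d) (G_top d) (\<lambda>x. (x, x))"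
  using continuous_map_Omega_G[of "\<lambda>_. undefined" d 0] by (simp add: words_0)

lemma continuous_map_fst_G: "continuous_map (G_top d) (Omega_top d) fst"
  unfolding continuous_map
proof (intro conjI allI impI)
  show "fst ` topspace (G_top d) \<subseteq> topspace (Omega_top d)" using G_Omega by auto
  fix U assume U: "openin (Omega_top d) U"
  show "openin (G_top d) {g \<in> topspace (G_top d). fst g \<in> U}"
    unfolding openin_G_iff
  proof (intro conjI allI impI)
    fix x y assume "(x, y) \<in> {g \<in> topspace (G_top d). fst g \<in> U}"
    then have xy: "(x, y) \<in> G d" "x \<in> U" by auto
    obtain n where n: "n \<ge> 1" "(x, y) \<in> band d n" using xy(1) G_iff_band by blast
    obtain m where m: "m \<ge> 1" "cylinder d m x \<subseteq> U" using U xy(2) openin_Omega_iff by blast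
    have b: "(x, y) \<in> band d (max m n)" using n band_mono[of n "max m n"] by auto
    have "slice d (max m n) x y \<subseteq> {g \<in> topspace (G_top d). fst g \<in> U}"
      using subset_trans[OF slice_band band_subset_G, of x d y "max m n"] G_Omega[OF xy(1)]
        subset_trans[OF cylinder_mono[of m "max m n" d x] m(2)]
      by (force simp: mem_slice_iff)
    then show "\<exists>n\<ge>1. (x, y) \<in> band d n \<and> slice d n x y \<subseteq> {g \<in> topspace (G_top d). fst g \<in> U}"
      using b m(1) by (meson max.coboundedI1)
  qed auto
qed

text \<open>It suffices to map slices into slices of the same depth, and only for all large depths:
  a threshold \<open>M\<close> is allowed because translations respect slices only once their window
  is contained in the block.\<close>

lemma continuous_map_G_G:
  assumes f: "f \<in> G d \<rightarrow> G d"
    and sl: "\<And>x y x' y'. (x, y) \<in> G d \<Longrightarrow> f (x, y) = (x', y') \<Longrightarrow>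
      \<exists>M. \<forall>n\<ge>M. (x, y) \<in> band d n \<longrightarrow> f ` slice d n x y \<subseteq> slice d n x' y'"
  shows "continuous_map (G_top d) (G_top d) f"
  unfolding continuous_map
proof (intro conjI allI impI)
  show "f ` topspace (G_top d) \<subseteq> topspace (G_top d)" using f by auto
  fix U assume U: "openin (G_top d) U"
  show "openin (G_top d) {g \<in> topspace (G_top d). f g \<in> U}"
    unfolding openin_G_iff
  proof (intro conjI allI impI)
    fix x y assume "(x, y) \<in> {g \<in> topspace (G_top d). f g \<in> U}"
    then have xy: "(x, y) \<in> G d" "f (x, y) \<in> U" by auto
    obtain x' y' where f': "f (x, y) = (x', y')" by fastforce
    obtain M where M: "\<And>n. n \<ge> M \<Longrightarrow> (x, y) \<in> band d n \<Longrightarrow> f ` slice d n x y \<subseteq> slice d n x' y'"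
      using sl[OF xy(1) f'] by blast
    obtain k where k: "k \<ge> 1" "(x, y) \<in> band d k" using xy(1) G_iff_band by blast
    obtain m where m: "(x', y') \<in> band d m" "slice d m x' y' \<subseteq> U"
      using U xy(2) f' openin_G_iff by metis
    define n where "n = max M (max k m)"
    have b: "(x, y) \<in> band d n" using subsetD[OF band_mono k(2), of n] by (simp add: n_def)
    have "f ` slice d n x y \<subseteq> slice d n x' y'" using M[OF _ b] by (simp add: n_def)
    also have "\<dots> \<subseteq> U" using subset_trans[OF slice_mono[OF m(1), of n] m(2)] by (simp add: n_def)
    finally have "slice d n x y \<subseteq> {g \<in> topspace (G_top d). f g \<in> U}"
      using subset_trans[OF slice_band[of x d y n] band_subset_G] G_Omega[OF xy(1)] by auto
    then show "\<exists>n\<ge>1. (x, y) \<in> band d n \<and> slice d n x y \<subseteq> {g \<in> topspace (G_top d). f g \<in> U}"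
      using b k(1) by (intro exI[of _ n]) (auto simp: n_def)
  qed auto
qed

text \<open>The swapped slice is the graph of the inverse homeomorphism, which writes the letters of
  \<open>x\<close> back. This is continuity of inversion in the groupoid.\<close>

lemma continuous_map_swap: "continuous_map (G_top d) (G_top d) prod.swap"
proof (rule continuous_map_G_G)
  show "prod.swap \<in> G d \<rightarrow> G d" using G_sym by auto
  fix x y x' y' assume xy: "(x, y) \<in> G d" "prod.swap (x, y) = (x', y')"
  have "prod.swap ` slice d n x y \<subseteq> slice d n x' y'" if b: "(x, y) \<in> band d n" for n
  proof
    fix g assume "g \<in> prod.swap ` slice d n x y"
    then obtain z where z: "z \<in> cylinder d n x" "g = (conj_map n y z, z)"
      by (auto simp: slice_def)
    have "conj_map n y z \<in> Omega d"
      using z(1) G_Omega[OF xy(1)] Omega_in_block by (intro conj_map_Omega) (auto simp: cylinder_def)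
    then have "conj_map n y z \<in> cylinder d n y" by (auto simp: cylinder_def conj_map_def)
    moreover have "conj_map n x (conj_map n y z) = z"
      using z(1) by (auto simp: cylinder_def conj_map_def fun_eq_iff)
    ultimately show "g \<in> slice d n x' y'" using z xy by (simp add: mem_slice_iff)
  qed
  then show "\<exists>M. \<forall>n\<ge>M. (x, y) \<in> band d n \<longrightarrow> prod.swap ` slice d n x y \<subseteq> slice d n x' y'" by blast
qed

text \<open>Changing the first coordinate inside \<open>block N\<close> is invisible to a slice of
  depth at least \<open>N\<close>, whose second coordinate overwrites that block anyway. The map
  supplies the factor \<open>B (z, y)\<close> of a convolution as a function of
  \<open>(x, y)\<close>.\<close>

lemma continuous_map_translate:
  assumes w: "w \<in> words d N"
  shows "continuous_map (G_top d) (G_top d) (\<lambda>(x, y). (conj_map N w x, y))"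
proof (rule continuous_map_G_G)
  show "(\<lambda>(x, y). (conj_map N w x, y)) \<in> G d \<rightarrow> G d"
  proof clarify
    fix x y assume g: "(x, y) \<in> G d"
    then have "(x, conj_map N w x) \<in> G d" using conj_map_band[OF _ w] band_subset_G G_Omega by blast
    then show "(conj_map N w x, y) \<in> G d" using g G_sym G_trans by blast
  qed
  fix x y x' y' assume xy: "(x, y) \<in> G d" "(\<lambda>(x, y). (conj_map N w x, y)) (x, y) = (x', y')"
  have "(\<lambda>(x, y). (conj_map N w x, y)) ` slice d n x y \<subseteq> slice d n x' y'" if n: "n \<ge> N" for n
  proof
    fix g assume "g \<in> (\<lambda>(x, y). (conj_map N w x, y)) ` slice d n x y"
    then obtain z where z: "z \<in> cylinder d n x" "g = (conj_map N w z, conj_map n y z)"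
      by (auto simp: slice_def)
    have "conj_map N w z \<in> Omega d"
      using z(1) by (intro conj_map_words w) (auto simp: cylinder_def)
    then have "conj_map N w z \<in> cylinder d n (conj_map N w x)"
      using z by (auto simp: cylinder_def conj_map_def)
    moreover have "conj_map n y (conj_map N w z) = conj_map n y z"
      using block_mono[OF n] by (auto simp: conj_map_def fun_eq_iff)
    ultimately show "g \<in> slice d n x' y'" using z xy by (simp add: mem_slice_iff)
  qed
  then show "\<exists>M. \<forall>n\<ge>M. (x, y) \<in> band d n \<longrightarrow>
      (\<lambda>(x, y). (conj_map N w x, y)) ` slice d n x y \<subseteq> slice d n x' y'" by blast
qed

section \<open>Bands are compact and closed, and compact sets lie in bands\<close>

lemma band_eq_Union_slices:
  "band d N = (\<Union>w\<in>words d N. (\<lambda>x. (x, conj_map N w x)) ` Omega d)"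
proof (intro equalityI subsetI)
  fix g assume "g \<in> band d N"
  moreover obtain x y where [simp]: "g = (x, y)" by (cases g)
  ultimately have b: "(x, y) \<in> band d N" by simp
  then have "x \<in> Omega d" "y \<in> Omega d" by (auto simp: band_def)
  then show "g \<in> (\<Union>w\<in>words d N. (\<lambda>x. (x, conj_map N w x)) ` Omega d)"
    using restrict_words[of y d N] band_conj_map[OF b] conj_map_restrict[of N y] by force
qed (use conj_map_band in auto)

lemma compactin_band: "compactin (G_top d) (band d N)"
  unfolding band_eq_Union_slices
proof (rule compactin_Union)
  show "finite ((\<lambda>w. (\<lambda>x. (x, conj_map N w x)) ` Omega d) ` words d N)"
    using finite_words by blast
  fix S assume "S \<in> (\<lambda>w. (\<lambda>x. (x, conj_map N w x)) ` Omega d) ` words d N"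
  then show "compactin (G_top d) S"
    using image_compactin[OF _ continuous_map_Omega_G, of d "Omega d"] compact_Omega[of d]
    by (auto simp: compact_space_def)
qed

lemma closedin_band: "closedin (G_top d) (band d N)"
  unfolding closedin_def topspace_G openin_G_iff
proof (intro conjI allI impI band_subset_G)
  fix x y assume xy: "(x, y) \<in> G d - band d N"
  then obtain n where n: "n \<ge> 1" "(x, y) \<in> band d n" using G_iff_band by auto
  have O: "x \<in> Omega d" "y \<in> Omega d" using xy G_Omega by auto
  then obtain j where j: "j \<notin> block N" "x j \<noteq> y j" using xy by (auto simp: band_def)
  \<comment> \<open>The position that separates \<open>x\<close> from \<open>y\<close> lies inside
    \<open>block n\<close>, so every pair in the slice still has the letters \<open>x j\<close> and
    \<open>y j\<close> there and stays outside the band.\<close>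
  then have "j \<in> block n" using n by (auto simp: band_def)
  then have "slice d n x y \<subseteq> G d - band d N"
    using slice_band[OF O, of n] band_subset_G[of d n] j by (auto simp: mem_slice_iff cylinder_def conj_map_def band_def)
  then show "\<exists>n\<ge>1. (x, y) \<in> band d n \<and> slice d n x y \<subseteq> G d - band d N" using n by blast
qed auto

lemma openin_band: "n \<ge> 1 \<Longrightarrow> openin (G_top d) (band d n)"
  unfolding openin_G_iff
  using band_subset_G slice_band by (meson G_Omega subsetD)

lemma compact_subset_band:
  assumes "compactin (G_top d) K"
  shows "\<exists>N\<ge>1. K \<subseteq> band d N"
proof -
  have "\<exists>F. finite F \<and> F \<subseteq> band d ` {1..} \<and> K \<subseteq> \<Union>F"
  proof -
    have "\<And>U. U \<in> band d ` {1..} \<Longrightarrow> openin (G_top d) U" using openin_band by auto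
    moreover have "K \<subseteq> \<Union>(band d ` {1..})"
    proof
      fix g assume "g \<in> K"
      then have "g \<in> G d" using compactin_subset_topspace[OF assms] by auto
      then obtain n where "n \<ge> 1" "g \<in> band d n" using G_iff_band by blast
      then show "g \<in> \<Union>(band d ` {1..})" by auto
    qed
    ultimately show ?thesis using compactinD[OF assms] by blast
  qed
  then obtain F where F: "finite F" "F \<subseteq> band d ` {1..}" "K \<subseteq> \<Union>F" by blast
  obtain I where I: "finite I" "F = band d ` I"
    using finite_subset_image[OF F(1,2)] by (auto simp del: image_subset_iff)
  have "K \<subseteq> band d (Max (insert 1 I))"
  proof
    fix g assume "g \<in> K"
    then obtain i where "i \<in> I" "g \<in> band d i" using F I by auto
    then show "g \<in> band d (Max (insert 1 I))" using I band_mono[of i "Max (insert 1 I)" d] by auto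
  qed
  moreover have "Max (insert 1 I) \<ge> 1" using I by simp
  ultimately show ?thesis by blast
qed

subsection \<open>Compactly supported kernels\<close>

text \<open>The bands are compact, and those with positive index are open and exhaust \<open>G d\<close>; hence
  compact support means support in some band.\<close>

definition supported :: "nat \<Rightarrow> nat \<Rightarrow> kernel \<Rightarrow> bool" where
  "supported d N A \<longleftrightarrow> (\<forall>g. A g \<noteq> 0 \<longrightarrow> g \<in> band d N)"

lemma supportedD: "supported d N A \<Longrightarrow> A g \<noteq> 0 \<Longrightarrow> g \<in> band d N"
  unfolding supported_def by blast

lemma supported_mono: "supported d M A \<Longrightarrow> M \<le> N \<Longrightarrow> supported d N A"
  using band_mono unfolding supported_def by blast

lemma CcI:
  assumes "continuous_map (G_top d) euclidean A" "supported d N A"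
  shows "A \<in> Cc d"
proof -
  have "G_top d closure_of {g \<in> G d. A g \<noteq> 0} \<subseteq> band d N"
    using supportedD[OF assms(2)] by (intro closure_of_minimal closedin_band) auto
  then have "compactin (G_top d) (G_top d closure_of {g \<in> G d. A g \<noteq> 0})"
    by (rule closed_compactin[OF compactin_band _ closedin_closure_of])
  moreover have "\<forall>g. g \<notin> G d \<longrightarrow> A g = 0"
    using assms(2) subsetD[OF band_subset_G] unfolding supported_def by metis
  ultimately show ?thesis using assms(1) by (simp add: Cc_def)
qed

lemma Cc_continuous: "A \<in> Cc d \<Longrightarrow> continuous_map (G_top d) euclidean A"
  by (simp add: Cc_def)

lemma Cc_support:
  assumes "A \<in> Cc d" obtains N where "N \<ge> 1" "supported d N A"
proof -
  have "compactin (G_top d) (G_top d closure_of {g \<in> G d. A g \<noteq> 0})" using assms by (simp add: Cc_def)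
  then obtain N where N: "N \<ge> 1" "G_top d closure_of {g \<in> G d. A g \<noteq> 0} \<subseteq> band d N"
    using compact_subset_band by blast
  have "g \<in> band d N" if "A g \<noteq> 0" for g
  proof -
    have "g \<in> G d" using that assms unfolding Cc_def by blast
    then have "g \<in> {g \<in> G d. A g \<noteq> 0}" using that by simp
    then show ?thesis using N closure_of_subset[of "{g \<in> G d. A g \<noteq> 0}" "G_top d"] by auto
  qed
  then show thesis using that[of N] N(1) by (simp add: supported_def)
qed

lemma Cc_support2:
  assumes "A \<in> Cc d" "B \<in> Cc d"
  obtains N where "N \<ge> 1" "supported d N A" "supported d N B"
proof -
  obtain M where M: "M \<ge> 1" "supported d M A" by (rule Cc_support[OF assms(1)])
  obtain N where N: "N \<ge> 1" "supported d N B" by (rule Cc_support[OF assms(2)])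
  show thesis
    using that[of "max M N"] M supported_mono[OF M(2), of "max M N"] supported_mono[OF N(2), of "max M N"]
    by simp
qed

lemma continuous_G_bounded:
  fixes f :: "config \<times> config \<Rightarrow> 'a::real_normed_vector"
  assumes "continuous_map (G_top d) euclidean f"
  shows "\<exists>M\<ge>0. \<forall>g\<in>band d N. norm (f g) \<le> M"
proof -
  have "compact (f ` band d N)" using image_compactin[OF compactin_band assms] by simp
  then have "bounded (f ` band d N)" by (rule compact_imp_bounded)
  then obtain M where "\<And>g. g \<in> band d N \<Longrightarrow> norm (f g) \<le> M" by (auto simp: bounded_iff)
  then show ?thesis by (intro exI[of _ "max M 0"]) (auto simp: le_max_iff_disj)
qed

lemma Cc_bounded:
  assumes "A \<in> Cc d" shows "\<exists>M\<ge>0. \<forall>g. norm (A g) \<le> M"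
proof -
  obtain N where N: "N \<ge> 1" "supported d N A"
    by (rule Cc_support[OF assms])
  obtain M where "M \<ge> 0" "\<And>g. g \<in> band d N \<Longrightarrow> norm (A g) \<le> M"
    using continuous_G_bounded[OF Cc_continuous[OF assms], of N] by auto
  then show ?thesis using supportedD[OF N(2)] by (metis norm_zero)
qed

lemma continuous_map_add_euclidean:
  fixes f g :: "'a \<Rightarrow> 'b::real_normed_vector"
  assumes "continuous_map X euclidean f" "continuous_map X euclidean g"
  shows "continuous_map X euclidean (\<lambda>x. f x + g x)"
  using assms unfolding continuous_map_atin limitin_canonical_iff by (auto intro: tendsto_add)

lemma continuous_map_mult_euclidean:
  fixes f g :: "'a \<Rightarrow> 'b::real_normed_algebra"
  assumes "continuous_map X euclidean f" "continuous_map X euclidean g"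
  shows "continuous_map X euclidean (\<lambda>x. f x * g x)"
  using assms unfolding continuous_map_atin limitin_canonical_iff by (auto intro: tendsto_mult)

lemma continuous_map_sum_euclidean:
  fixes f :: "'i \<Rightarrow> 'a \<Rightarrow> 'b::real_normed_vector"
  assumes "\<And>i. i \<in> I \<Longrightarrow> continuous_map X euclidean (f i)"
  shows "continuous_map X euclidean (\<lambda>x. \<Sum>i\<in>I. f i x)"
  using assms unfolding continuous_map_atin limitin_canonical_iff by (auto intro!: tendsto_sum)

lemma Cc_zero: "(\<lambda>_. 0) \<in> Cc d"
  by (rule CcI[of _ _ 0]) (auto simp: supported_def)

lemma Cc_add:
  assumes "A \<in> Cc d" "B \<in> Cc d" shows "(\<lambda>g. A g + B g) \<in> Cc d"
proof -
  obtain N where N: "N \<ge> 1" "supported d N A" "supported d N B"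
    by (rule Cc_support2[OF assms])
  show ?thesis
  proof (rule CcI[of _ _ N])
    show "continuous_map (G_top d) euclidean (\<lambda>g. A g + B g)"
      by (intro continuous_map_add_euclidean Cc_continuous assms)
    show "supported d N (\<lambda>g. A g + B g)"
      using N(2,3) unfolding supported_def by (metis add_0)
  qed
qed

lemma Cc_mult_continuous:
  assumes "A \<in> Cc d" "continuous_map (G_top d) euclidean h"
  shows "(\<lambda>g. h g * A g) \<in> Cc d"
proof -
  obtain N where N: "N \<ge> 1" "supported d N A"
    by (rule Cc_support[OF assms(1)])
  show ?thesis
  proof (rule CcI[of _ _ N])
    show "continuous_map (G_top d) euclidean (\<lambda>g. h g * A g)"
      by (intro continuous_map_mult_euclidean Cc_continuous assms)
    show "supported d N (\<lambda>g. h g * A g)"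
      using N(2) by (simp add: supported_def)
  qed
qed

lemma Cc_scale: "A \<in> Cc d \<Longrightarrow> (\<lambda>g. c * A g) \<in> Cc d"
  using Cc_mult_continuous[of A d "\<lambda>_. c"] by simp

lemma Cc_diff: "A \<in> Cc d \<Longrightarrow> B \<in> Cc d \<Longrightarrow> (\<lambda>g. A g - B g) \<in> Cc d"
  using Cc_add[of A d "\<lambda>g. - 1 * B g"] Cc_scale[of B d "- 1"] by simp

lemma Cc_kstar:
  assumes "A \<in> Cc d" shows "kstar A \<in> Cc d"
proof -
  obtain N where N: "N \<ge> 1" "supported d N A"
    by (rule Cc_support[OF assms(1)])
  have eq: "kstar A = cnj \<circ> (A \<circ> prod.swap)" by (auto simp: kstar_def)
  have "continuous_map (G_top d) euclidean (kstar A)" unfolding eq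
    by (rule continuous_map_compose[OF continuous_map_compose[OF continuous_map_swap Cc_continuous[OF assms]]])
      (simp add: continuous_on_cnj)
  then show ?thesis
  proof (rule CcI)
    show "supported d N (kstar A)"
      using N(2) band_sym by (auto simp: kstar_def supported_def)
  qed
qed

lemma Cc_kflow:
  assumes "A \<in> Cc d" "continuous_map (G_top d) euclideanreal W"
  shows "kflow W t A \<in> Cc d"
proof -
  have "continuous_map (G_top d) euclidean ((\<lambda>s. exp (\<i> * complex_of_real (s * t))) \<circ> W)"
    by (rule continuous_map_compose[OF assms(2)])
      (simp, intro continuous_intros)
  then show ?thesis unfolding kflow_def using Cc_mult_continuous[OF assms(1)] by (simp add: o_def)
qed

lemma Cc_kunit: "kunit d \<in> Cc d"
proof (rule CcI[of _ _ 0])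
  show "supported d 0 (kunit d)"
    by (auto simp: supported_def kunit_def indicator_def band_def split: if_splits)
  show "continuous_map (G_top d) euclidean (kunit d)"
    unfolding continuous_map
  proof (intro conjI allI impI)
    fix U :: "complex set"
    show "openin (G_top d) {g \<in> topspace (G_top d). kunit d g \<in> U}"
      unfolding openin_G_iff
    proof (intro conjI allI impI)
      fix x y assume "(x, y) \<in> {g \<in> topspace (G_top d). kunit d g \<in> U}"
      then have xy: "(x, y) \<in> G d" "kunit d (x, y) \<in> U" by auto
      obtain n where n: "n \<ge> 1" "(x, y) \<in> band d n" using xy(1) G_iff_band by blast
      have O: "x \<in> Omega d" "y \<in> Omega d" using G_Omega[OF xy(1)] by auto
      have "g \<in> {g \<in> topspace (G_top d). kunit d g \<in> U}" if g: "g \<in> slice d n x y" for g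
      proof -
        obtain z where z: "z \<in> cylinder d n x" "g = (z, conj_map n y z)" using g by (auto simp: slice_def)
        \<comment> \<open>On the block the two sides spell \<open>x\<close> and \<open>y\<close>,
          and outside it \<open>x\<close> and \<open>y\<close> agree anyway. Hence a slice lies
          entirely on the diagonal or entirely off it, and the unit is locally constant.\<close>
        have "z = conj_map n y z \<longleftrightarrow> x = y"
          using z(1) n(2) by (auto simp: cylinder_def conj_map_def fun_eq_iff band_def)
        then have "kunit d g = kunit d (x, y)"
          using z O by (auto simp: kunit_def indicator_def cylinder_def)
        then show ?thesis using xy(2) g slice_band[OF O, of n] band_subset_G by auto
      qed
      then show "\<exists>n\<ge>1. (x, y) \<in> band d n \<and> slice d n x y \<subseteq> {g \<in> topspace (G_top d). kunit d g \<in> U}"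
        using n by blast
    qed auto
  qed auto
qed

text \<open>The finite neighbourhood of \<open>x\<close> over which row \<open>x\<close> of a kernel supported in
  \<open>band d N\<close> lives.\<close>

definition nbhd :: "nat \<Rightarrow> nat \<Rightarrow> config \<Rightarrow> config set" where
  "nbhd d N x = {y. (x, y) \<in> band d N}"

text \<open>This trades a neighbourhood that moves with \<open>x\<close> for the fixed index set
  \<open>words d N\<close>, so that sums over neighbours can be tested for continuity and exchanged
  with integrals.\<close>

lemma nbhd_bij:
  assumes "x \<in> Omega d"
  shows "bij_betw (\<lambda>w. conj_map N w x) (words d N) (nbhd d N x)"
  unfolding bij_betw_def
proof
  show "inj_on (\<lambda>w. conj_map N w x) (words d N)"
  proof (rule inj_onI)
    fix u w assume uw: "u \<in> words d N" "w \<in> words d N" "conj_map N u x = conj_map N w x"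
    have "u j = w j" if "j \<in> block N" for j
      using fun_cong[OF uw(3), of j] that by (simp add: conj_map_def)
    then show "u = w" using uw(1,2) unfolding words_def by (intro PiE_ext) auto
  qed
  show "(\<lambda>w. conj_map N w x) ` words d N = nbhd d N x"
  proof (intro equalityI subsetI)
    fix y assume "y \<in> nbhd d N x"
    then have b: "(x, y) \<in> band d N" by (simp add: nbhd_def)
    then have "y \<in> Omega d" by (auto simp: band_def)
    then show "y \<in> (\<lambda>w. conj_map N w x) ` words d N"
      using restrict_words[of y d N] band_conj_map[OF b] conj_map_restrict[of N y] by force
  qed (use conj_map_band[OF assms] in \<open>auto simp: nbhd_def\<close>)
qed

lemma finite_nbhd: "finite (nbhd d N x)"
proof (cases "x \<in> Omega d")
  case True
  then show ?thesis using nbhd_bij finite_words bij_betw_finite by blast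
next
  case False
  then have "nbhd d N x = {}" by (auto simp: nbhd_def band_def)
  then show ?thesis by simp
qed

lemma nbhd_subset_hclass:
  assumes "x \<in> Omega d" "y \<in> hclass d x" shows "nbhd d N y \<subseteq> hclass d x"
  using assms subsetD[OF band_subset_G, of _ d N] G_trans[of x y d]
  by (auto simp: nbhd_def hclass_iff)

lemma hclass_self: "x \<in> Omega d \<Longrightarrow> x \<in> hclass d x"
  by (simp add: hclass_iff G_refl)

lemma infsum_hclass:
  fixes f :: "config \<Rightarrow> complex"
  assumes "x \<in> Omega d" "y \<in> hclass d x" "\<And>z. f z \<noteq> 0 \<Longrightarrow> (y, z) \<in> band d N"
  shows "(\<Sum>\<^sub>\<infinity>z\<in>hclass d x. f z) = (\<Sum>z\<in>nbhd d N y. f z)"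
proof -
  have "(\<Sum>\<^sub>\<infinity>z\<in>hclass d x. f z) = (\<Sum>\<^sub>\<infinity>z\<in>nbhd d N y. f z)"
    using nbhd_subset_hclass[OF assms(1,2), of N] assms(3)
    by (intro infsum_cong_neutral) (auto simp: nbhd_def)
  then show ?thesis using finite_nbhd by simp
qed

text \<open>The support condition concerns the product of the two entries, so that a window for
  either factor can be used; on the diagonal a window for the right factor serves as well, by
  symmetry of the band.\<close>

lemma kconv_eq:
  assumes "(x, y) \<in> G d" "\<And>z. A (x, z) * B (z, y) \<noteq> 0 \<Longrightarrow> (x, z) \<in> band d N"
  shows "kconv d A B (x, y) = (\<Sum>z\<in>nbhd d N x. A (x, z) * B (z, y))"
  unfolding kconv_def using assms G_Omega hclass_self
  by (simp, intro infsum_hclass) auto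

lemma sum_nbhd:
  assumes "x \<in> Omega d"
  shows "(\<Sum>z\<in>nbhd d N x. f z) = (\<Sum>w\<in>words d N. f (conj_map N w x))"
  using sum.reindex_bij_betw[OF nbhd_bij[OF assms]] by metis

text \<open>A band is an equivalence relation, so convolution does not widen a common
  window.\<close>

lemma kconv_support:
  assumes A: "supported d N A" and B: "supported d N B"
  shows "supported d N (kconv d A B)"
  unfolding supported_def
proof (intro allI impI)
  fix g assume nz: "kconv d A B g \<noteq> 0"
  obtain x y where [simp]: "g = (x, y)" by (cases g)
  have g: "(x, y) \<in> G d" using nz by (auto simp: kconv_def split: if_splits)
  have "kconv d A B (x, y) = (\<Sum>z\<in>nbhd d N x. A (x, z) * B (z, y))"
    using supportedD[OF A] by (intro kconv_eq[OF g]) (metis mult_zero_left)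
  then have "(\<Sum>z\<in>nbhd d N x. A (x, z) * B (z, y)) \<noteq> 0" using nz by simp
  then obtain z where "A (x, z) * B (z, y) \<noteq> 0" by (rule sum.not_neutral_contains_not_neutral)
  then have "(x, z) \<in> band d N" "(z, y) \<in> band d N"
    using supportedD[OF A, of "(x, z)"] supportedD[OF B, of "(z, y)"] by simp_all
  then show "g \<in> band d N" using band_trans[of x z d N y] by simp
qed

lemma Cc_kconv:
  assumes "A \<in> Cc d" "B \<in> Cc d" shows "kconv d A B \<in> Cc d"
proof -
  obtain N where N: "N \<ge> 1" "supported d N A" "supported d N B"
    by (rule Cc_support2[OF assms])
  \<comment> \<open>Each summand is \<open>A (x, z) * B (z, y)\<close> with
    \<open>z = conj_map N w x\<close>: the first factor is a row entry depending on \<open>x\<close>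
    alone, the second is \<open>B\<close> after a translation of the first coordinate.\<close>
  have c: "continuous_map (G_top d) euclidean
      (\<lambda>g. \<Sum>w\<in>words d N. (A \<circ> ((\<lambda>x. (x, conj_map N w x)) \<circ> fst)) g * (B \<circ> (\<lambda>(x, y). (conj_map N w x, y))) g)"
    by (intro continuous_map_sum_euclidean continuous_map_mult_euclidean
      continuous_map_compose[OF _ Cc_continuous[OF assms(1)]]
      continuous_map_compose[OF _ Cc_continuous[OF assms(2)]] continuous_map_translate
      continuous_map_compose[OF continuous_map_fst_G continuous_map_Omega_G])
  have "continuous_map (G_top d) euclidean (kconv d A B)"
  proof (rule continuous_map_eq[OF c])
    fix g assume "g \<in> topspace (G_top d)"
    moreover obtain x y where [simp]: "g = (x, y)" by (cases g)
    ultimately have g: "(x, y) \<in> G d" by simp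
    have "kconv d A B (x, y) = (\<Sum>z\<in>nbhd d N x. A (x, z) * B (z, y))"
      using supportedD[OF N(2)] by (intro kconv_eq[OF g]) (metis mult_zero_left)
    then show "(\<Sum>w\<in>words d N. (A \<circ> ((\<lambda>x. (x, conj_map N w x)) \<circ> fst)) g * (B \<circ> (\<lambda>(x, y). (conj_map N w x, y))) g)
      = kconv d A B g"
      using sum_nbhd[of x d "\<lambda>z. A (x, z) * B (z, y)" N] G_Omega[OF g] by simp
  qed
  then show ?thesis by (rule CcI) (rule kconv_support[OF N(2,3)])
qed

subsection \<open>The reduced norm\<close>

text \<open>All square-summability estimates are made on finite sets, where \<open>L2_set\<close>
  provides the Minkowski and Cauchy-Schwarz inequalities; this lemma carries them to the whole
  class.\<close>

lemma in_l2I: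
  assumes "\<And>F. finite F \<Longrightarrow> F \<subseteq> S \<Longrightarrow> L2_set (\<lambda>y. cmod (\<xi> y)) F \<le> C" "0 \<le> C"
  shows "in_l2 S \<xi>" "l2_norm S \<xi> \<le> C"
proof -
  have sq: "(\<Sum>y\<in>F. (cmod (\<xi> y))\<^sup>2) \<le> C\<^sup>2" if "finite F" "F \<subseteq> S" for F
    using assms(1)[OF that] assms(2) unfolding L2_set_def
    by (metis real_sqrt_le_iff real_sqrt_unique)
  show l2: "in_l2 S \<xi>" unfolding in_l2_def
    by (rule nonneg_bdd_above_summable_on) (auto intro!: bdd_aboveI2[where M = "C\<^sup>2"] sq)
  have "(\<Sum>\<^sub>\<infinity>y\<in>S. (cmod (\<xi> y))\<^sup>2) \<le> C\<^sup>2"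
    using l2 sq unfolding in_l2_def by (rule infsum_le_finite_sums)
  then show "l2_norm S \<xi> \<le> C"
    unfolding l2_norm_def using assms(2) by (simp add: real_le_lsqrt infsum_nonneg)
qed

lemma l2_norm_nonneg: "0 \<le> l2_norm S \<xi>"
  unfolding l2_norm_def by (simp add: infsum_nonneg)

lemma L2_set_le_l2_norm:
  assumes "in_l2 S \<xi>" "finite F" "F \<subseteq> S"
  shows "L2_set (\<lambda>y. cmod (\<xi> y)) F \<le> l2_norm S \<xi>"
  unfolding L2_set_def l2_norm_def using assms
  by (auto intro!: finite_sum_le_infsum simp: in_l2_def)

lemma l2_cong:
  assumes "\<And>y. y \<in> S \<Longrightarrow> cmod (\<xi> y) = cmod (\<eta> y)"
  shows "in_l2 S \<xi> \<longleftrightarrow> in_l2 S \<eta>" "l2_norm S \<xi> = l2_norm S \<eta>"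
  unfolding in_l2_def l2_norm_def using assms
  by (auto intro!: summable_on_cong arg_cong[where f = sqrt] infsum_cong)

lemma l2_add:
  assumes "in_l2 S \<xi>" "in_l2 S \<eta>"
  shows "in_l2 S (\<lambda>y. \<xi> y + \<eta> y)" "l2_norm S (\<lambda>y. \<xi> y + \<eta> y) \<le> l2_norm S \<xi> + l2_norm S \<eta>"
proof -
  have "L2_set (\<lambda>y. cmod (\<xi> y + \<eta> y)) F \<le> l2_norm S \<xi> + l2_norm S \<eta>" if F: "finite F" "F \<subseteq> S" for F
  proof -
    have "L2_set (\<lambda>y. cmod (\<xi> y + \<eta> y)) F \<le> L2_set (\<lambda>y. cmod (\<xi> y) + cmod (\<eta> y)) F"
      by (intro L2_set_mono norm_triangle_ineq) auto
    also have "\<dots> \<le> L2_set (\<lambda>y. cmod (\<xi> y)) F + L2_set (\<lambda>y. cmod (\<eta> y)) F"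
      by (rule L2_set_triangle_ineq)
    also have "\<dots> \<le> l2_norm S \<xi> + l2_norm S \<eta>"
      using F assms by (intro add_mono L2_set_le_l2_norm)
    finally show ?thesis .
  qed
  then show "in_l2 S (\<lambda>y. \<xi> y + \<eta> y)" "l2_norm S (\<lambda>y. \<xi> y + \<eta> y) \<le> l2_norm S \<xi> + l2_norm S \<eta>"
    using l2_norm_nonneg[of S] by (auto intro!: in_l2I)
qed

lemma l2_scale:
  assumes "in_l2 S \<xi>"
  shows "in_l2 S (\<lambda>y. c * \<xi> y)" "l2_norm S (\<lambda>y. c * \<xi> y) = cmod c * l2_norm S \<xi>"
proof -
  show "in_l2 S (\<lambda>y. c * \<xi> y)"
    using assms unfolding in_l2_def by (simp add: norm_mult power_mult_distrib summable_on_cmult_right)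
  show "l2_norm S (\<lambda>y. c * \<xi> y) = cmod c * l2_norm S \<xi>"
    unfolding l2_norm_def by (simp add: norm_mult power_mult_distrib infsum_cmult_right' real_sqrt_mult)
qed

lemma in_l2_zero: "in_l2 S (\<lambda>_. 0)" "l2_norm S (\<lambda>_. 0) = 0"
  by (auto simp: in_l2_def l2_norm_def)

text \<open>Boundedness of the operator with an explicit constant, including that it preserves
  square-summability. Unlike \<open>rep_norm\<close>, it is meaningful before any supremum is known
  to be finite.\<close>

definition op_bound :: "nat \<Rightarrow> config \<Rightarrow> kernel \<Rightarrow> real \<Rightarrow> bool" where
  "op_bound d x A C \<longleftrightarrow> (\<forall>\<xi>. in_l2 (hclass d x) \<xi> \<longrightarrow>
     in_l2 (hclass d x) (rep d x A \<xi>) \<and>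
     l2_norm (hclass d x) (rep d x A \<xi>) \<le> C * l2_norm (hclass d x) \<xi>)"

lemma op_boundD:
  assumes "op_bound d x A C" "in_l2 (hclass d x) \<xi>"
  shows "in_l2 (hclass d x) (rep d x A \<xi>)"
    "l2_norm (hclass d x) (rep d x A \<xi>) \<le> C * l2_norm (hclass d x) \<xi>"
  using assms by (auto simp: op_bound_def)

lemma rep_eq:
  assumes "x \<in> Omega d" "y \<in> hclass d x" "supported d N A"
  shows "rep d x A \<xi> y = (\<Sum>z\<in>nbhd d N y. A (y, z) * \<xi> z)"
  unfolding rep_def using supportedD[OF assms(3)]
  by (intro infsum_hclass assms(1,2)) (metis mult_zero_left)

text \<open>Allows one finite index set for many rows at once, which is what an exchange of
  summations requires.\<close>

lemma rep_eq_sum: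
  assumes "x \<in> Omega d" "y \<in> hclass d x" "supported d N A"
    and "finite T" "nbhd d N y \<subseteq> T"
  shows "rep d x A \<xi> y = (\<Sum>z\<in>T. A (y, z) * \<xi> z)"
  unfolding rep_eq[OF assms(1-3)] using assms(4,5) supportedD[OF assms(3)]
  by (intro sum.mono_neutral_left) (auto simp: nbhd_def)

lemma card_nbhd_le: "card (nbhd d N x) \<le> card (words d N)"
proof (cases "x \<in> Omega d")
  case True
  then show ?thesis using bij_betw_same_card[OF nbhd_bij] by simp
next
  case False
  then have "nbhd d N x = {}" by (auto simp: nbhd_def band_def)
  then show ?thesis by simp
qed

text \<open>A Schur test: rows and columns have at most \<open>card (words d N)\<close> nonzero entries.\<close>

lemma op_bound_supported:
  assumes x: "x \<in> Omega d" and A: "supported d N A" and M: "\<And>g. cmod (A g) \<le> M" "0 \<le> M"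
  shows "op_bound d x A (M * card (words d N))"
  unfolding op_bound_def
proof (intro allI impI)
  fix \<xi> assume \<xi>: "in_l2 (hclass d x) \<xi>"
  define K where "K = real (card (words d N))"
  have K: "0 \<le> K" by (simp add: K_def)
  have "L2_set (\<lambda>y. cmod (rep d x A \<xi> y)) F \<le> M * K * l2_norm (hclass d x) \<xi>"
    if F: "finite F" "F \<subseteq> hclass d x" for F
  proof -
    define F' where "F' = (\<Union>y\<in>F. nbhd d N y)"
    have F': "finite F'" "F' \<subseteq> hclass d x"
      unfolding F'_def using F finite_nbhd nbhd_subset_hclass[OF x] by (blast, intro UN_least) blast
    have "(cmod (rep d x A \<xi> y))\<^sup>2 \<le> M\<^sup>2 * K * (\<Sum>z | z \<in> F' \<and> (y, z) \<in> band d N. (cmod (\<xi> z))\<^sup>2)"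
      if y: "y \<in> F" for y
    proof -
      have "cmod (rep d x A \<xi> y) \<le> (\<Sum>z\<in>nbhd d N y. M * cmod (\<xi> z))"
        using y F unfolding rep_eq[OF x subsetD[OF F(2) y] A]
        by (intro sum_norm_le) (auto simp: norm_mult intro!: mult_right_mono M)
      then have "(cmod (rep d x A \<xi> y))\<^sup>2 \<le> (\<Sum>z\<in>nbhd d N y. M * cmod (\<xi> z))\<^sup>2"
        by (rule power_mono) simp
      \<comment> \<open>Cauchy-Schwarz along the row costs one factor \<open>K\<close>, the number
        of its entries.\<close>
      also have "\<dots> \<le> (\<Sum>z\<in>nbhd d N y. (M * cmod (\<xi> z))\<^sup>2) * real (card (nbhd d N y))"
        by (rule sum_squared_le_sum_of_squares)
      also have "\<dots> \<le> (\<Sum>z\<in>nbhd d N y. (M * cmod (\<xi> z))\<^sup>2) * K"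
        using card_nbhd_le[of d N y] by (intro mult_left_mono sum_nonneg) (auto simp: K_def)
      also have "nbhd d N y = {z. z \<in> F' \<and> (y, z) \<in> band d N}"
        using y by (auto simp: F'_def nbhd_def)
      finally show ?thesis
        by (simp add: power_mult_distrib sum_distrib_left[symmetric] mult_ac)
    qed
    then have "(\<Sum>y\<in>F. (cmod (rep d x A \<xi> y))\<^sup>2) \<le>
        (\<Sum>y\<in>F. M\<^sup>2 * K * (\<Sum>z | z \<in> F' \<and> (y, z) \<in> band d N. (cmod (\<xi> z))\<^sup>2))"
      by (rule sum_mono)
    also have "\<dots> = M\<^sup>2 * K * (\<Sum>z\<in>F'. \<Sum>y | y \<in> F \<and> (y, z) \<in> band d N. (cmod (\<xi> z))\<^sup>2)"
      unfolding sum_distrib_left[symmetric] by (subst sum.swap_restrict[OF F(1) F'(1)]) rule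
    \<comment> \<open>After exchanging the sums, each \<open>z\<close> is counted once for every row
      that meets it; symmetry of the band bounds this column count by \<open>K\<close> too. The two
      factors give \<open>K\<close> squared, hence \<open>K\<close> in the norm.\<close>
    also have "\<dots> \<le> M\<^sup>2 * K * (\<Sum>z\<in>F'. K * (cmod (\<xi> z))\<^sup>2)"
    proof (intro mult_left_mono sum_mono)
      fix z
      have "card {y. y \<in> F \<and> (y, z) \<in> band d N} \<le> card (nbhd d N z)"
        by (intro card_mono finite_nbhd) (auto simp: nbhd_def intro: band_sym)
      also have "\<dots> \<le> card (words d N)" by (rule card_nbhd_le)
      finally show "(\<Sum>y | y \<in> F \<and> (y, z) \<in> band d N. (cmod (\<xi> z))\<^sup>2) \<le> K * (cmod (\<xi> z))\<^sup>2"
        by (simp add: K_def mult_right_mono)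
    qed (use M K in auto)
    also have "\<dots> = (M * K * L2_set (\<lambda>y. cmod (\<xi> y)) F')\<^sup>2"
      by (simp add: L2_set_def power_mult_distrib sum_nonneg sum_distrib_left[symmetric] power2_eq_square mult_ac)
    finally have "L2_set (\<lambda>y. cmod (rep d x A \<xi> y)) F \<le> M * K * L2_set (\<lambda>y. cmod (\<xi> y)) F'"
      unfolding L2_set_def[of _ F] using M K by (intro real_le_lsqrt) (auto intro: sum_nonneg)
    also have "\<dots> \<le> M * K * l2_norm (hclass d x) \<xi>"
      using M K by (intro mult_left_mono L2_set_le_l2_norm \<xi> F') auto
    finally show ?thesis .
  qed
  then show "in_l2 (hclass d x) (rep d x A \<xi>) \<and>
      l2_norm (hclass d x) (rep d x A \<xi>) \<le> M * card (words d N) * l2_norm (hclass d x) \<xi>"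
    using M K l2_norm_nonneg[of "hclass d x" \<xi>]
    by (intro conjI in_l2I(1)[where C = "M * K * l2_norm (hclass d x) \<xi>"]
      in_l2I(2)[where C = "M * card (words d N) * l2_norm (hclass d x) \<xi>"]) (simp_all add: K_def)
qed

lemma op_bound_Cc:
  assumes "A \<in> Cc d"
  obtains C where "0 \<le> C" "\<forall>x\<in>Omega d. op_bound d x A C"
proof -
  obtain N where N: "N \<ge> 1" "supported d N A" by (rule Cc_support[OF assms])
  obtain M where M: "0 \<le> M" "\<And>g. cmod (A g) \<le> M" using Cc_bounded[OF assms] by auto
  show thesis
    using that[of "M * card (words d N)"] op_bound_supported[OF _ N(2) M(2,1)] M(1) by auto
qed

lemma rep_scale: "rep d x A (\<lambda>y. c * \<xi> y) = (\<lambda>y. c * rep d x A \<xi> y)"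
  unfolding rep_def
  by (rule ext, subst infsum_cmult_right'[symmetric]) (simp add: mult.left_commute)

lemma rep_zero: "rep d x A (\<lambda>_. 0) = (\<lambda>_. 0)"
  by (simp add: rep_def)

lemma op_bound_unit:
  assumes "op_bound d x A C" "0 \<le> C" "in_l2 (hclass d x) \<xi>" "l2_norm (hclass d x) \<xi> \<le> 1"
  shows "l2_norm (hclass d x) (rep d x A \<xi>) \<le> C"
proof -
  have "l2_norm (hclass d x) (rep d x A \<xi>) \<le> C * l2_norm (hclass d x) \<xi>"
    by (rule op_boundD[OF assms(1,3)])
  also have "\<dots> \<le> C * 1" using assms by (intro mult_left_mono)
  finally show ?thesis by simp
qed

lemma rep_norm_le:
  assumes "op_bound d x A C" "0 \<le> C" shows "rep_norm d x A \<le> C"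
  unfolding rep_norm_def
proof (rule cSUP_least)
  show "{\<xi>. in_l2 (hclass d x) \<xi> \<and> l2_norm (hclass d x) \<xi> \<le> 1} \<noteq> {}"
    using in_l2_zero[of "hclass d x"] by (metis (mono_tags, lifting) empty_iff mem_Collect_eq zero_le_one)
qed (use op_bound_unit[OF assms] in auto)

text \<open>The constant \<open>C\<close> only guarantees that the supremum over the unit ball is a
  genuine one; homogeneity then yields the sharp inequality for all vectors.\<close>

lemma rep_norm_bound:
  assumes "op_bound d x A C" "0 \<le> C"
  shows "op_bound d x A (rep_norm d x A)" "0 \<le> rep_norm d x A"
proof -
  let ?S = "hclass d x"
  have bdd: "bdd_above ((\<lambda>\<xi>. l2_norm ?S (rep d x A \<xi>)) ` {\<xi>. in_l2 ?S \<xi> \<and> l2_norm ?S \<xi> \<le> 1})"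
    using op_bound_unit[OF assms] by (intro bdd_aboveI2[where M = C]) auto
  have up: "l2_norm ?S (rep d x A \<xi>) \<le> rep_norm d x A" if "in_l2 ?S \<xi>" "l2_norm ?S \<xi> \<le> 1" for \<xi>
    unfolding rep_norm_def using that by (intro cSUP_upper bdd) auto
  show "0 \<le> rep_norm d x A"
    using up[of "\<lambda>_. 0"] by (simp add: in_l2_zero rep_zero)
  show "op_bound d x A (rep_norm d x A)"
    unfolding op_bound_def
  proof (intro allI impI conjI)
    fix \<xi> assume \<xi>: "in_l2 ?S \<xi>"
    show "in_l2 ?S (rep d x A \<xi>)" using op_boundD[OF assms(1) \<xi>] by simp
    show "l2_norm ?S (rep d x A \<xi>) \<le> rep_norm d x A * l2_norm ?S \<xi>"
    proof (cases "l2_norm ?S \<xi> = 0")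
      case True
      \<comment> \<open>A vector of norm zero cannot be normalised, so here the a priori bound
        \<open>C\<close> is used directly.\<close>
      then show ?thesis using op_boundD(2)[OF assms(1) \<xi>] by simp
    next
      case False
      then have pos: "l2_norm ?S \<xi> > 0" using l2_norm_nonneg[of ?S \<xi>] by simp
      define c where "c = complex_of_real (1 / l2_norm ?S \<xi>)"
      have c: "cmod c = 1 / l2_norm ?S \<xi>" using pos by (simp add: c_def norm_divide)
      have "l2_norm ?S (rep d x A (\<lambda>y. c * \<xi> y)) \<le> rep_norm d x A"
        using pos by (intro up) (auto simp: l2_scale[OF \<xi>] c)
      then show ?thesis using pos
        by (simp add: rep_scale l2_scale[OF op_boundD(1)[OF assms(1) \<xi>]] c pos_divide_le_eq)
    qed
  qed
qed

lemma op_bound_mono: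
  assumes "op_bound d x A C" "C \<le> D" shows "op_bound d x A D"
  unfolding op_bound_def
proof (intro allI impI conjI)
  fix \<xi> assume \<xi>: "in_l2 (hclass d x) \<xi>"
  show "in_l2 (hclass d x) (rep d x A \<xi>)" using op_boundD[OF assms(1) \<xi>] by simp
  have "l2_norm (hclass d x) (rep d x A \<xi>) \<le> C * l2_norm (hclass d x) \<xi>"
    by (rule op_boundD[OF assms(1) \<xi>])
  also have "\<dots> \<le> D * l2_norm (hclass d x) \<xi>"
    using assms l2_norm_nonneg by (intro mult_right_mono)
  finally show "l2_norm (hclass d x) (rep d x A \<xi>) \<le> D * l2_norm (hclass d x) \<xi>" .
qed

section \<open>The reduced norm and the algebraic operations\<close>

lemma Omega_nonempty: "d \<ge> 1 \<Longrightarrow> Omega d \<noteq> {}"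
  unfolding Omega_def Omega_top_def by (auto simp: PiE_eq_empty_iff)

text \<open>With \<open>red_norm_le\<close> this characterises \<open>red_norm\<close> as the least
  uniform operator bound. The constant of \<open>op_bound_Cc\<close> is independent of
  \<open>x\<close>, so the outer supremum is bounded too.\<close>

lemma red_norm_op_bound:
  assumes "A \<in> Cc d" "x \<in> Omega d" shows "op_bound d x A (red_norm d A)"
proof -
  obtain C where C: "0 \<le> C" "\<forall>x\<in>Omega d. op_bound d x A C" by (rule op_bound_Cc[OF assms(1)])
  have "rep_norm d x A \<le> red_norm d A" unfolding red_norm_def
    using C rep_norm_le assms(2) by (intro cSUP_upper bdd_aboveI2[where M = C]) auto
  then show ?thesis using rep_norm_bound[of d x A C] C assms(2) op_bound_mono by blast
qed

lemma red_norm_le: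
  assumes "d \<ge> 1" "0 \<le> C" "\<And>x. x \<in> Omega d \<Longrightarrow> op_bound d x A C"
  shows "red_norm d A \<le> C"
  unfolding red_norm_def using Omega_nonempty[OF assms(1)] assms by (intro cSUP_least rep_norm_le) auto

lemma red_norm_nonneg:
  assumes "d \<ge> 1" "A \<in> Cc d" shows "0 \<le> red_norm d A"
proof -
  obtain x where x: "x \<in> Omega d" using Omega_nonempty[OF assms(1)] by auto
  obtain C where C: "0 \<le> C" "\<forall>x\<in>Omega d. op_bound d x A C" by (rule op_bound_Cc[OF assms(2)])
  have "0 \<le> rep_norm d x A" using rep_norm_bound[of d x A C] C x by auto
  also have "\<dots> \<le> red_norm d A" unfolding red_norm_def
    using C rep_norm_le x by (intro cSUP_upper bdd_aboveI2[where M = C]) auto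
  finally show ?thesis .
qed

text \<open>The comparison is only of moduli and only on the class, which absorbs unimodular factors
  such as those produced by the flow.\<close>

lemma op_bound_cong:
  assumes "\<And>y \<xi>. y \<in> hclass d x \<Longrightarrow> in_l2 (hclass d x) \<xi> \<Longrightarrow> cmod (rep d x A \<xi> y) = cmod (f \<xi> y)"
    "\<And>\<xi>. in_l2 (hclass d x) \<xi> \<Longrightarrow> in_l2 (hclass d x) (f \<xi>) \<and>
        l2_norm (hclass d x) (f \<xi>) \<le> C * l2_norm (hclass d x) \<xi>"
  shows "op_bound d x A C"
  unfolding op_bound_def
proof (intro allI impI)
  fix \<xi> assume \<xi>: "in_l2 (hclass d x) \<xi>"
  show "in_l2 (hclass d x) (rep d x A \<xi>) \<and>
      l2_norm (hclass d x) (rep d x A \<xi>) \<le> C * l2_norm (hclass d x) \<xi>"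
    using assms(2)[OF \<xi>] l2_cong[of "hclass d x" "rep d x A \<xi>" "f \<xi>"] assms(1)[OF _ \<xi>] by simp
qed

lemma red_norm_add:
  assumes d: "d \<ge> 1" and A: "A \<in> Cc d" and B: "B \<in> Cc d"
  shows "red_norm d (\<lambda>g. A g + B g) \<le> red_norm d A + red_norm d B"
proof (rule red_norm_le[OF d])
  show "0 \<le> red_norm d A + red_norm d B" using red_norm_nonneg[OF d] A B by simp
  fix x assume x: "x \<in> Omega d"
  obtain N where N: "N \<ge> 1" "supported d N A" "supported d N B" by (rule Cc_support2[OF A B])
  have N': "supported d N (\<lambda>g. A g + B g)"
    using N(2,3) unfolding supported_def by (metis add_0)
  show "op_bound d x (\<lambda>g. A g + B g) (red_norm d A + red_norm d B)"
  proof (rule op_bound_cong)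
    fix \<xi>
    show "cmod (rep d x (\<lambda>g. A g + B g) \<xi> y) = cmod (rep d x A \<xi> y + rep d x B \<xi> y)" if "y \<in> hclass d x" for y
      using rep_eq[OF x that N(2)] rep_eq[OF x that N(3)] rep_eq[OF x that N']
      by (simp add: sum.distrib ring_distribs)
    assume \<xi>: "in_l2 (hclass d x) \<xi>"
    note bA = op_boundD[OF red_norm_op_bound[OF A x] \<xi>] and bB = op_boundD[OF red_norm_op_bound[OF B x] \<xi>]
    show "in_l2 (hclass d x) (\<lambda>y. rep d x A \<xi> y + rep d x B \<xi> y) \<and>
        l2_norm (hclass d x) (\<lambda>y. rep d x A \<xi> y + rep d x B \<xi> y)
          \<le> (red_norm d A + red_norm d B) * l2_norm (hclass d x) \<xi>"
      using l2_add[OF bA(1) bB(1)] bA(2) bB(2) by (simp add: ring_distribs)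
  qed
qed

lemma red_norm_scale:
  assumes d: "d \<ge> 1" and A: "A \<in> Cc d"
  shows "red_norm d (\<lambda>g. c * A g) \<le> cmod c * red_norm d A"
proof (rule red_norm_le[OF d])
  show "0 \<le> cmod c * red_norm d A" using red_norm_nonneg[OF d A] by simp
  fix x assume x: "x \<in> Omega d"
  show "op_bound d x (\<lambda>g. c * A g) (cmod c * red_norm d A)"
  proof (rule op_bound_cong)
    fix \<xi>
    show "cmod (rep d x (\<lambda>g. c * A g) \<xi> y) = cmod (c * rep d x A \<xi> y)" for y
      unfolding rep_def mult.assoc by (simp add: infsum_cmult_right')
    assume \<xi>: "in_l2 (hclass d x) \<xi>"
    note bA = op_boundD[OF red_norm_op_bound[OF A x] \<xi>]
    show "in_l2 (hclass d x) (\<lambda>y. c * rep d x A \<xi> y) \<and>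
        l2_norm (hclass d x) (\<lambda>y. c * rep d x A \<xi> y) \<le> cmod c * red_norm d A * l2_norm (hclass d x) \<xi>"
      using l2_scale[OF bA(1)] mult_left_mono[OF bA(2), of "cmod c"] by (simp add: mult.assoc)
  qed
qed

lemma red_norm_diff_triangle:
  assumes d: "d \<ge> 1" and A: "A \<in> Cc d" and B: "B \<in> Cc d" and C: "C \<in> Cc d"
  shows "red_norm d (\<lambda>g. A g - C g) \<le> red_norm d (\<lambda>g. A g - B g) + red_norm d (\<lambda>g. B g - C g)"
  using red_norm_add[OF d Cc_diff[OF A B] Cc_diff[OF B C]] by simp

lemma red_norm_minus:
  assumes d: "d \<ge> 1" and A: "A \<in> Cc d" and B: "B \<in> Cc d"
  shows "red_norm d (\<lambda>g. A g - B g) = red_norm d (\<lambda>g. B g - A g)"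
  using red_norm_scale[OF d Cc_diff[OF A B], of "- 1"] red_norm_scale[OF d Cc_diff[OF B A], of "- 1"] by simp

lemma red_norm_zero: "d \<ge> 1 \<Longrightarrow> red_norm d (\<lambda>_. 0) = 0"
  using red_norm_scale[of d "\<lambda>_. 0" 0] red_norm_nonneg[of d "\<lambda>_. 0"] Cc_zero by simp

lemma rep_kconv:
  assumes x: "x \<in> Omega d" and y: "y \<in> hclass d x" and N: "supported d N A" "supported d N B"
  shows "rep d x (kconv d A B) \<xi> y = rep d x A (rep d x B \<xi>) y"
proof -
  have yO: "y \<in> Omega d" using y by (simp add: hclass_def)
  \<comment> \<open>Neighbourhoods are equivalence classes of the band, so both sums of the product
    run over one and the same finite set.\<close>
  have eqn: "nbhd d N v = nbhd d N y" if "v \<in> nbhd d N y" for v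
    using that by (auto simp: nbhd_def intro: band_trans band_sym)
  have "rep d x (kconv d A B) \<xi> y = (\<Sum>z\<in>nbhd d N y. (\<Sum>v\<in>nbhd d N y. A (y, v) * B (v, z)) * \<xi> z)"
    unfolding rep_eq[OF x y kconv_support[OF N]]
  proof (rule sum.cong[OF refl])
    fix z assume "z \<in> nbhd d N y"
    then have yz: "(y, z) \<in> G d" using subsetD[OF band_subset_G, of _ d N] by (auto simp: nbhd_def)
    then have "kconv d A B (y, z) = (\<Sum>v\<in>nbhd d N y. A (y, v) * B (v, z))"
      using supportedD[OF N(1)] by (intro kconv_eq[OF yz]) (metis mult_zero_left)
    then show "kconv d A B (y, z) * \<xi> z = (\<Sum>v\<in>nbhd d N y. A (y, v) * B (v, z)) * \<xi> z" by simp
  qed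
  also have "\<dots> = (\<Sum>v\<in>nbhd d N y. A (y, v) * (\<Sum>z\<in>nbhd d N y. B (v, z) * \<xi> z))"
    unfolding sum_distrib_left sum_distrib_right by (subst sum.swap) (simp add: mult.assoc)
  also have "\<dots> = (\<Sum>v\<in>nbhd d N y. A (y, v) * rep d x B \<xi> v)"
  proof (rule sum.cong[OF refl])
    fix v assume v: "v \<in> nbhd d N y"
    then have "v \<in> hclass d x" using nbhd_subset_hclass[OF x y] by blast
    then show "A (y, v) * (\<Sum>z\<in>nbhd d N y. B (v, z) * \<xi> z) = A (y, v) * rep d x B \<xi> v"
      using rep_eq[OF x _ N(2)] eqn[OF v] by simp
  qed
  also have "\<dots> = rep d x A (rep d x B \<xi>) y" using rep_eq[OF x y N(1)] by simp
  finally show ?thesis .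
qed

lemma red_norm_kconv:
  assumes d: "d \<ge> 1" and A: "A \<in> Cc d" and B: "B \<in> Cc d"
  shows "red_norm d (kconv d A B) \<le> red_norm d A * red_norm d B"
proof (rule red_norm_le[OF d])
  show "0 \<le> red_norm d A * red_norm d B" using red_norm_nonneg[OF d] A B by simp
  fix x assume x: "x \<in> Omega d"
  obtain N where N: "N \<ge> 1" "supported d N A" "supported d N B" by (rule Cc_support2[OF A B])
  show "op_bound d x (kconv d A B) (red_norm d A * red_norm d B)"
  proof (rule op_bound_cong)
    fix \<xi>
    show "cmod (rep d x (kconv d A B) \<xi> y) = cmod (rep d x A (rep d x B \<xi>) y)" if "y \<in> hclass d x" for y
      using rep_kconv[OF x that N(2,3)] by simp
    assume \<xi>: "in_l2 (hclass d x) \<xi>"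
    note bB = op_boundD[OF red_norm_op_bound[OF B x] \<xi>]
    note bA = op_boundD[OF red_norm_op_bound[OF A x] bB(1)]
    show "in_l2 (hclass d x) (rep d x A (rep d x B \<xi>)) \<and>
        l2_norm (hclass d x) (rep d x A (rep d x B \<xi>)) \<le> red_norm d A * red_norm d B * l2_norm (hclass d x) \<xi>"
      using bA order_trans[OF bA(2) mult_left_mono[OF bB(2) red_norm_nonneg[OF d A]]] by (simp add: mult.assoc)
  qed
qed

text \<open>Duality on finite sets: for \<open>\<eta>\<close> the truncation of \<open>A\<^sup>*\<xi>\<close> to \<open>F\<close>,
  one has \<open>\<parallel>\<eta>\<parallel>\<^sup>2 = \<langle>\<xi>, A\<eta>\<rangle> \<le> C \<parallel>\<xi>\<parallel> \<parallel>\<eta>\<parallel>\<close>.\<close>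

lemma red_norm_kstar:
  assumes d: "d \<ge> 1" and A: "A \<in> Cc d"
  shows "red_norm d (kstar A) \<le> red_norm d A"
proof (rule red_norm_le[OF d])
  show nn: "0 \<le> red_norm d A" using red_norm_nonneg[OF d A] .
  fix x assume x: "x \<in> Omega d"
  obtain N where N: "N \<ge> 1" "supported d N A" by (rule Cc_support[OF A])
  have N': "supported d N (kstar A)"
    using N(2) band_sym by (auto simp: kstar_def supported_def)
  define S where "S = hclass d x"
  show "op_bound d x (kstar A) (red_norm d A)"
    unfolding op_bound_def S_def[symmetric]
  proof (intro allI impI)
    fix \<xi> assume \<xi>: "in_l2 S \<xi>"
    define \<zeta> where "\<zeta> = rep d x (kstar A) \<xi>"
    have "L2_set (\<lambda>y. cmod (\<zeta> y)) F \<le> red_norm d A * l2_norm S \<xi>" if F: "finite F" "F \<subseteq> S" for F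
    proof -
      define F' where "F' = (\<Union>y\<in>F. nbhd d N y)"
      have F': "finite F'" "F' \<subseteq> S"
        unfolding F'_def S_def using F[unfolded S_def] finite_nbhd nbhd_subset_hclass[OF x]
        by (blast, intro UN_least) blast
      define \<eta> where "\<eta> = (\<lambda>y. if y \<in> F then \<zeta> y else 0)"
      define L where "L = L2_set (\<lambda>y. cmod (\<zeta> y)) F"
      have \<eta>L: "L2_set (\<lambda>y. cmod (\<eta> y)) H \<le> L" if "finite H" for H
      proof -
        have "(\<Sum>y\<in>H. (cmod (\<eta> y))\<^sup>2) = (\<Sum>y\<in>H \<inter> F. (cmod (\<zeta> y))\<^sup>2)"
          using that by (intro sum.mono_neutral_cong_right) (auto simp: \<eta>_def)
        also have "\<dots> \<le> (\<Sum>y\<in>F. (cmod (\<zeta> y))\<^sup>2)"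
          using F by (intro sum_mono2) auto
        finally show ?thesis by (simp add: L_def L2_set_def)
      qed
      have L0: "0 \<le> L" by (simp add: L_def)
      have \<eta>: "in_l2 S \<eta>" "l2_norm S \<eta> \<le> L"
        using in_l2I[of S \<eta> L] \<eta>L L0 by auto
      have rep\<eta>: "rep d x A \<eta> z = (\<Sum>y\<in>F. A (z, y) * \<zeta> y)" if z: "z \<in> S" for z
      proof -
        have "rep d x A \<eta> z = (\<Sum>y\<in>F \<union> nbhd d N z. A (z, y) * \<eta> y)"
          using F z finite_nbhd by (intro rep_eq_sum[OF x _ N(2)]) (auto simp: S_def)
        also have "\<dots> = (\<Sum>y\<in>F. A (z, y) * \<zeta> y)"
          using F finite_nbhd by (intro sum.mono_neutral_cong_right) (auto simp: \<eta>_def)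
        finally show ?thesis .
      qed
      have \<zeta>: "\<zeta> y = (\<Sum>z\<in>F'. cnj (A (z, y)) * \<xi> z)" if y: "y \<in> F" for y
        unfolding \<zeta>_def using y F F'
        by (subst rep_eq_sum[OF x _ N', where T = F']) (auto simp: S_def F'_def kstar_def)
      have "complex_of_real (L\<^sup>2) = (\<Sum>y\<in>F. \<zeta> y * cnj (\<zeta> y))"
        by (simp add: L_def L2_set_def sum_nonneg complex_norm_square[symmetric])
      also have "\<dots> = (\<Sum>y\<in>F. \<Sum>z\<in>F'. \<xi> z * cnj (A (z, y) * \<zeta> y))"
        using \<zeta> by (intro sum.cong) (auto simp: sum_distrib_right mult_ac)
      also have "\<dots> = (\<Sum>z\<in>F'. \<xi> z * cnj (rep d x A \<eta> z))"
        using F' rep\<eta> by (subst sum.swap) (auto simp: sum_distrib_left intro!: sum.cong)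
      finally have "L\<^sup>2 = cmod (\<Sum>z\<in>F'. \<xi> z * cnj (rep d x A \<eta> z))"
        by (metis norm_of_real abs_of_nonneg zero_le_power2)
      also have "\<dots> \<le> (\<Sum>z\<in>F'. \<bar>cmod (\<xi> z)\<bar> * \<bar>cmod (rep d x A \<eta> z)\<bar>)"
        by (intro sum_norm_le) (simp add: norm_mult)
      also have "\<dots> \<le> L2_set (\<lambda>z. cmod (\<xi> z)) F' * L2_set (\<lambda>z. cmod (rep d x A \<eta> z)) F'"
        by (rule L2_set_mult_ineq)
      also have "\<dots> \<le> l2_norm S \<xi> * (red_norm d A * L)"
      proof (rule mult_mono)
        show "L2_set (\<lambda>z. cmod (\<xi> z)) F' \<le> l2_norm S \<xi>" using \<xi> F' by (rule L2_set_le_l2_norm)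
        note b = op_boundD[OF red_norm_op_bound[OF A x] \<eta>(1)[unfolded S_def]]
        have "L2_set (\<lambda>z. cmod (rep d x A \<eta> z)) F' \<le> l2_norm S (rep d x A \<eta>)"
          using b(1) F' unfolding S_def by (rule L2_set_le_l2_norm)
        also have "\<dots> \<le> red_norm d A * l2_norm S \<eta>" using b(2) by (simp add: S_def)
        also have "\<dots> \<le> red_norm d A * L" using \<eta>(2) nn by (rule mult_left_mono)
        finally show "L2_set (\<lambda>z. cmod (rep d x A \<eta> z)) F' \<le> red_norm d A * L" .
      qed (auto simp: l2_norm_nonneg)
      finally have "L * L \<le> (red_norm d A * l2_norm S \<xi>) * L" by (simp add: power2_eq_square mult_ac)
      then show "L \<le> red_norm d A * l2_norm S \<xi>"
        using L0 nn l2_norm_nonneg[of S \<xi>] by (cases "L = 0") auto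
    qed
    then show "in_l2 S (rep d x (kstar A) \<xi>) \<and> l2_norm S (rep d x (kstar A) \<xi>) \<le> red_norm d A * l2_norm S \<xi>"
      unfolding \<zeta>_def using nn l2_norm_nonneg[of S \<xi>]
      by (intro conjI in_l2I(1)[where C = "red_norm d A * l2_norm S \<xi>"] in_l2I(2)) simp_all
  qed
qed

text \<open>By the cocycle identity \<open>W (y, z) = W (y, x) + W (x, z)\<close> the flow is, in
  the representation on the class of \<open>x\<close>, conjugation by a diagonal unitary:
  \<open>u\<close> acts on the vector and \<open>v\<close> on the result.\<close>

lemma red_norm_kflow:
  assumes d: "d \<ge> 1" and A: "A \<in> Cc d" and W: "modular_function d W"
  shows "red_norm d (kflow W t A) \<le> red_norm d A"
proof (rule red_norm_le[OF d])
  show "0 \<le> red_norm d A" using red_norm_nonneg[OF d A] .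
  fix x assume x: "x \<in> Omega d"
  define u where "u y = exp (\<i> * complex_of_real (W (x, y) * t))" for y
  define v where "v y = exp (\<i> * complex_of_real (W (y, x) * t))" for y
  have uv: "cmod (u y) = 1" "cmod (v y) = 1" for y
    by (auto simp: u_def v_def)
  show "op_bound d x (kflow W t A) (red_norm d A)"
  proof (rule op_bound_cong)
    fix \<xi>
    show "cmod (rep d x (kflow W t A) \<xi> y) = cmod (rep d x A (\<lambda>z. u z * \<xi> z) y)" if y: "y \<in> hclass d x" for y
    proof -
      have "rep d x (kflow W t A) \<xi> y = (\<Sum>\<^sub>\<infinity>z\<in>hclass d x. v y * (A (y, z) * (u z * \<xi> z)))"
        unfolding rep_def
      proof (rule infsum_cong)
        fix z assume "z \<in> hclass d x"
        then have "(x, z) \<in> G d" "(y, x) \<in> G d" using y hclass_iff[OF x] G_sym by auto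
        then have "W (y, z) = W (y, x) + W (x, z)" using W unfolding modular_function_def by metis
        then show "kflow W t A (y, z) * \<xi> z = v y * (A (y, z) * (u z * \<xi> z))"
          by (simp add: kflow_def u_def v_def ring_distribs exp_add mult_ac)
      qed
      then show ?thesis by (simp add: rep_def infsum_cmult_right' norm_mult uv)
    qed
    assume \<xi>: "in_l2 (hclass d x) \<xi>"
    have c: "in_l2 (hclass d x) (\<lambda>z. u z * \<xi> z)"
        "l2_norm (hclass d x) (\<lambda>z. u z * \<xi> z) = l2_norm (hclass d x) \<xi>"
      using l2_cong[of "hclass d x" "\<lambda>z. u z * \<xi> z" \<xi>] \<xi> by (auto simp: norm_mult uv)
    show "in_l2 (hclass d x) (rep d x A (\<lambda>z. u z * \<xi> z)) \<and>
        l2_norm (hclass d x) (rep d x A (\<lambda>z. u z * \<xi> z)) \<le> red_norm d A * l2_norm (hclass d x) \<xi>"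
      using op_boundD[OF red_norm_op_bound[OF A x] c(1)] c(2) by simp
  qed
qed

lemma diagonal_le_red_norm:
  assumes A: "A \<in> Cc d" and x: "x \<in> Omega d"
  shows "cmod (A (x, x)) \<le> red_norm d A"
proof -
  \<comment> \<open>The diagonal entry is read off at the unit vector located at
    \<open>x\<close>.\<close>
  define \<delta> where "\<delta> = (\<lambda>y. if y = x then 1 else 0 :: complex)"
  have "(\<Sum>y\<in>F. (cmod (\<delta> y))\<^sup>2) \<le> 1" if "finite F" for F
  proof -
    have "(\<Sum>y\<in>F. (cmod (\<delta> y))\<^sup>2) = (\<Sum>y\<in>F. if x = y then 1 else 0)"
      by (intro sum.cong) (auto simp: \<delta>_def)
    then show ?thesis using that by simp
  qed
  then have \<delta>: "in_l2 (hclass d x) \<delta>" "l2_norm (hclass d x) \<delta> \<le> 1"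
    using in_l2I[of "hclass d x" \<delta> 1] by (auto simp: L2_set_def)
  obtain N where N: "N \<ge> 1" "supported d N A" by (rule Cc_support[OF A])
  have "rep d x A \<delta> x = (\<Sum>z\<in>nbhd d N x. if x = z then A (x, x) else 0)"
    unfolding rep_eq[OF x hclass_self[OF x] N(2)] by (intro sum.cong) (auto simp: \<delta>_def)
  also have "\<dots> = A (x, x)" using finite_nbhd[of d N x] band_refl[OF x] by (simp add: nbhd_def)
  finally have "cmod (A (x, x)) = L2_set (\<lambda>y. cmod (rep d x A \<delta> y)) {x}" by (simp add: L2_set_def)
  also have "\<dots> \<le> l2_norm (hclass d x) (rep d x A \<delta>)"
    using op_boundD(1)[OF red_norm_op_bound[OF A x] \<delta>(1)] hclass_self[OF x] by (intro L2_set_le_l2_norm) auto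
  also have "\<dots> \<le> red_norm d A"
  proof (rule op_bound_unit[OF red_norm_op_bound[OF A x] _ \<delta>])
    have "d \<ge> 1" using OmegaD[OF x, of 1] by auto
    then show "0 \<le> red_norm d A" using red_norm_nonneg A by blast
  qed
  finally show ?thesis .
qed

subsection \<open>The completion and the state of a probability measure\<close>

abbreviation cls :: "nat \<Rightarrow> (nat \<Rightarrow> kernel) \<Rightarrow> cstar" where
  "cls d a \<equiv> cstar_rel d `` {a}"

lemma Cauchy_seqsD:
  assumes "a \<in> Cauchy_seqs d"
  shows "a n \<in> Cc d" "e > 0 \<Longrightarrow> \<exists>N. \<forall>m\<ge>N. \<forall>n\<ge>N. red_norm d (\<lambda>g. a m g - a n g) < e"
  using assms by (auto simp: Cauchy_seqs_def)

lemma const_Cauchy_seqs: "d \<ge> 1 \<Longrightarrow> A \<in> Cc d \<Longrightarrow> (\<lambda>_. A) \<in> Cauchy_seqs d"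
  by (simp add: Cauchy_seqs_def red_norm_zero)

lemma equiv_cstar_rel:
  assumes d: "d \<ge> 1" shows "equiv (Cauchy_seqs d) (cstar_rel d)"
proof (rule equivI)
  show "cstar_rel d \<subseteq> Cauchy_seqs d \<times> Cauchy_seqs d" by (auto simp: cstar_rel_def)
  show "refl_on (Cauchy_seqs d) (cstar_rel d)"
    by (auto simp: refl_on_def cstar_rel_def red_norm_zero[OF d])
  show "sym (cstar_rel d)"
  proof (rule symI)
    fix a b assume ab: "(a, b) \<in> cstar_rel d"
    then have "red_norm d (\<lambda>g. a n g - b n g) = red_norm d (\<lambda>g. b n g - a n g)" for n
      by (intro red_norm_minus[OF d] Cauchy_seqsD(1)) (auto simp: cstar_rel_def)
    then show "(b, a) \<in> cstar_rel d" using ab by (simp add: cstar_rel_def)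
  qed
  show "trans (cstar_rel d)"
  proof (rule transI)
    fix a b c assume ab: "(a, b) \<in> cstar_rel d" and bc: "(b, c) \<in> cstar_rel d"
    then have C: "a \<in> Cauchy_seqs d" "b \<in> Cauchy_seqs d" "c \<in> Cauchy_seqs d" by (auto simp: cstar_rel_def)
    have "(\<lambda>n. red_norm d (\<lambda>g. a n g - c n g)) \<longlonglongrightarrow> 0"
    proof (rule tendsto_sandwich[OF _ _ tendsto_const])
      show "(\<lambda>n. red_norm d (\<lambda>g. a n g - b n g) + red_norm d (\<lambda>g. b n g - c n g)) \<longlonglongrightarrow> 0"
        using ab bc by (intro tendsto_add_zero) (auto simp: cstar_rel_def)
      show "\<forall>\<^sub>F n in sequentially. 0 \<le> red_norm d (\<lambda>g. a n g - c n g)"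
        using C by (intro always_eventually allI red_norm_nonneg[OF d] Cc_diff Cauchy_seqsD(1))
      show "\<forall>\<^sub>F n in sequentially. red_norm d (\<lambda>g. a n g - c n g) \<le>
          red_norm d (\<lambda>g. a n g - b n g) + red_norm d (\<lambda>g. b n g - c n g)"
        using C by (intro always_eventually allI red_norm_diff_triangle[OF d] Cauchy_seqsD(1))
    qed
    then show "(a, c) \<in> cstar_rel d" using C by (simp add: cstar_rel_def)
  qed
qed

lemma Cstar_cases:
  assumes "X \<in> Cstar d" obtains a where "a \<in> Cauchy_seqs d" "X = cls d a"
  using assms unfolding Cstar_def by (rule quotientE)

section \<open>Lifting operations to classes of Cauchy sequences\<close>

lemma red_norm_triangle2:
  assumes "d \<ge> 1" "A \<in> Cc d" "B \<in> Cc d"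
  shows "red_norm d A \<le> red_norm d (\<lambda>g. A g - B g) + red_norm d B"
  using red_norm_add[OF assms(1) Cc_diff[OF assms(2,3)] assms(3)] by simp

lemma Cauchy_seqs_bounded:
  assumes d: "d \<ge> 1" and a: "a \<in> Cauchy_seqs d"
  obtains M where "0 \<le> M" "\<forall>n. red_norm d (a n) \<le> M"
proof -
  obtain N where N: "\<forall>m\<ge>N. \<forall>n\<ge>N. red_norm d (\<lambda>g. a m g - a n g) < 1"
    using Cauchy_seqsD(2)[OF a, of 1] by auto
  \<comment> \<open>The \<open>+ 1\<close> is the Cauchy tolerance: beyond \<open>N\<close> every
    term lies within 1 of the term with index \<open>N\<close>.\<close>
  define M where "M = Max ((\<lambda>n. red_norm d (a n)) ` {..N}) + 1"
  have M: "red_norm d (a n) \<le> M - 1" if "n \<le> N" for n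
    unfolding M_def using that by (simp add: Max_ge)
  have "red_norm d (a n) \<le> M" for n
  proof (cases "n \<le> N")
    case True
    then show ?thesis using M[of n] by simp
  next
    case False
    then have "red_norm d (\<lambda>g. a n g - a N g) < 1" using N by simp
    moreover have "red_norm d (a n) \<le> red_norm d (\<lambda>g. a n g - a N g) + red_norm d (a N)"
      by (intro red_norm_triangle2 d Cauchy_seqsD(1)[OF a])
    ultimately show ?thesis using M[of N] by simp
  qed
  moreover have "0 \<le> M"
    using M[of 0] red_norm_nonneg[OF d Cauchy_seqsD(1)[OF a], of 0] by simp
  ultimately show thesis using that by blast
qed

text \<open>One Lipschitz estimate does two jobs: it keeps termwise images Cauchy, and it makes
  their class independent of the representative, so that the union in \<open>cstar_lift\<close>
  collapses to a single class.\<close>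

lemma cstar_lift_cls:
  assumes d: "d \<ge> 1" and a: "a \<in> Cauchy_seqs d"
    and f: "\<And>A. A \<in> Cc d \<Longrightarrow> f A \<in> Cc d"
    and lip: "\<And>A B. A \<in> Cc d \<Longrightarrow> B \<in> Cc d \<Longrightarrow>
      red_norm d (\<lambda>g. f A g - f B g) \<le> K * red_norm d (\<lambda>g. A g - B g)"
  shows "(\<lambda>n. f (a n)) \<in> Cauchy_seqs d" "cstar_lift d f (cls d a) = cls d (\<lambda>n. f (a n))"
proof -
  have f_Cauchy: "(\<lambda>n. f (b n)) \<in> Cauchy_seqs d" if b: "b \<in> Cauchy_seqs d" for b
    unfolding Cauchy_seqs_def
  proof (intro CollectI conjI allI impI)
    show "f (b n) \<in> Cc d" for n using f Cauchy_seqsD(1)[OF b] .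
    fix e :: real assume e: "e > 0"
    \<comment> \<open>\<open>K\<close> carries no sign assumption; the enlarged constant is positive
      and may be divided by.\<close>
    define K' where "K' = \<bar>K\<bar> + 1"
    have K': "K' > 0" "K \<le> K'" by (auto simp: K'_def)
    obtain N where N: "\<forall>m\<ge>N. \<forall>n\<ge>N. red_norm d (\<lambda>g. b m g - b n g) < e / K'"
      using Cauchy_seqsD(2)[OF b, of "e / K'"] e K' by auto
    have "red_norm d (\<lambda>g. f (b m) g - f (b n) g) < e" if "m \<ge> N" "n \<ge> N" for m n
    proof -
      note mn = Cauchy_seqsD(1)[OF b, of m] Cauchy_seqsD(1)[OF b, of n]
      have "red_norm d (\<lambda>g. f (b m) g - f (b n) g) \<le> K * red_norm d (\<lambda>g. b m g - b n g)"
        using lip[OF mn] .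
      also have "\<dots> \<le> K' * red_norm d (\<lambda>g. b m g - b n g)"
        using K' red_norm_nonneg[OF d Cc_diff[OF mn]] by (intro mult_right_mono)
      also have "\<dots> < e" using N that K' by (simp add: pos_less_divide_eq mult.commute)
      finally show ?thesis .
    qed
    then show "\<exists>N. \<forall>m\<ge>N. \<forall>n\<ge>N. red_norm d (\<lambda>g. f (b m) g - f (b n) g) < e" by blast
  qed
  then show "(\<lambda>n. f (a n)) \<in> Cauchy_seqs d" using a .
  have "congruent (cstar_rel d) (\<lambda>b. cls d (\<lambda>n. f (b n)))"
  proof (rule congruentI)
    fix b c assume bc: "(b, c) \<in> cstar_rel d"
    then have C: "b \<in> Cauchy_seqs d" "c \<in> Cauchy_seqs d"
      and z: "(\<lambda>n. red_norm d (\<lambda>g. b n g - c n g)) \<longlonglongrightarrow> 0" by (auto simp: cstar_rel_def)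
    have "(\<lambda>n. red_norm d (\<lambda>g. f (b n) g - f (c n) g)) \<longlonglongrightarrow> 0"
    proof (rule tendsto_sandwich[OF _ _ tendsto_const])
      show "(\<lambda>n. K * red_norm d (\<lambda>g. b n g - c n g)) \<longlonglongrightarrow> 0"
        using tendsto_mult_left[OF z, of K] by simp
      show "\<forall>\<^sub>F n in sequentially. 0 \<le> red_norm d (\<lambda>g. f (b n) g - f (c n) g)"
        using C by (intro always_eventually allI red_norm_nonneg[OF d] Cc_diff f Cauchy_seqsD(1))
      show "\<forall>\<^sub>F n in sequentially. red_norm d (\<lambda>g. f (b n) g - f (c n) g) \<le> K * red_norm d (\<lambda>g. b n g - c n g)"
        using C by (intro always_eventually allI lip Cauchy_seqsD(1))
    qed
    then have "((\<lambda>n. f (b n)), (\<lambda>n. f (c n))) \<in> cstar_rel d"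
      using f_Cauchy C by (simp add: cstar_rel_def)
    then show "cls d (\<lambda>n. f (b n)) = cls d (\<lambda>n. f (c n))"
      by (rule equiv_class_eq[OF equiv_cstar_rel[OF d]])
  qed
  then show "cstar_lift d f (cls d a) = cls d (\<lambda>n. f (a n))"
    unfolding cstar_lift_def by (rule UN_equiv_class[OF equiv_cstar_rel[OF d] _ a])
qed

text \<open>The estimate \<open>lip\<close> is chosen so as to cover both addition and convolution.\<close>

lemma cstar_lift2_cls:
  assumes d: "d \<ge> 1" and a: "a \<in> Cauchy_seqs d" and b: "b \<in> Cauchy_seqs d"
    and f: "\<And>A B. A \<in> Cc d \<Longrightarrow> B \<in> Cc d \<Longrightarrow> f A B \<in> Cc d"
    and lip: "\<And>A B A' B'. A \<in> Cc d \<Longrightarrow> B \<in> Cc d \<Longrightarrow> A' \<in> Cc d \<Longrightarrow> B' \<in> Cc d \<Longrightarrow>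
      red_norm d (\<lambda>g. f A B g - f A' B' g) \<le>
        red_norm d (\<lambda>g. A g - A' g) * (1 + red_norm d B) + (1 + red_norm d A') * red_norm d (\<lambda>g. B g - B' g)"
  shows "(\<lambda>n. f (a n) (b n)) \<in> Cauchy_seqs d"
    "cstar_lift2 d f (cls d a) (cls d b) = cls d (\<lambda>n. f (a n) (b n))"
proof -
  \<comment> \<open>The estimate \<open>lip\<close> is only locally Lipschitz. Cauchy sequences are
    bounded in norm, and a bound \<open>M\<close> on the two factors occurring in it turns it into a
    Lipschitz estimate with the constant \<open>1 + M\<close>.\<close>
  have bound: "red_norm d (\<lambda>g. f A B g - f A' B' g) \<le>
      (1 + M) * (red_norm d (\<lambda>g. A g - A' g) + red_norm d (\<lambda>g. B g - B' g))"
    if "A \<in> Cc d" "B \<in> Cc d" "A' \<in> Cc d" "B' \<in> Cc d" "red_norm d B \<le> M" "red_norm d A' \<le> M" for A B A' B' M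
  proof -
    have "red_norm d (\<lambda>g. f A B g - f A' B' g) \<le>
        red_norm d (\<lambda>g. A g - A' g) * (1 + red_norm d B) + (1 + red_norm d A') * red_norm d (\<lambda>g. B g - B' g)"
      using that by (intro lip)
    also have "\<dots> \<le> red_norm d (\<lambda>g. A g - A' g) * (1 + M) + (1 + M) * red_norm d (\<lambda>g. B g - B' g)"
      using that by (intro add_mono mult_left_mono mult_right_mono red_norm_nonneg[OF d] Cc_diff) auto
    finally show ?thesis by (simp add: algebra_simps)
  qed
  have f_Cauchy: "(\<lambda>n. f (a n) (b n)) \<in> Cauchy_seqs d"
    if a: "a \<in> Cauchy_seqs d" and b: "b \<in> Cauchy_seqs d" for a b
    unfolding Cauchy_seqs_def
  proof (intro CollectI conjI allI impI)
    note ac = Cauchy_seqsD(1)[OF a] and bc = Cauchy_seqsD(1)[OF b]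
    show "f (a n) (b n) \<in> Cc d" for n using f ac bc .
    obtain M1 where M1: "0 \<le> M1" "\<forall>n. red_norm d (a n) \<le> M1" by (rule Cauchy_seqs_bounded[OF d a])
    obtain M2 where M2: "0 \<le> M2" "\<forall>n. red_norm d (b n) \<le> M2" by (rule Cauchy_seqs_bounded[OF d b])
    define M where "M = max M1 M2"
    have M: "0 < 1 + M" "\<And>n. red_norm d (a n) \<le> M" "\<And>n. red_norm d (b n) \<le> M"
      using M1 M2 by (auto simp: M_def le_max_iff_disj)
    fix e :: real assume e: "e > 0"
    define e' where "e' = e / (2 * (1 + M))"
    have e': "e' > 0" using e M(1) by (simp add: e'_def)
    obtain N1 where N1: "\<forall>m\<ge>N1. \<forall>n\<ge>N1. red_norm d (\<lambda>g. a m g - a n g) < e'"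
      using Cauchy_seqsD(2)[OF a e'] by auto
    obtain N2 where N2: "\<forall>m\<ge>N2. \<forall>n\<ge>N2. red_norm d (\<lambda>g. b m g - b n g) < e'"
      using Cauchy_seqsD(2)[OF b e'] by auto
    have "red_norm d (\<lambda>g. f (a m) (b m) g - f (a n) (b n) g) < e"
      if "m \<ge> max N1 N2" "n \<ge> max N1 N2" for m n
    proof -
      have "red_norm d (\<lambda>g. f (a m) (b m) g - f (a n) (b n) g) \<le>
          (1 + M) * (red_norm d (\<lambda>g. a m g - a n g) + red_norm d (\<lambda>g. b m g - b n g))"
        by (intro bound ac bc M)
      also have "\<dots> < (1 + M) * (e' + e')"
        using N1 N2 that M(1) by (intro mult_strict_left_mono add_strict_mono) auto
      also have "\<dots> = e"
      proof -
        have "e' * (2 * (1 + M)) = e" using M(1) by (simp add: e'_def)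
        then show ?thesis by (simp add: algebra_simps)
      qed
      finally show ?thesis .
    qed
    then show "\<exists>N. \<forall>m\<ge>N. \<forall>n\<ge>N. red_norm d (\<lambda>g. f (a m) (b m) g - f (a n) (b n) g) < e" by blast
  qed
  then show "(\<lambda>n. f (a n) (b n)) \<in> Cauchy_seqs d" using a b .
  have "congruent2 (cstar_rel d) (cstar_rel d) (\<lambda>a b. cls d (\<lambda>n. f (a n) (b n)))"
  proof (rule congruent2I')
    fix a a' b b' assume r: "(a, a') \<in> cstar_rel d" "(b, b') \<in> cstar_rel d"
    then have C: "a \<in> Cauchy_seqs d" "a' \<in> Cauchy_seqs d" "b \<in> Cauchy_seqs d" "b' \<in> Cauchy_seqs d"
      and z: "(\<lambda>n. red_norm d (\<lambda>g. a n g - a' n g)) \<longlonglongrightarrow> 0" "(\<lambda>n. red_norm d (\<lambda>g. b n g - b' n g)) \<longlonglongrightarrow> 0"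
      by (auto simp: cstar_rel_def)
    note cc = C[THEN Cauchy_seqsD(1)]
    obtain M1 where M1: "0 \<le> M1" "\<forall>n. red_norm d (a' n) \<le> M1" by (rule Cauchy_seqs_bounded[OF d C(2)])
    obtain M2 where M2: "0 \<le> M2" "\<forall>n. red_norm d (b n) \<le> M2" by (rule Cauchy_seqs_bounded[OF d C(3)])
    define M where "M = max M1 M2"
    have M: "red_norm d (b n) \<le> M" "red_norm d (a' n) \<le> M" for n
      using M1 M2 by (auto simp: M_def le_max_iff_disj)
    have "(\<lambda>n. red_norm d (\<lambda>g. f (a n) (b n) g - f (a' n) (b' n) g)) \<longlonglongrightarrow> 0"
    proof (rule tendsto_sandwich[OF _ _ tendsto_const])
      show "(\<lambda>n. (1 + M) * (red_norm d (\<lambda>g. a n g - a' n g) + red_norm d (\<lambda>g. b n g - b' n g))) \<longlonglongrightarrow> 0"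
        using tendsto_mult_left[OF tendsto_add_zero[OF z], of "1 + M"] by simp
      show "\<forall>\<^sub>F n in sequentially. 0 \<le> red_norm d (\<lambda>g. f (a n) (b n) g - f (a' n) (b' n) g)"
        by (intro always_eventually allI red_norm_nonneg[OF d] Cc_diff f cc)
      show "\<forall>\<^sub>F n in sequentially. red_norm d (\<lambda>g. f (a n) (b n) g - f (a' n) (b' n) g) \<le>
          (1 + M) * (red_norm d (\<lambda>g. a n g - a' n g) + red_norm d (\<lambda>g. b n g - b' n g))"
        by (intro always_eventually allI bound cc M)
    qed
    then have "((\<lambda>n. f (a n) (b n)), (\<lambda>n. f (a' n) (b' n))) \<in> cstar_rel d"
      using f_Cauchy C by (simp add: cstar_rel_def)
    then show "cls d (\<lambda>n. f (a n) (b n)) = cls d (\<lambda>n. f (a' n) (b' n))"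
      by (rule equiv_class_eq[OF equiv_cstar_rel[OF d]])
  qed
  then show "cstar_lift2 d f (cls d a) (cls d b) = cls d (\<lambda>n. f (a n) (b n))"
    unfolding cstar_lift2_def
    by (rule UN_equiv_class2[OF equiv_cstar_rel[OF d] equiv_cstar_rel[OF d] _ a b])
qed

text \<open>The telescoping identity for a difference of products. A common window for
  \<open>A\<close> and \<open>A'\<close> lets all the sums run over the same finite
  neighbourhood.\<close>

lemma kconv_diff:
  assumes A: "A \<in> Cc d" and A': "A' \<in> Cc d" and B: "B \<in> Cc d" and B': "B' \<in> Cc d"
  shows "kconv d A B g - kconv d A' B' g =
    kconv d (\<lambda>g. A g - A' g) B g + kconv d A' (\<lambda>g. B g - B' g) g"
proof (cases "g \<in> G d")
  case True
  obtain x y where [simp]: "g = (x, y)" by (cases g)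
  have g: "(x, y) \<in> G d" using True by simp
  obtain N where N: "N \<ge> 1" "supported d N A" "supported d N A'" by (rule Cc_support2[OF A A'])
  have s: "kconv d C D (x, y) = (\<Sum>z\<in>nbhd d N x. C (x, z) * D (z, y))" if "supported d N C" for C D
    using supportedD[OF that] by (intro kconv_eq[OF g]) (metis mult_zero_left)
  have N': "supported d N (\<lambda>g. A g - A' g)"
    using N(2,3) unfolding supported_def by (metis diff_self)
  show ?thesis
    using s[OF N(2)] s[OF N(3)] s[OF N']
    by (simp add: sum.distrib[symmetric] sum_subtractf[symmetric] algebra_simps)
next
  case False
  then show ?thesis by (cases g) (simp add: kconv_def)
qed

lemma red_norm_kconv_diff:
  assumes d: "d \<ge> 1" and A: "A \<in> Cc d" and B: "B \<in> Cc d" and A': "A' \<in> Cc d" and B': "B' \<in> Cc d"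
  shows "red_norm d (\<lambda>g. kconv d A B g - kconv d A' B' g) \<le>
    red_norm d (\<lambda>g. A g - A' g) * red_norm d B + red_norm d A' * red_norm d (\<lambda>g. B g - B' g)"
proof -
  have "red_norm d (\<lambda>g. kconv d A B g - kconv d A' B' g) \<le>
      red_norm d (kconv d (\<lambda>g. A g - A' g) B) + red_norm d (kconv d A' (\<lambda>g. B g - B' g))"
    unfolding kconv_diff[OF A A' B B'] by (intro red_norm_add d Cc_kconv Cc_diff assms)
  also have "\<dots> \<le> red_norm d (\<lambda>g. A g - A' g) * red_norm d B + red_norm d A' * red_norm d (\<lambda>g. B g - B' g)"
    by (intro add_mono red_norm_kconv d Cc_diff assms)
  finally show ?thesis .
qed

lemma cstar_mult_cls:
  assumes d: "d \<ge> 1" and a: "a \<in> Cauchy_seqs d" and b: "b \<in> Cauchy_seqs d"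
  shows "(\<lambda>n. kconv d (a n) (b n)) \<in> Cauchy_seqs d"
    "cstar_mult d (cls d a) (cls d b) = cls d (\<lambda>n. kconv d (a n) (b n))"
proof -
  have lip: "red_norm d (\<lambda>g. kconv d A B g - kconv d A' B' g) \<le>
      red_norm d (\<lambda>g. A g - A' g) * (1 + red_norm d B) + (1 + red_norm d A') * red_norm d (\<lambda>g. B g - B' g)"
    if "A \<in> Cc d" "B \<in> Cc d" "A' \<in> Cc d" "B' \<in> Cc d" for A B A' B'
    using red_norm_kconv_diff[OF d that] red_norm_nonneg[OF d Cc_diff[OF that(1,3)]]
      red_norm_nonneg[OF d Cc_diff[OF that(2,4)]] by (simp add: ring_distribs)
  show "(\<lambda>n. kconv d (a n) (b n)) \<in> Cauchy_seqs d"
    by (rule cstar_lift2_cls(1)[OF d a b Cc_kconv lip])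
  show "cstar_mult d (cls d a) (cls d b) = cls d (\<lambda>n. kconv d (a n) (b n))"
    unfolding cstar_mult_def by (rule cstar_lift2_cls(2)[OF d a b Cc_kconv lip])
qed

lemma cstar_add_cls:
  assumes d: "d \<ge> 1" and a: "a \<in> Cauchy_seqs d" and b: "b \<in> Cauchy_seqs d"
  shows "(\<lambda>n g. a n g + b n g) \<in> Cauchy_seqs d"
    "cstar_add d (cls d a) (cls d b) = cls d (\<lambda>n g. a n g + b n g)"
proof -
  have lip: "red_norm d (\<lambda>g. (A g + B g) - (A' g + B' g)) \<le>
      red_norm d (\<lambda>g. A g - A' g) * (1 + red_norm d B) + (1 + red_norm d A') * red_norm d (\<lambda>g. B g - B' g)"
    if "A \<in> Cc d" "B \<in> Cc d" "A' \<in> Cc d" "B' \<in> Cc d" for A B A' B'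
  proof -
    have "red_norm d (\<lambda>g. (A g + B g) - (A' g + B' g)) \<le> red_norm d (\<lambda>g. A g - A' g) + red_norm d (\<lambda>g. B g - B' g)"
      using red_norm_add[OF d Cc_diff[OF that(1,3)] Cc_diff[OF that(2,4)]] by (simp add: algebra_simps)
    moreover have "0 \<le> red_norm d (\<lambda>g. A g - A' g) * red_norm d B"
      "0 \<le> red_norm d A' * red_norm d (\<lambda>g. B g - B' g)"
      using that by (auto intro!: mult_nonneg_nonneg red_norm_nonneg[OF d] Cc_diff)
    ultimately show ?thesis by (simp add: ring_distribs)
  qed
  show "(\<lambda>n g. a n g + b n g) \<in> Cauchy_seqs d"
    by (rule cstar_lift2_cls(1)[OF d a b Cc_add lip])
  show "cstar_add d (cls d a) (cls d b) = cls d (\<lambda>n g. a n g + b n g)"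
    unfolding cstar_add_def by (rule cstar_lift2_cls(2)[OF d a b Cc_add lip])
qed

lemma cstar_scale_cls:
  assumes d: "d \<ge> 1" and a: "a \<in> Cauchy_seqs d"
  shows "(\<lambda>n g. c * a n g) \<in> Cauchy_seqs d" "cstar_scale d c (cls d a) = cls d (\<lambda>n g. c * a n g)"
proof -
  have lip: "red_norm d (\<lambda>g. c * A g - c * B g) \<le> cmod c * red_norm d (\<lambda>g. A g - B g)"
    if "A \<in> Cc d" "B \<in> Cc d" for A B
    using red_norm_scale[OF d Cc_diff[OF that], of c] by (simp add: right_diff_distrib)
  show "(\<lambda>n g. c * a n g) \<in> Cauchy_seqs d"
    by (rule cstar_lift_cls(1)[OF d a Cc_scale lip])
  show "cstar_scale d c (cls d a) = cls d (\<lambda>n g. c * a n g)"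
    unfolding cstar_scale_def by (rule cstar_lift_cls(2)[OF d a Cc_scale lip])
qed

lemma cstar_star_cls:
  assumes d: "d \<ge> 1" and a: "a \<in> Cauchy_seqs d"
  shows "(\<lambda>n. kstar (a n)) \<in> Cauchy_seqs d" "cstar_star d (cls d a) = cls d (\<lambda>n. kstar (a n))"
proof -
  have lip: "red_norm d (\<lambda>g. kstar A g - kstar B g) \<le> 1 * red_norm d (\<lambda>g. A g - B g)"
    if "A \<in> Cc d" "B \<in> Cc d" for A B
  proof -
    have "(\<lambda>g. kstar A g - kstar B g) = kstar (\<lambda>g. A g - B g)" by (auto simp: kstar_def)
    then show ?thesis using red_norm_kstar[OF d Cc_diff[OF that]] by simp
  qed
  show "(\<lambda>n. kstar (a n)) \<in> Cauchy_seqs d"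
    by (rule cstar_lift_cls(1)[OF d a Cc_kstar lip])
  show "cstar_star d (cls d a) = cls d (\<lambda>n. kstar (a n))"
    unfolding cstar_star_def by (rule cstar_lift_cls(2)[OF d a Cc_kstar lip])
qed

lemma modular_continuous: "modular_function d W \<Longrightarrow> continuous_map (G_top d) euclideanreal W"
  by (simp add: modular_function_def)

lemma red_norm_kflow_diff:
  assumes d: "d \<ge> 1" and W: "modular_function d W" and A: "A \<in> Cc d" and B: "B \<in> Cc d"
  shows "red_norm d (\<lambda>g. kflow W t A g - kflow W t B g) \<le> red_norm d (\<lambda>g. A g - B g)"
proof -
  have "(\<lambda>g. kflow W t A g - kflow W t B g) = kflow W t (\<lambda>g. A g - B g)"
    by (auto simp: kflow_def right_diff_distrib)
  then show ?thesis using red_norm_kflow[OF d Cc_diff[OF A B] W] by simp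
qed

lemma cstar_flow_cls:
  assumes d: "d \<ge> 1" and W: "modular_function d W" and a: "a \<in> Cauchy_seqs d"
  shows "(\<lambda>n. kflow W t (a n)) \<in> Cauchy_seqs d" "cstar_flow d W t (cls d a) = cls d (\<lambda>n. kflow W t (a n))"
proof -
  have lip: "red_norm d (\<lambda>g. kflow W t A g - kflow W t B g) \<le> 1 * red_norm d (\<lambda>g. A g - B g)"
    if "A \<in> Cc d" "B \<in> Cc d" for A B using red_norm_kflow_diff[OF d W that] by simp
  have C: "kflow W t A \<in> Cc d" if "A \<in> Cc d" for A
    by (rule Cc_kflow[OF that modular_continuous[OF W]])
  show "(\<lambda>n. kflow W t (a n)) \<in> Cauchy_seqs d"
    by (rule cstar_lift_cls(1)[OF d a C lip])
  show "cstar_flow d W t (cls d a) = cls d (\<lambda>n. kflow W t (a n))"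
    unfolding cstar_flow_def by (rule cstar_lift_cls(2)[OF d a C lip])
qed

section \<open>Borel probabilities and the diagonal functional\<close>

lemma Borel_probability_space:
  assumes "Borel_probability d \<nu>"
  shows "prob_space \<nu>" "space \<nu> = Omega d" "sets \<nu> = sigma_sets (Omega d) {U. openin (Omega_top d) U}"
proof -
  have sub: "{U. openin (Omega_top d) U} \<subseteq> Pow (Omega d)" using openin_subset by fastforce
  have s: "sets \<nu> = sets (Borel_Omega d)" using assms by (simp add: Borel_probability_def)
  show "prob_space \<nu>" using assms by (simp add: Borel_probability_def)
  show "space \<nu> = Omega d" using sets_eq_imp_space_eq[OF s] sub by (simp add: Borel_Omega_def)
  show "sets \<nu> = sigma_sets (Omega d) {U. openin (Omega_top d) U}"
    using s sub by (simp add: Borel_Omega_def)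
qed

lemma continuous_measurable:
  fixes f :: "config \<Rightarrow> 'a::real_normed_vector"
  assumes \<nu>: "Borel_probability d \<nu>" and f: "continuous_map (Omega_top d) euclidean f"
  shows "f \<in> borel_measurable \<nu>"
proof (rule borel_measurableI)
  fix S :: "'a set" assume "open S"
  then have "openin (Omega_top d) {x \<in> topspace (Omega_top d). f x \<in> S}"
    using f by (intro openin_continuous_map_preimage) auto
  moreover have "f -` S \<inter> space \<nu> = {x \<in> topspace (Omega_top d). f x \<in> S}"
    using Borel_probability_space(2)[OF \<nu>] by auto
  ultimately show "f -` S \<inter> space \<nu> \<in> sets \<nu>"
    using Borel_probability_space(3)[OF \<nu>] by (auto intro: sigma_sets.Basic)
qed

lemma continuous_Omega_bounded:
  fixes f :: "config \<Rightarrow> 'a::real_normed_vector"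
  assumes "continuous_map (Omega_top d) euclidean f"
  obtains M where "0 \<le> M" "\<forall>x\<in>Omega d. norm (f x) \<le> M"
proof -
  have "compact (f ` Omega d)"
    using image_compactin[OF _ assms, of "Omega d"] compact_Omega[of d] by (simp add: compact_space_def)
  then have "bounded (f ` Omega d)" by (rule compact_imp_bounded)
  then obtain M where "\<And>x. x \<in> Omega d \<Longrightarrow> norm (f x) \<le> M" by (auto simp: bounded_iff)
  then show thesis using that[of "max M 0"] by (auto simp: le_max_iff_disj)
qed

lemma continuous_integrable:
  fixes f :: "config \<Rightarrow> 'a::{banach, second_countable_topology}"
  assumes \<nu>: "Borel_probability d \<nu>" and f: "continuous_map (Omega_top d) euclidean f"
  shows "integrable \<nu> f"
proof -
  interpret prob_space \<nu> by (rule Borel_probability_space[OF \<nu>])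
  obtain M where "0 \<le> M" "\<forall>x\<in>Omega d. norm (f x) \<le> M" by (rule continuous_Omega_bounded[OF f])
  then show ?thesis
    using continuous_measurable[OF \<nu> f] Borel_probability_space(2)[OF \<nu>]
    by (intro integrable_const_bound[where B = M]) auto
qed

lemma Cc_diagonal_continuous:
  "A \<in> Cc d \<Longrightarrow> continuous_map (Omega_top d) euclidean (\<lambda>x. A (x, x))"
  using continuous_map_compose[OF continuous_map_diagonal Cc_continuous, of A d] by (simp add: o_def)

definition diag_int :: "config measure \<Rightarrow> kernel \<Rightarrow> complex" where
  "diag_int \<nu> A = (LINT x|\<nu>. A (x, x))"

lemma diag_int_integrable:
  "Borel_probability d \<nu> \<Longrightarrow> A \<in> Cc d \<Longrightarrow> integrable \<nu> (\<lambda>x. A (x, x))"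
  by (intro continuous_integrable Cc_diagonal_continuous)

lemma diag_int_le:
  assumes "d \<ge> 1" and \<nu>: "Borel_probability d \<nu>" and A: "A \<in> Cc d"
  shows "cmod (diag_int \<nu> A) \<le> red_norm d A"
proof -
  interpret prob_space \<nu> by (rule Borel_probability_space[OF \<nu>])
  have "cmod (diag_int \<nu> A) \<le> (LINT x|\<nu>. cmod (A (x, x)))"
    unfolding diag_int_def by (rule integral_norm_bound)
  also have "\<dots> \<le> (LINT x|\<nu>. red_norm d A)"
    using diag_int_integrable[OF \<nu> A] diagonal_le_red_norm[OF A] Borel_probability_space(2)[OF \<nu>]
    by (intro integral_mono) auto
  also have "\<dots> = red_norm d A" by (simp add: prob_space)
  finally show ?thesis .
qed

lemma diag_int_diff:
  assumes "Borel_probability d \<nu>" "A \<in> Cc d" "B \<in> Cc d"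
  shows "diag_int \<nu> (\<lambda>g. A g - B g) = diag_int \<nu> A - diag_int \<nu> B"
  unfolding diag_int_def using assms by (intro Bochner_Integration.integral_diff diag_int_integrable)

text \<open>The diagonal integral is 1-Lipschitz for the reduced norm, so it converges along a
  Cauchy sequence and has the same limit along every equivalent one. This makes the definite
  description in \<open>hat\<close> well defined.\<close>

lemma hat_tendsto:
  assumes d: "d \<ge> 1" and \<nu>: "Borel_probability d \<nu>" and a: "a \<in> Cauchy_seqs d"
  shows "(\<lambda>n. diag_int \<nu> (a n)) \<longlonglongrightarrow> hat \<nu> (cls d a)"
proof -
  have le: "dist (diag_int \<nu> A) (diag_int \<nu> B) \<le> red_norm d (\<lambda>g. A g - B g)"
    if "A \<in> Cc d" "B \<in> Cc d" for A B
    using diag_int_le[OF d \<nu> Cc_diff[OF that]] diag_int_diff[OF \<nu> that] by (simp add: dist_norm)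
  note ac = Cauchy_seqsD(1)[OF a]
  have "Cauchy (\<lambda>n. diag_int \<nu> (a n))"
  proof (rule metric_CauchyI)
    fix e :: real assume "e > 0"
    then obtain N where "\<forall>m\<ge>N. \<forall>n\<ge>N. red_norm d (\<lambda>g. a m g - a n g) < e"
      using Cauchy_seqsD(2)[OF a] by blast
    then show "\<exists>N. \<forall>m\<ge>N. \<forall>n\<ge>N. dist (diag_int \<nu> (a m)) (diag_int \<nu> (a n)) < e"
      using le[OF ac ac] by (meson order_le_less_trans)
  qed
  then obtain c where c: "(\<lambda>n. diag_int \<nu> (a n)) \<longlonglongrightarrow> c"
    using Cauchy_convergent convergent_def by blast
  have all: "(\<lambda>n. diag_int \<nu> (b n)) \<longlonglongrightarrow> c" if "b \<in> cls d a" for b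
  proof -
    have b: "b \<in> Cauchy_seqs d" and z: "(\<lambda>n. red_norm d (\<lambda>g. a n g - b n g)) \<longlonglongrightarrow> 0"
      using that by (auto simp: cstar_rel_def)
    have "(\<lambda>n. dist (diag_int \<nu> (a n)) (diag_int \<nu> (b n))) \<longlonglongrightarrow> 0"
      by (rule tendsto_sandwich[OF _ _ tendsto_const z])
        (auto intro!: always_eventually le ac Cauchy_seqsD(1)[OF b])
    then have "(\<lambda>n. diag_int \<nu> (a n) - diag_int \<nu> (b n)) \<longlonglongrightarrow> 0"
      by (simp add: dist_norm tendsto_norm_zero_iff)
    from tendsto_diff[OF c this] show ?thesis by simp
  qed
  \<comment> \<open>The class is not empty; otherwise every number would satisfy the description in
    \<open>hat\<close> and uniqueness would fail.\<close>
  have self: "a \<in> cls d a" using equiv_class_self[OF equiv_cstar_rel[OF d] a] .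
  have "hat \<nu> (cls d a) = c"
    unfolding hat_def diag_int_def[symmetric]
    by (rule the_equality) (use all self LIMSEQ_unique c in blast)+
  then show ?thesis using c by simp
qed

lemma hat_eqI:
  assumes "d \<ge> 1" "Borel_probability d \<nu>" "a \<in> Cauchy_seqs d" "(\<lambda>n. diag_int \<nu> (a n)) \<longlonglongrightarrow> c"
  shows "hat \<nu> (cls d a) = c"
  using LIMSEQ_unique[OF hat_tendsto[OF assms(1-3)] assms(4)] .

lemma hat_embed:
  assumes "d \<ge> 1" "Borel_probability d \<nu>" "A \<in> Cc d"
  shows "hat \<nu> (cstar_embed d A) = diag_int \<nu> A"
  unfolding cstar_embed_def using assms by (intro hat_eqI[where a = "\<lambda>_. A"] const_Cauchy_seqs) auto

text \<open>On the diagonal, \<open>A\<close> times its adjoint is the sum of the squared moduli of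
  the entries in the row of \<open>x\<close>.\<close>

lemma diag_int_positive:
  assumes \<nu>: "Borel_probability d \<nu>" and A: "A \<in> Cc d"
  shows "diag_int \<nu> (kconv d A (kstar A)) \<in> \<real>\<^sub>\<ge>\<^sub>0"
proof -
  obtain N where N: "N \<ge> 1" "supported d N A" by (rule Cc_support[OF A])
  have "kconv d A (kstar A) (x, x) = complex_of_real (\<Sum>z\<in>nbhd d N x. (cmod (A (x, z)))\<^sup>2)"
    if "x \<in> Omega d" for x
  proof -
    have "kconv d A (kstar A) (x, x) = (\<Sum>z\<in>nbhd d N x. A (x, z) * kstar A (z, x))"
      using supportedD[OF N(2)] by (intro kconv_eq[OF G_refl[OF that]]) (metis mult_zero_left)
    then show ?thesis unfolding of_real_sum complex_norm_square kstar_def by simp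
  qed
  then have "diag_int \<nu> (kconv d A (kstar A)) =
      (LINT x|\<nu>. complex_of_real (\<Sum>z\<in>nbhd d N x. (cmod (A (x, z)))\<^sup>2))"
    unfolding diag_int_def using Borel_probability_space(2)[OF \<nu>] by (intro Bochner_Integration.integral_cong) auto
  also have "\<dots> = complex_of_real (LINT x|\<nu>. (\<Sum>z\<in>nbhd d N x. (cmod (A (x, z)))\<^sup>2))"
    by (rule integral_complex_of_real)
  also have "\<dots> \<in> \<real>\<^sub>\<ge>\<^sub>0"
    by (auto intro!: Bochner_Integration.integral_nonneg sum_nonneg simp: complex_nonneg_Reals_iff)
  finally show ?thesis .
qed

lemma hat_is_state:
  assumes d: "d \<ge> 1" and \<nu>: "Borel_probability d \<nu>"
  shows "is_state d (hat \<nu>)"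
  unfolding is_state_def
proof (intro conjI ballI allI)
  note ht = hat_tendsto[OF d \<nu>]
  fix X assume "X \<in> Cstar d"
  then obtain a where a: "a \<in> Cauchy_seqs d" "X = cls d a" by (rule Cstar_cases)
  show "hat \<nu> (cstar_add d X Y) = hat \<nu> X + hat \<nu> Y" if Y: "Y \<in> Cstar d" for Y
  proof -
    obtain b where b: "b \<in> Cauchy_seqs d" "Y = cls d b" using Y by (rule Cstar_cases)
    have "diag_int \<nu> (\<lambda>g. a n g + b n g) = diag_int \<nu> (a n) + diag_int \<nu> (b n)" for n
      unfolding diag_int_def
      by (intro Bochner_Integration.integral_add diag_int_integrable[OF \<nu>] Cauchy_seqsD(1) a b)
    then show ?thesis
      unfolding a(2) b(2) cstar_add_cls(2)[OF d a(1) b(1)]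
      using tendsto_add[OF ht[OF a(1)] ht[OF b(1)]]
      by (intro hat_eqI[OF d \<nu> cstar_add_cls(1)[OF d a(1) b(1)]]) simp
  qed
  show "hat \<nu> (cstar_scale d c X) = c * hat \<nu> X" for c
  proof -
    have "diag_int \<nu> (\<lambda>g. c * a n g) = c * diag_int \<nu> (a n)" for n
      unfolding diag_int_def by (intro integral_mult_right_zero)
    then show ?thesis
      unfolding a(2) cstar_scale_cls(2)[OF d a(1)]
      using tendsto_mult_left[OF ht[OF a(1)], of c]
      by (intro hat_eqI[OF d \<nu> cstar_scale_cls(1)[OF d a(1)]]) simp
  qed
  note s = cstar_star_cls[OF d a(1)] and m = cstar_mult_cls[OF d a(1) cstar_star_cls(1)[OF d a(1)]]
  have "(\<lambda>n. diag_int \<nu> (kconv d (a n) (kstar (a n)))) \<longlonglongrightarrow> hat \<nu> (cstar_mult d X (cstar_star d X))"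
    unfolding a(2) s(2) m(2) using ht[OF m(1)] .
  then show "hat \<nu> (cstar_mult d X (cstar_star d X)) \<in> \<real>\<^sub>\<ge>\<^sub>0"
    by (rule closed_sequentially[OF closed_nonneg_Reals_complex, rotated])
      (rule diag_int_positive[OF \<nu> Cauchy_seqsD(1)[OF a(1)]])
next
  interpret prob_space \<nu> by (rule Borel_probability_space[OF \<nu>])
  have "diag_int \<nu> (kunit d) = (LINT x|\<nu>. 1)"
    unfolding diag_int_def using Borel_probability_space(2)[OF \<nu>]
    by (intro Bochner_Integration.integral_cong) (auto simp: kunit_def indicator_def)
  then show "hat \<nu> (cstar_unit d) = 1"
    unfolding cstar_unit_def hat_embed[OF d \<nu> Cc_kunit] by (simp add: prob_space)
qed

text \<open>The cocycle identity at \<open>(x, x)\<close> forces \<open>W (x, x) = 0\<close>, so the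
  flow leaves diagonal entries unchanged.\<close>

lemma hat_flow_invariant:
  assumes d: "d \<ge> 1" and \<nu>: "Borel_probability d \<nu>" and W: "modular_function d W" and X: "X \<in> Cstar d"
  shows "hat \<nu> (cstar_flow d W t X) = hat \<nu> X"
proof -
  obtain a where a: "a \<in> Cauchy_seqs d" "X = cls d a" using X by (rule Cstar_cases)
  have "W (x, x) = 0" if "x \<in> Omega d" for x
    using W G_refl[OF that] unfolding modular_function_def by (metis add_cancel_left_left)
  then have "diag_int \<nu> (kflow W t (a n)) = diag_int \<nu> (a n)" for n
    unfolding diag_int_def kflow_def using Borel_probability_space(2)[OF \<nu>]
    by (intro Bochner_Integration.integral_cong) auto
  then show ?thesis
    unfolding a(2) cstar_flow_cls(2)[OF d W a(1)]
    using hat_tendsto[OF d \<nu> a(1)] by (intro hat_eqI[OF d \<nu> cstar_flow_cls(1)[OF d W a(1)]]) simp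
qed

subsection \<open>The boundary condition\<close>

text \<open>A Phragmen-Lindelof argument: a Gaussian factor forces decay along the strip, the
  maximum principle applies on a long rectangle, and then the factor is removed. The a priori bound
  \<open>M\<close> is used only on the vertical sides and does not enter the conclusion.\<close>

lemma strip_maximum_modulus:
  fixes f :: "complex \<Rightarrow> complex"
  assumes cont: "continuous_on {z. 0 \<le> Im z \<and> Im z \<le> 1} f"
    and hol: "f holomorphic_on {z. 0 < Im z \<and> Im z < 1}"
    and bd: "\<And>z. 0 \<le> Im z \<Longrightarrow> Im z \<le> 1 \<Longrightarrow> cmod (f z) \<le> M"
    and bdry: "\<And>t. cmod (f (complex_of_real t)) \<le> B" "\<And>t. cmod (f (complex_of_real t + \<i>)) \<le> B"
    and B: "B > 0" and z: "0 \<le> Im z" "Im z \<le> 1"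
  shows "cmod (f z) \<le> B"
proof -
  have e: "cmod (f z) * exp (- \<epsilon> * ((Re z)\<^sup>2 - (Im z)\<^sup>2 + 1)) \<le> B" if \<epsilon>: "\<epsilon> > 0" for \<epsilon> :: real
  proof -
    \<comment> \<open>The modulus of the factor involves
      \<open>(Re w)\<^sup>2 - (Im w)\<^sup>2 + 1\<close>; the summand 1 compensates for
      \<open>(Im w)\<^sup>2\<close>, which is at most 1 on the strip, so the factor never exceeds 1
      in modulus.\<close>
    define h where "h w = f w * exp (- complex_of_real \<epsilon> * (w\<^sup>2 + 1))" for w
    have cmod_h: "cmod (h w) = cmod (f w) * exp (- \<epsilon> * ((Re w)\<^sup>2 - (Im w)\<^sup>2 + 1))" for w
      by (simp add: h_def norm_mult Re_power2)
    have h_le: "cmod (h w) \<le> cmod (f w) * exp (- \<epsilon> * (Re w)\<^sup>2)" if "0 \<le> Im w" "Im w \<le> 1" for w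
    proof -
      have "(Im w)\<^sup>2 \<le> 1" using that by (simp add: power_le_one)
      then have "\<epsilon> * (Re w)\<^sup>2 \<le> \<epsilon> * ((Re w)\<^sup>2 - (Im w)\<^sup>2 + 1)" using \<epsilon> by (intro mult_left_mono) auto
      then show ?thesis unfolding cmod_h by (intro mult_left_mono) auto
    qed
    have M: "0 \<le> M" using bd[OF z] by (meson norm_ge_zero order_trans)
    \<comment> \<open>The half-width \<open>R\<close> is chosen so that the Gaussian pushes
      \<open>M\<close> below \<open>B\<close> on the vertical sides, which is possible since
      \<open>B\<close> is strictly positive, and so that the rectangle contains
      \<open>z\<close>.\<close>
    have "((\<lambda>R. M * exp (- \<epsilon> * R\<^sup>2)) \<longlongrightarrow> 0) at_top" using \<epsilon> by real_asymp
    then have "\<forall>\<^sub>F R in at_top. M * exp (- \<epsilon> * R\<^sup>2) < B" using B by (rule order_tendstoD)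
    moreover have "\<forall>\<^sub>F R in at_top. \<bar>Re z\<bar> \<le> R" by (rule eventually_ge_at_top)
    ultimately have "\<forall>\<^sub>F R in at_top. M * exp (- \<epsilon> * R\<^sup>2) < B \<and> \<bar>Re z\<bar> \<le> R" by (rule eventually_conj)
    then obtain R where R: "M * exp (- \<epsilon> * R\<^sup>2) < B" "\<bar>Re z\<bar> \<le> R"
      by (auto simp: eventually_at_top_linorder)
    define S where "S = cbox (Complex (- R) 0) (Complex R 1)"
    have S_iff: "w \<in> S \<longleftrightarrow> - R \<le> Re w \<and> Re w \<le> R \<and> 0 \<le> Im w \<and> Im w \<le> 1" for w
      by (auto simp: S_def in_cbox_complex_iff)
    have S_int: "w \<in> interior S \<longleftrightarrow> - R < Re w \<and> Re w < R \<and> 0 < Im w \<and> Im w < 1" for w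
      by (auto simp: S_def interior_cbox in_box_complex_iff)
    have "cmod (h z) \<le> B"
    proof (rule maximum_modulus_frontier[of h S])
      show "h holomorphic_on interior S" unfolding h_def
        by (intro holomorphic_intros holomorphic_on_subset[OF hol]) (auto simp: S_int)
      have "closure S = S" by (simp add: S_def)
      then show "continuous_on (closure S) h" unfolding h_def
        by (auto intro!: continuous_intros continuous_on_subset[OF cont] simp: S_iff)
      show "bounded S" by (simp add: S_def)
      show "z \<in> S" using z R by (auto simp: S_iff)
      fix w assume w: "w \<in> frontier S"
      then have wS: "w \<in> S" "w \<notin> interior S" using \<open>closure S = S\<close> by (auto simp: frontier_def)
      then have im: "0 \<le> Im w" "Im w \<le> 1" by (auto simp: S_iff)
      consider "Im w = 0" | "Im w = 1" | "\<bar>Re w\<bar> = R" using wS by (force simp: S_iff S_int)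
      then show "cmod (h w) \<le> B"
      proof cases
        case 3
        have "cmod (h w) \<le> cmod (f w) * exp (- \<epsilon> * (Re w)\<^sup>2)" using h_le[OF im] .
        also have "\<dots> \<le> M * exp (- \<epsilon> * (Re w)\<^sup>2)" using bd[OF im] by (intro mult_right_mono) auto
        also have "(Re w)\<^sup>2 = R\<^sup>2" using 3 by (metis power2_abs)
        finally show ?thesis using R(1) by simp
      next
        case 1
        then have "w = complex_of_real (Re w)" by (simp add: complex_eq_iff)
        then have "cmod (f w) \<le> B" using bdry(1)[of "Re w"] by simp
        moreover have "cmod (f w) * exp (- \<epsilon> * (Re w)\<^sup>2) \<le> cmod (f w) * 1"
          using \<epsilon> by (intro mult_left_mono) auto
        ultimately show ?thesis using h_le[OF im] by simp
      next
        case 2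
        then have "w = complex_of_real (Re w) + \<i>" by (simp add: complex_eq_iff)
        then have "cmod (f w) \<le> B" using bdry(2)[of "Re w"] by simp
        moreover have "cmod (f w) * exp (- \<epsilon> * (Re w)\<^sup>2) \<le> cmod (f w) * 1"
          using \<epsilon> by (intro mult_left_mono) auto
        ultimately show ?thesis using h_le[OF im] by simp
      qed
    qed
    then show ?thesis by (simp add: cmod_h)
  qed
  \<comment> \<open>With \<open>z\<close> fixed, the damping disappears as \<epsilon> tends to 0
    from the right.\<close>
  have "((\<lambda>\<epsilon>. cmod (f z) * exp (- \<epsilon> * ((Re z)\<^sup>2 - (Im z)\<^sup>2 + 1))) \<longlongrightarrow>
      cmod (f z) * exp (- 0 * ((Re z)\<^sup>2 - (Im z)\<^sup>2 + 1))) (at_right 0)"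
    by (intro tendsto_intros)
  then have "cmod (f z) * exp (- 0 * ((Re z)\<^sup>2 - (Im z)\<^sup>2 + 1)) \<le> B"
  proof (rule tendsto_upperbound)
    show "\<forall>\<^sub>F \<epsilon> in at_right 0. cmod (f z) * exp (- \<epsilon> * ((Re z)\<^sup>2 - (Im z)\<^sup>2 + 1)) \<le> B"
      using eventually_at_right_less[of 0] by (rule eventually_mono) (rule e)
  qed simp
  then show ?thesis by simp
qed

text \<open>The exponential is expanded and integrated term by term. As \<open>h\<close> and
  \<open>g\<close> are bounded on the compact space, the terms are dominated by an exponential
  series, and the resulting power series in \<open>z\<close> converges everywhere.\<close>

lemma holomorphic_exp_integral:
  assumes \<nu>: "Borel_probability d \<nu>"
    and h: "continuous_map (Omega_top d) euclideanreal h"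
    and g: "continuous_map (Omega_top d) (euclidean :: complex topology) g"
  shows "(\<lambda>z. LINT x|\<nu>. exp (\<i> * complex_of_real (h x) * z) * g x) holomorphic_on UNIV"
proof -
  interpret prob_space \<nu> by (rule Borel_probability_space[OF \<nu>])
  note sp = Borel_probability_space(2)[OF \<nu>]
  obtain H where H: "0 \<le> H" "\<forall>x\<in>Omega d. norm (h x) \<le> H" by (rule continuous_Omega_bounded[OF h])
  obtain M where M: "0 \<le> M" "\<forall>x\<in>Omega d. norm (g x) \<le> M" by (rule continuous_Omega_bounded[OF g])
  note [measurable] = continuous_measurable[OF \<nu> h] continuous_measurable[OF \<nu> g]
  define c where "c k = (LINT x|\<nu>. (\<i> * complex_of_real (h x)) ^ k / fact k * g x)" for k
  define F where "F z = (LINT x|\<nu>. exp (\<i> * complex_of_real (h x) * z) * g x)" for z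
  have sums: "(\<lambda>k. c k * z ^ k) sums F z" for z
  proof -
    define f where "f k x = (\<i> * complex_of_real (h x)) ^ k / fact k * g x * z ^ k" for k x
    have le: "norm (f k x) \<le> (H * cmod z) ^ k / fact k * M" if "x \<in> Omega d" for k x
    proof -
      have "norm (f k x) = (\<bar>h x\<bar> * cmod z) ^ k / fact k * cmod (g x)"
        by (simp add: f_def norm_mult norm_divide norm_power power_mult_distrib)
      also have "\<dots> \<le> (H * cmod z) ^ k / fact k * M"
        using H M that by (intro mult_mono divide_right_mono power_mono mult_right_mono) auto
      finally show ?thesis .
    qed
    have summ: "summable (\<lambda>k. (H * cmod z) ^ k / fact k * M)"
      using summable_exp[of "H * cmod z"] by (intro summable_mult2) (simp add: divide_inverse mult.commute)
    have int: "integrable \<nu> (f k)" for k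
      using le sp unfolding f_def
      by (intro integrable_const_bound[where B = "(H * cmod z) ^ k / fact k * M"]) auto
    have "(\<lambda>k. integral\<^sup>L \<nu> (f k)) sums (LINT x|\<nu>. (\<Sum>k. f k x))"
    proof (rule sums_integral[OF int])
      show "AE x in \<nu>. summable (\<lambda>k. norm (f k x))"
        using sp le by (intro AE_I2 summable_comparison_test'[OF summ]) auto
      show "summable (\<lambda>k. LINT x|\<nu>. norm (f k x))"
      proof (rule summable_comparison_test'[OF summ])
        fix k
        have "(LINT x|\<nu>. norm (f k x)) \<le> (LINT x|\<nu>. (H * cmod z) ^ k / fact k * M)"
          using sp le int by (intro integral_mono) auto
        then show "norm (LINT x|\<nu>. norm (f k x)) \<le> (H * cmod z) ^ k / fact k * M"
          by (simp add: prob_space)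
      qed
    qed
    moreover have "(\<Sum>k. f k x) = exp (\<i> * complex_of_real (h x) * z) * g x" for x
    proof -
      have "(\<lambda>k. (\<i> * complex_of_real (h x) * z) ^ k /\<^sub>R fact k * g x) sums (exp (\<i> * complex_of_real (h x) * z) * g x)"
        by (intro sums_mult2 exp_converges)
      moreover have "(\<i> * complex_of_real (h x) * z) ^ k /\<^sub>R fact k * g x = f k x" for k
        by (simp add: f_def power_mult_distrib scaleR_conv_of_real divide_inverse)
      ultimately show ?thesis by (simp add: sums_iff)
    qed
    moreover have "integral\<^sup>L \<nu> (f k) = c k * z ^ k" for k
      unfolding f_def c_def by (rule integral_mult_left_zero)
    ultimately show ?thesis by (simp add: F_def)
  qed
  have "F holomorphic_on ball 0 r" for r
    by (rule power_series_holomorphic[where a = c]) (use sums in auto)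
  then have "F holomorphic_on (\<Union>r\<in>UNIV. ball 0 r)"
    by (intro holomorphic_on_UN_open) auto
  moreover have "(\<Union>r\<in>UNIV. ball (0::complex) r) = UNIV"
  proof -
    have "w \<in> ball (0::complex) (norm w + 1)" for w by simp
    then show ?thesis by blast
  qed
  ultimately show ?thesis by (simp add: F_def[abs_def])
qed

text \<open>The exponential has modulus \<open>exp (- (h x * Im z))\<close>, at most
  \<open>exp H\<close> on the strip. This supplies the a priori bound that the maximum principle for
  strips requires.\<close>

lemma exp_integral_bounded:
  assumes \<nu>: "Borel_probability d \<nu>"
    and h: "continuous_map (Omega_top d) euclideanreal h"
    and g: "continuous_map (Omega_top d) (euclidean :: complex topology) g"
  shows "\<exists>M. \<forall>z. 0 \<le> Im z \<longrightarrow> Im z \<le> 1 \<longrightarrow>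
    cmod (LINT x|\<nu>. exp (\<i> * complex_of_real (h x) * z) * g x) \<le> M"
proof -
  interpret prob_space \<nu> by (rule Borel_probability_space[OF \<nu>])
  note sp = Borel_probability_space(2)[OF \<nu>]
  obtain H where H: "0 \<le> H" "\<forall>x\<in>Omega d. norm (h x) \<le> H" by (rule continuous_Omega_bounded[OF h])
  obtain M where M: "0 \<le> M" "\<forall>x\<in>Omega d. norm (g x) \<le> M" by (rule continuous_Omega_bounded[OF g])
  note [measurable] = continuous_measurable[OF \<nu> h] continuous_measurable[OF \<nu> g]
  have "cmod (LINT x|\<nu>. exp (\<i> * complex_of_real (h x) * z) * g x) \<le> exp H * M"
    if z: "0 \<le> Im z" "Im z \<le> 1" for z
  proof -
    have le: "cmod (exp (\<i> * complex_of_real (h x) * z) * g x) \<le> exp H * M" if x: "x \<in> Omega d" for x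
    proof -
      have "- (h x * Im z) \<le> \<bar>h x\<bar> * 1"
        using z mult_mono[of "\<bar>h x\<bar>" "\<bar>h x\<bar>" "\<bar>Im z\<bar>" 1] abs_le_D2[of "h x * Im z"]
        by (simp add: abs_mult)
      also have "\<dots> \<le> H" using H x by simp
      finally have "exp (- (h x * Im z)) \<le> exp H" by simp
      then show ?thesis using M x by (auto simp: norm_mult intro!: mult_mono)
    qed
    have "integrable \<nu> (\<lambda>x. exp (\<i> * complex_of_real (h x) * z) * g x)"
      using le sp by (intro integrable_const_bound[where B = "exp H * M"]) auto
    then have "(LINT x|\<nu>. cmod (exp (\<i> * complex_of_real (h x) * z) * g x)) \<le> (LINT x|\<nu>. exp H * M)"
      using le sp by (intro integral_mono) auto
    with Bochner_Integration.integral_norm_bound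
    have "cmod (LINT x|\<nu>. exp (\<i> * complex_of_real (h x) * z) * g x) \<le> (LINT x|\<nu>. exp H * M)"
      by (rule order_trans)
    then show ?thesis by (simp add: prob_space)
  qed
  then show ?thesis by blast
qed

section \<open>Cylinder decompositions and the Gibbs relation\<close>

lemma cylinder_sets:
  assumes "Borel_probability d \<nu>" "n \<ge> 1" shows "cylinder d n u \<in> sets \<nu>"
  using Borel_probability_space(3)[OF assms(1)] openin_cylinder[OF assms(2)]
  by (auto intro: sigma_sets.Basic)

text \<open>The cylinders over \<open>words d n\<close> partition the space; this connects integrals
  over everything with the Gibbs relation, which is stated cylinder by cylinder.\<close>

lemma integral_cylinders:
  fixes f :: "config \<Rightarrow> complex"
  assumes \<nu>: "Borel_probability d \<nu>" and n: "n \<ge> 1" and f: "continuous_map (Omega_top d) euclidean f"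
  shows "(LINT x|\<nu>. f x) = (\<Sum>u\<in>words d n. LINT x:cylinder d n u|\<nu>. f x)"
proof -
  have "(\<Sum>u\<in>words d n. indicator (cylinder d n u) x *\<^sub>R f x) = f x" if x: "x \<in> Omega d" for x
  proof -
    have "(\<Sum>u\<in>words d n. indicator (cylinder d n u) x *\<^sub>R f x) =
        (\<Sum>u\<in>words d n. if restrict x (block n) = u then f x else 0)"
    proof (rule sum.cong[OF refl])
      fix u assume u: "u \<in> words d n"
      have "x \<in> cylinder d n u \<longleftrightarrow> restrict x (block n) = u"
      proof
        assume "x \<in> cylinder d n u"
        then show "restrict x (block n) = u"
          using u unfolding words_def cylinder_def
          by (intro extensionalityI[of _ "block n"]) (auto simp: PiE_iff)
      next
        assume "restrict x (block n) = u"
        then show "x \<in> cylinder d n u" using x by (auto simp: cylinder_def)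
      qed
      then show "indicator (cylinder d n u) x *\<^sub>R f x = (if restrict x (block n) = u then f x else 0)"
        by (simp add: indicator_def)
    qed
    also have "\<dots> = f x" using restrict_words[OF x] finite_words by simp
    finally show ?thesis .
  qed
  then have "(LINT x|\<nu>. f x) = (LINT x|\<nu>. (\<Sum>u\<in>words d n. indicator (cylinder d n u) x *\<^sub>R f x))"
    using Borel_probability_space(2)[OF \<nu>] by (intro Bochner_Integration.integral_cong) auto
  also have "\<dots> = (\<Sum>u\<in>words d n. LINT x|\<nu>. indicator (cylinder d n u) x *\<^sub>R f x)"
    by (intro Bochner_Integration.integral_sum integrable_mult_indicator cylinder_sets[OF \<nu> n]
      continuous_integrable[OF \<nu> f])
  finally show ?thesis by (simp add: set_lebesgue_integral_def)
qed

lemma conj_map_image_cylinder: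
  assumes "u \<in> words d n" "w \<in> words d n"
  shows "conj_map n w ` cylinder d n u = cylinder d n w"
proof (intro equalityI subsetI)
  fix y assume "y \<in> conj_map n w ` cylinder d n u"
  then show "y \<in> cylinder d n w"
    using conj_map_words[OF _ assms(2)] by (auto simp: cylinder_def conj_map_def)
next
  fix y assume y: "y \<in> cylinder d n w"
  have "conj_map n u y \<in> cylinder d n u"
    using y conj_map_words[OF _ assms(1), of y] by (auto simp: cylinder_def conj_map_def)
  moreover have "y = conj_map n w (conj_map n u y)"
    using y by (auto simp: cylinder_def conj_map_def fun_eq_iff)
  ultimately show "y \<in> conj_map n w ` cylinder d n u" by blast
qed

lemma continuous_map_row:
  assumes "w \<in> words d N" "continuous_map (G_top d) euclidean f"
  shows "continuous_map (Omega_top d) euclidean (\<lambda>x. f (x, conj_map N w x))"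
  using continuous_map_compose[OF continuous_map_Omega_G[OF assms(1)] assms(2)] by (simp add: o_def)

lemma continuous_map_column:
  assumes "w \<in> words d N" "continuous_map (G_top d) euclidean f"
  shows "continuous_map (Omega_top d) euclidean (\<lambda>x. f (conj_map N w x, x))"
  using continuous_map_row[OF assms(1) continuous_map_compose[OF continuous_map_swap assms(2)]]
  by (simp add: o_def)

text \<open>Summed over all pairs of words, the Gibbs relation says that the
  measures \<open>\<Sum>\<^sub>y k(x, y) d\<alpha>(x)\<close> and \<open>\<Sum>\<^sub>x k(x, y) d\<alpha>(y)\<close> on \<open>G d\<close> differ by the density
  \<open>exp (- \<beta> V)\<close>.\<close>

lemma Gibbs_exchange:
  assumes \<alpha>: "Borel_probability d \<alpha>" and gibbs: "Cstar_Gibbs d \<beta> V \<alpha>"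
    and n: "n \<ge> 1" and k: "continuous_map (G_top d) (euclidean :: complex topology) k"
    and V: "continuous_map (G_top d) euclideanreal V"
  shows "(\<Sum>w\<in>words d n. LINT x|\<alpha>. complex_of_real (exp (- \<beta> * V (x, conj_map n w x))) * k (x, conj_map n w x))
    = (\<Sum>w\<in>words d n. LINT y|\<alpha>. k (conj_map n w y, y))"
proof -
  let ?e = "\<lambda>w x. complex_of_real (exp (- \<beta> * V (x, conj_map n w x)))"
  have ce: "continuous_map (Omega_top d) euclidean (?e w)" if "w \<in> words d n" for w
    using continuous_map_compose[OF continuous_map_row[OF that V], of euclidean "\<lambda>s. complex_of_real (exp (- \<beta> * s))"]
    by (simp add: o_def continuous_intros)
  have eq: "(LINT x:cylinder d n u|\<alpha>. ?e w x * k (x, conj_map n w x)) = (LINT y:cylinder d n w|\<alpha>. k (conj_map n u y, y))"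
    if u: "u \<in> words d n" and w: "w \<in> words d n" for u w
  proof -
    \<comment> \<open>On the cylinder of \<open>u\<close> the point \<open>x\<close> is recovered
      from its image by writing \<open>u\<close> back. The integrand thus has the form required by
      the Gibbs relation, with test function \<open>y \<mapsto> k (conj_map n u y, y)\<close>,
      continuous on the whole space.\<close>
    have "(LINT x:cylinder d n u|\<alpha>. ?e w x * k (x, conj_map n w x)) =
        (LINT x:cylinder d n u|\<alpha>. ?e w x * k (conj_map n u (conj_map n w x), conj_map n w x))"
    proof (rule set_lebesgue_integral_cong)
      show "cylinder d n u \<in> sets \<alpha>" by (rule cylinder_sets[OF \<alpha> n])
      have "conj_map n u (conj_map n w x) = x" if "x \<in> cylinder d n u" for x
        using that by (auto simp: conj_map_def cylinder_def fun_eq_iff)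
      then show "\<forall>x. x \<in> cylinder d n u \<longrightarrow> ?e w x * k (x, conj_map n w x) =
          ?e w x * k (conj_map n u (conj_map n w x), conj_map n w x)" by simp
    qed
    also have "\<dots> = (LINT y:conj_map n w ` cylinder d n u|\<alpha>. k (conj_map n u y, y))"
      using gibbs n u w continuous_map_column[OF u k] unfolding Cstar_Gibbs_def by blast
    finally show ?thesis by (simp add: conj_map_image_cylinder[OF u w])
  qed
  have "(\<Sum>w\<in>words d n. LINT x|\<alpha>. ?e w x * k (x, conj_map n w x)) =
      (\<Sum>w\<in>words d n. \<Sum>u\<in>words d n. LINT x:cylinder d n u|\<alpha>. ?e w x * k (x, conj_map n w x))"
    by (intro sum.cong refl integral_cylinders[OF \<alpha> n] continuous_map_mult_euclidean ce continuous_map_row[OF _ k])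
  also have "\<dots> = (\<Sum>w\<in>words d n. \<Sum>u\<in>words d n. LINT y:cylinder d n w|\<alpha>. k (conj_map n u y, y))"
    by (intro sum.cong refl eq)
  \<comment> \<open>The source word \<open>u\<close> now labels the column entry and the target word
    \<open>w\<close> only the cylinder of integration; summing over \<open>w\<close> first restores
    the full integral.\<close>
  also have "\<dots> = (\<Sum>u\<in>words d n. \<Sum>w\<in>words d n. LINT y:cylinder d n w|\<alpha>. k (conj_map n u y, y))"
    by (rule sum.swap)
  also have "\<dots> = (\<Sum>u\<in>words d n. LINT y|\<alpha>. k (conj_map n u y, y))"
    by (intro sum.cong refl integral_cylinders[OF \<alpha> n, symmetric] continuous_map_column[OF _ k])
  finally show ?thesis .
qed

text \<open>The support window of \<open>A\<close> serves for both products, since the flow does not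
  enlarge it and an entry of \<open>A\<close> occurs in every summand. Besides the boundary values,
  the bound on the strip is recorded for later use in the maximum principle.\<close>

lemma KMS_kernels:
  assumes \<alpha>: "Borel_probability d \<alpha>" and gibbs: "Cstar_Gibbs d \<beta> V \<alpha>"
    and V: "continuous_map (G_top d) euclideanreal V"
    and A: "A \<in> Cc d" and B: "B \<in> Cc d" and W: "W = (\<lambda>g. \<beta> * V g)"
  shows "\<exists>F. F holomorphic_on UNIV \<and> (\<exists>M. \<forall>z. 0 \<le> Im z \<longrightarrow> Im z \<le> 1 \<longrightarrow> cmod (F z) \<le> M) \<and>
    (\<forall>t. F (complex_of_real t) = diag_int \<alpha> (kconv d (kflow W t A) B)) \<and>
    (\<forall>t. F (complex_of_real t + \<i>) = diag_int \<alpha> (kconv d B (kflow W t A)))"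
proof -
  note sp = Borel_probability_space(2)[OF \<alpha>]
  obtain N where N: "N \<ge> 1" "supported d N A" by (rule Cc_support[OF A])
  have cW: "continuous_map (G_top d) euclideanreal W"
    unfolding W by (intro continuous_map_mult_euclidean V) auto
  have N': "supported d N (kflow W t A)" for t using N(2) by (simp add: supported_def kflow_def)
  have cA: "continuous_map (G_top d) euclidean A" and cB: "continuous_map (G_top d) euclidean B"
    using A B Cc_continuous by auto
  have cB': "continuous_map (G_top d) euclidean (\<lambda>g. B (prod.swap g))"
    using continuous_map_compose[OF continuous_map_swap cB] by (simp add: o_def)
  define g where "g w x = A (x, conj_map N w x) * B (conj_map N w x, x)" for w x
  define h where "h w x = W (x, conj_map N w x)" for w x
  have ch: "continuous_map (Omega_top d) euclideanreal (h w)" if "w \<in> words d N" for w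
    unfolding h_def by (rule continuous_map_row[OF that cW])
  have cg: "continuous_map (Omega_top d) euclidean (g w)" if "w \<in> words d N" for w
    unfolding g_def using continuous_map_row[OF that continuous_map_mult_euclidean[OF cA cB']] by simp
  define F where "F z = (\<Sum>w\<in>words d N. LINT x|\<alpha>. exp (\<i> * complex_of_real (h w x) * z) * g w x)" for z
  have "F holomorphic_on UNIV"
    unfolding F_def by (intro holomorphic_on_sum holomorphic_exp_integral[OF \<alpha>] ch cg)
  moreover have "\<exists>M. \<forall>z. 0 \<le> Im z \<longrightarrow> Im z \<le> 1 \<longrightarrow> cmod (F z) \<le> M"
  proof -
    have "\<forall>w\<in>words d N. \<exists>M. \<forall>z. 0 \<le> Im z \<longrightarrow> Im z \<le> 1 \<longrightarrow>
        cmod (LINT x|\<alpha>. exp (\<i> * complex_of_real (h w x) * z) * g w x) \<le> M"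
      using exp_integral_bounded[OF \<alpha> ch cg] by blast
    then obtain M where M: "\<forall>w\<in>words d N. \<forall>z. 0 \<le> Im z \<longrightarrow> Im z \<le> 1 \<longrightarrow>
        cmod (LINT x|\<alpha>. exp (\<i> * complex_of_real (h w x) * z) * g w x) \<le> M w" by (auto dest!: bchoice)
    have "cmod (F z) \<le> (\<Sum>w\<in>words d N. M w)" if "0 \<le> Im z" "Im z \<le> 1" for z
      unfolding F_def using M that by (intro sum_norm_le) auto
    then show ?thesis by blast
  qed
  moreover have "F (complex_of_real t) = diag_int \<alpha> (kconv d (kflow W t A) B)" for t
  proof -
    have kf: "continuous_map (G_top d) euclidean (kflow W t A)"
      by (rule Cc_continuous[OF Cc_kflow[OF A cW]])
    have "diag_int \<alpha> (kconv d (kflow W t A) B) =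
        (LINT x|\<alpha>. (\<Sum>w\<in>words d N. kflow W t A (x, conj_map N w x) * B (conj_map N w x, x)))"
      unfolding diag_int_def
    proof (rule Bochner_Integration.integral_cong[OF refl])
      fix x assume "x \<in> space \<alpha>"
      then have x: "x \<in> Omega d" using sp by simp
      have "kconv d (kflow W t A) B (x, x) = (\<Sum>z\<in>nbhd d N x. kflow W t A (x, z) * B (z, x))"
        using supportedD[OF N'] by (intro kconv_eq[OF G_refl[OF x]]) (metis mult_zero_left)
      then show "kconv d (kflow W t A) B (x, x) = (\<Sum>w\<in>words d N. kflow W t A (x, conj_map N w x) * B (conj_map N w x, x))"
        using sum_nbhd[OF x, of "\<lambda>z. kflow W t A (x, z) * B (z, x)" N] by simp
    qed
    also have "\<dots> = (\<Sum>w\<in>words d N. LINT x|\<alpha>. kflow W t A (x, conj_map N w x) * B (conj_map N w x, x))"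
      using continuous_map_row[OF _ continuous_map_mult_euclidean[OF kf cB']]
      by (intro Bochner_Integration.integral_sum continuous_integrable[OF \<alpha>]) simp
    also have "\<dots> = F (complex_of_real t)"
      unfolding F_def g_def h_def kflow_def by (simp add: mult.assoc)
    finally show ?thesis by simp
  qed
  moreover have "F (complex_of_real t + \<i>) = diag_int \<alpha> (kconv d B (kflow W t A))" for t
  proof -
    have kf: "continuous_map (G_top d) euclidean (kflow W t A)"
      by (rule Cc_continuous[OF Cc_kflow[OF A cW]])
    \<comment> \<open>With \<open>k (x, y)\<close> the product of \<open>kflow W t A (x, y)\<close>
      and \<open>B (y, x)\<close>, row sums of \<open>k\<close> give the diagonal of one product and
      column sums the diagonal of the product in the opposite order. At time \<open>t + \<i>\<close>
      the row sums also carry the weight that the Gibbs relation removes.\<close>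
    define k where "k g = kflow W t A g * B (prod.swap g)" for g
    have k: "continuous_map (G_top d) euclidean k"
      unfolding k_def by (rule continuous_map_mult_euclidean[OF kf cB'])
    have "F (complex_of_real t + \<i>) = (\<Sum>w\<in>words d N. LINT x|\<alpha>.
        complex_of_real (exp (- \<beta> * V (x, conj_map N w x))) * k (x, conj_map N w x))"
      unfolding F_def
    proof (intro sum.cong refl Bochner_Integration.integral_cong)
      fix w x
      have "\<i> * complex_of_real (h w x) * (complex_of_real t + \<i>) =
          complex_of_real (- h w x) + \<i> * complex_of_real (h w x * t)"
        by (simp add: algebra_simps)
      then have "exp (\<i> * complex_of_real (h w x) * (complex_of_real t + \<i>)) =
          complex_of_real (exp (- h w x)) * exp (\<i> * complex_of_real (h w x * t))"
        by (simp only: exp_add exp_of_real)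
      then show "exp (\<i> * complex_of_real (h w x) * (complex_of_real t + \<i>)) * g w x =
          complex_of_real (exp (- \<beta> * V (x, conj_map N w x))) * k (x, conj_map N w x)"
        by (simp add: k_def kflow_def h_def g_def W mult.assoc)
    qed
    also have "\<dots> = (\<Sum>w\<in>words d N. LINT y|\<alpha>. k (conj_map N w y, y))"
      by (rule Gibbs_exchange[OF \<alpha> gibbs N(1) k V])
    also have "\<dots> = (LINT y|\<alpha>. (\<Sum>w\<in>words d N. k (conj_map N w y, y)))"
      by (intro Bochner_Integration.integral_sum[symmetric] continuous_integrable[OF \<alpha>] continuous_map_column[OF _ k])
    also have "\<dots> = diag_int \<alpha> (kconv d B (kflow W t A))"
      unfolding diag_int_def
    proof (rule Bochner_Integration.integral_cong[OF refl])
      fix y assume "y \<in> space \<alpha>"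
      then have y: "y \<in> Omega d" using sp by simp
      have "kconv d B (kflow W t A) (y, y) = (\<Sum>z\<in>nbhd d N y. B (y, z) * kflow W t A (z, y))"
        using supportedD[OF N'] band_sym by (intro kconv_eq[OF G_refl[OF y]]) (metis mult_zero_right)
      then show "(\<Sum>w\<in>words d N. k (conj_map N w y, y)) = kconv d B (kflow W t A) (y, y)"
        using sum_nbhd[OF y, of "\<lambda>z. B (y, z) * kflow W t A (z, y)" N] by (simp add: k_def mult.commute)
    qed
    finally show ?thesis .
  qed
  ultimately show ?thesis by blast
qed

section \<open>From kernels to the completion\<close>

lemma diag_int_kconv_diff:
  assumes d: "d \<ge> 1" and \<nu>: "Borel_probability d \<nu>"
    and AB: "A \<in> Cc d" "B \<in> Cc d" "A' \<in> Cc d" "B' \<in> Cc d"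
    and M: "red_norm d B \<le> M" "red_norm d A' \<le> M"
    and e: "red_norm d (\<lambda>g. A g - A' g) \<le> e" "red_norm d (\<lambda>g. B g - B' g) \<le> e"
  shows "cmod (diag_int \<nu> (kconv d A B) - diag_int \<nu> (kconv d A' B')) \<le> 2 * M * e"
proof -
  have "cmod (diag_int \<nu> (kconv d A B) - diag_int \<nu> (kconv d A' B')) \<le>
      red_norm d (\<lambda>g. kconv d A B g - kconv d A' B' g)"
    using diag_int_le[OF d \<nu> Cc_diff] diag_int_diff[OF \<nu>] AB Cc_kconv by metis
  also have "\<dots> \<le> red_norm d (\<lambda>g. A g - A' g) * red_norm d B + red_norm d A' * red_norm d (\<lambda>g. B g - B' g)"
    by (rule red_norm_kconv_diff[OF d AB])
  also have "\<dots> \<le> e * M + M * e"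
    using M e red_norm_nonneg[OF d AB(2)] red_norm_nonneg[OF d AB(3)]
      red_norm_nonneg[OF d Cc_diff[OF AB(1,3)]] red_norm_nonneg[OF d Cc_diff[OF AB(2,4)]]
    by (intro add_mono mult_mono) auto
  finally show ?thesis by simp
qed

lemma KMS_hat:
  assumes d: "d \<ge> 1" and \<alpha>: "Borel_probability d \<alpha>" and gibbs: "Cstar_Gibbs d \<beta> V \<alpha>"
    and V: "modular_function d V" and W: "W = (\<lambda>g. \<beta> * V g)" and modW: "modular_function d W"
  shows "KMS_condition d W (hat \<alpha>)"
  unfolding KMS_condition_def
proof (intro conjI allI ballI)
  show "X \<in> Cstar d \<Longrightarrow> hat \<alpha> (cstar_flow d W t X) = hat \<alpha> X" for X t
    by (rule hat_flow_invariant[OF d \<alpha> modW])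
  fix X Y assume X: "X \<in> Cstar d" and Y: "Y \<in> Cstar d"
  obtain a where a: "a \<in> Cauchy_seqs d" "X = cls d a" using X by (rule Cstar_cases)
  obtain b where b: "b \<in> Cauchy_seqs d" "Y = cls d b" using Y by (rule Cstar_cases)
  note ac = Cauchy_seqsD(1)[OF a(1)] and bc = Cauchy_seqsD(1)[OF b(1)]
  note cV = modular_continuous[OF V]
  have fc: "kflow W t (a n) \<in> Cc d" for t n by (rule Cc_kflow[OF ac modular_continuous[OF modW]])
  have "\<forall>n. \<exists>F. F holomorphic_on UNIV \<and> (\<exists>M. \<forall>z. 0 \<le> Im z \<longrightarrow> Im z \<le> 1 \<longrightarrow> cmod (F z) \<le> M) \<and>
      (\<forall>t. F (complex_of_real t) = diag_int \<alpha> (kconv d (kflow W t (a n)) (b n))) \<and>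
      (\<forall>t. F (complex_of_real t + \<i>) = diag_int \<alpha> (kconv d (b n) (kflow W t (a n))))"
    by (intro allI KMS_kernels[OF \<alpha> gibbs cV ac bc W])
  then obtain F where F: "\<And>n. F n holomorphic_on UNIV"
      "\<And>n. \<exists>M. \<forall>z. 0 \<le> Im z \<longrightarrow> Im z \<le> 1 \<longrightarrow> cmod (F n z) \<le> M"
      "\<And>n t. F n (complex_of_real t) = diag_int \<alpha> (kconv d (kflow W t (a n)) (b n))"
      "\<And>n t. F n (complex_of_real t + \<i>) = diag_int \<alpha> (kconv d (b n) (kflow W t (a n)))"
    by (auto dest!: choice)
  define S where "S = {z. 0 \<le> Im z \<and> Im z \<le> 1}"
  define S' where "S' = {z. 0 < Im z \<and> Im z < 1}"
  obtain M1 where M1: "0 \<le> M1" "\<forall>n. red_norm d (a n) \<le> M1" by (rule Cauchy_seqs_bounded[OF d a(1)])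
  obtain M2 where M2: "0 \<le> M2" "\<forall>n. red_norm d (b n) \<le> M2" by (rule Cauchy_seqs_bounded[OF d b(1)])
  \<comment> \<open>The \<open>+ 1\<close> makes \<open>M\<close> positive, as it becomes a divisor
    below.\<close>
  define M where "M = max M1 M2 + 1"
  have M: "M > 0" "\<And>n. red_norm d (a n) \<le> M" "\<And>n. red_norm d (b n) \<le> M"
    using M1 M2 by (auto simp: M_def intro: add_increasing2 simp: le_max_iff_disj)
  have Mf: "red_norm d (kflow W t (a n)) \<le> M" for t n
    using red_norm_kflow[OF d ac modW] M(2) order_trans by blast
  have "uniformly_Cauchy_on S F"
    unfolding uniformly_Cauchy_on_def
  proof (intro allI impI)
    fix e :: real assume e: "e > 0"
    \<comment> \<open>\<open>diag_int_kconv_diff\<close> bounds the difference by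
      \<open>2 * M * e'\<close>, which is \<open>e / 2\<close>: positive, as the maximum principle
      demands of its bound, and strictly below \<open>e\<close>.\<close>
    define e' where "e' = e / (4 * M)"
    have e': "e' > 0" "2 * M * e' = e / 2" using e M(1) by (auto simp: e'_def)
    obtain N1 where N1: "\<forall>m\<ge>N1. \<forall>n\<ge>N1. red_norm d (\<lambda>g. a m g - a n g) < e'"
      using Cauchy_seqsD(2)[OF a(1) e'(1)] by auto
    obtain N2 where N2: "\<forall>m\<ge>N2. \<forall>n\<ge>N2. red_norm d (\<lambda>g. b m g - b n g) < e'"
      using Cauchy_seqsD(2)[OF b(1) e'(1)] by auto
    have "dist (F m z) (F n z) < e" if z: "z \<in> S" and mn: "m \<ge> max N1 N2" "n \<ge> max N1 N2" for m n z
    proof -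
      have da: "red_norm d (\<lambda>g. kflow W t (a m) g - kflow W t (a n) g) \<le> e'" for t
        using red_norm_kflow_diff[OF d modW ac[of m] ac[of n], of t] N1 mn
        by (meson max.boundedE less_imp_le order_trans)
      have db: "red_norm d (\<lambda>g. b m g - b n g) \<le> e'"
        using N2 mn by (meson max.boundedE less_imp_le)
      obtain K1 where K1: "\<forall>z. 0 \<le> Im z \<longrightarrow> Im z \<le> 1 \<longrightarrow> cmod (F m z) \<le> K1" using F(2) by blast
      obtain K2 where K2: "\<forall>z. 0 \<le> Im z \<longrightarrow> Im z \<le> 1 \<longrightarrow> cmod (F n z) \<le> K2" using F(2) by blast
      have "cmod (F m z - F n z) \<le> e / 2"
      proof (rule strip_maximum_modulus[where f = "\<lambda>z. F m z - F n z" and M = "K1 + K2"])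
        show "(\<lambda>z. F m z - F n z) holomorphic_on {z. 0 < Im z \<and> Im z < 1}"
          using F(1) by (auto intro!: holomorphic_on_diff intro: holomorphic_on_subset)
        show "continuous_on {z. 0 \<le> Im z \<and> Im z \<le> 1} (\<lambda>z. F m z - F n z)"
          using F(1) by (auto intro!: continuous_on_diff intro: holomorphic_on_imp_continuous_on holomorphic_on_subset)
        show "cmod (F m z - F n z) \<le> K1 + K2" if "0 \<le> Im z" "Im z \<le> 1" for z
          using K1 K2 that norm_triangle_ineq4[of "F m z" "F n z"] by force
        show "cmod (F m (complex_of_real t) - F n (complex_of_real t)) \<le> e / 2" for t
          unfolding F(3) e'(2)[symmetric] by (intro diag_int_kconv_diff[OF d \<alpha>] fc bc M Mf da db)
        show "cmod (F m (complex_of_real t + \<i>) - F n (complex_of_real t + \<i>)) \<le> e / 2" for t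
          unfolding F(4) e'(2)[symmetric] by (intro diag_int_kconv_diff[OF d \<alpha>] fc bc M Mf da db)
      qed (use e z in \<open>auto simp: S_def\<close>)
      then show ?thesis using e by (simp add: dist_norm)
    qed
    then show "\<exists>N. \<forall>z\<in>S. \<forall>m\<ge>N. \<forall>n\<ge>N. dist (F m z) (F n z) < e" by blast
  qed
  then obtain f where f: "uniform_limit S F f sequentially"
    using Cauchy_uniformly_convergent uniformly_convergent_on_def by blast
  have "continuous_on S f"
  proof (rule uniform_limit_theorem[OF _ f])
    show "\<forall>\<^sub>F n in sequentially. continuous_on S (F n)"
      using F(1) holomorphic_on_imp_continuous_on holomorphic_on_subset by (intro always_eventually) blast
  qed simp
  moreover have "f holomorphic_on S'"
  proof (rule holomorphic_uniform_sequence)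
    have "S' = {z. 0 < Im z} \<inter> {z. Im z < 1}" by (auto simp: S'_def)
    then show o: "open S'" by (simp add: open_halfspace_Im_gt open_halfspace_Im_lt open_Int)
    show "F n holomorphic_on S'" for n using F(1) holomorphic_on_subset by blast
    fix z assume "z \<in> S'"
    then obtain r where r: "r > 0" "cball z r \<subseteq> S'" using o open_contains_cball by blast
    \<comment> \<open>Uniform convergence is available on the whole closed strip, in particular on
      every closed disc inside the open one.\<close>
    moreover have "S' \<subseteq> S" by (auto simp: S_def S'_def)
    ultimately have "uniform_limit (cball z r) F f sequentially"
      using uniform_limit_on_subset[OF f] by blast
    then show "\<exists>r>0. cball z r \<subseteq> S' \<and> uniform_limit (cball z r) F f sequentially" using r by blast
  qed
  moreover have "hat \<alpha> (cstar_mult d (cstar_flow d W t X) Y) = f (complex_of_real t)" for t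
  proof -
    note fl = cstar_flow_cls[OF d modW a(1)]
    note m = cstar_mult_cls[OF d fl(1) b(1)]
    have "complex_of_real t \<in> S" by (simp add: S_def)
    \<comment> \<open>The numbers \<open>F n t\<close> are the diagonal integrals of the termwise
      products representing the class on the left, so their limit is its value under
      \<open>hat\<close>.\<close>
    from tendsto_uniform_limitI[OF f this] show ?thesis
      unfolding a(2) b(2) fl(2) m(2) F(3) by (rule hat_eqI[OF d \<alpha> m(1)])
  qed
  moreover have "hat \<alpha> (cstar_mult d Y (cstar_flow d W t X)) = f (complex_of_real t + \<i>)" for t
  proof -
    note fl = cstar_flow_cls[OF d modW a(1)]
    note m = cstar_mult_cls[OF d b(1) fl(1)]
    have "complex_of_real t + \<i> \<in> S" by (simp add: S_def)
    from tendsto_uniform_limitI[OF f this] show ?thesis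
      unfolding a(2) b(2) fl(2) m(2) F(4) by (rule hat_eqI[OF d \<alpha> m(1)])
  qed
  ultimately show "\<exists>F. continuous_on {z. 0 \<le> Im z \<and> Im z \<le> 1} F \<and>
      F holomorphic_on {z. 0 < Im z \<and> Im z < 1} \<and>
      (\<forall>t. hat \<alpha> (cstar_mult d (cstar_flow d W t X) Y) = F (complex_of_real t) \<and>
        hat \<alpha> (cstar_mult d Y (cstar_flow d W t X)) = F (complex_of_real t + \<i>))"
    unfolding S_def S'_def by blast
qed

theorem theorem34:
  fixes d :: nat and V :: "config \<times> config \<Rightarrow> real" and \<beta> :: real and \<alpha> :: "config measure"
  assumes "d \<ge> 1"
    and "modular_function d V"
    and "Borel_probability d \<alpha>"
    and "Cstar_Gibbs d \<beta> V \<alpha>"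
  shows "modular_function d (\<lambda>g. \<beta> * V g) \<and> KMS_probability d (\<lambda>g. \<beta> * V g) \<alpha>"
proof
  have c: "continuous_map (G_top d) euclideanreal (\<lambda>g. \<beta> * V g)"
    using continuous_map_mult_euclidean[OF _ modular_continuous[OF assms(2)], of "\<lambda>_. \<beta>"] by simp
  have add: "\<beta> * V (x, y) + \<beta> * V (y, z) = \<beta> * V (x, z)" if "(x, y) \<in> G d" "(y, z) \<in> G d" for x y z
  proof -
    have "V (x, y) + V (y, z) = V (x, z)" using assms(2) that by (simp add: modular_function_def)
    then show ?thesis by (metis distrib_left)
  qed
  show W: "modular_function d (\<lambda>g. \<beta> * V g)"
    unfolding modular_function_def using c add by blast
  show "KMS_probability d (\<lambda>g. \<beta> * V g) \<alpha>"
    unfolding KMS_probability_def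
    using assms hat_embed[OF assms(1,3)] hat_is_state[OF assms(1,3)]
      KMS_hat[OF assms(1,3,4,2) refl W]
    by (simp add: diag_int_def)
qed

end
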